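(* Let $\Gamma$ and $\Lambda$ be finitely generated groups, and let $\Gamma\curvearrowright M$ and $\Lambda\curvearrowright N$ be essentially free actions by isometries on compact Riemannian manifolds. If the associated warped cones are quasi-isometric, then $\Gamma\times\mathbb{Z}^{\dim(M)}$ is quasi-isometric to $\Lambda\times\mathbb{Z}^{\dim(N)}$.
   Context: Finitely generated groups are equipped with word metrics. Warped cones: let $\Gamma$ be a group with finite symmetric generating set $S$, acting on a compact Riemannian manifold $M$ with Riemannian distance $d$. For $t\ge1$ let $d^t=t\,d$. The $t$-level of the warped cone of the action is the metric space $(M,\delta^t_\Gamma)$, where $\delta^t_\Gamma$ is the largest metric on $M$ satisfying $\delta^t_\Gamma(x,y)\le d^t(x,y)$ for all $x,y\in M$ and $\delta^t_\Gamma(x,s\cdot x)\le 1$ for all $x\in M$, $s\in S$. (Different finite generating sets give quasi-isometric warped cones.) Similarly for $\Lambda\curvearrowright N$ and $\delta^s_\Lambda$. Quasi-isometry of the warped cones is understood at the level of these families of level sets: there are increasing diverging sequences $(t_k)$ and $(s_k)$ in $[1,\infty)$ (not required to be equal) such that the sequences $\{(M,\delta^{t_k}_\Gamma)\}_k$ and $\{(N,\delta^{s_k}_\Lambda)\}_k$ are uniformly quasi-isometric. An action is essentially free if the set of points with nontrivial stabilizer has measure zero (for the Riemannian volume). A map $f\colon X\to Y$ between metric spaces is an $(L,A)$-quasi-isometry, where $L\ge1$ and $A\ge0$, if $\frac1L d(x_1,x_2)-A\le d(f(x_1),f(x_2))\le L\,d(x_1,x_2)+A$ for all $x_1,x_2\in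 X$ and every point of $Y$ is at distance at most $A$ from $f(X)$. Two spaces are quasi-isometric if there is a quasi-isometry between them; two sequences $(X_k)$, $(Y_k)$ of metric spaces are uniformly quasi-isometric if there are $(L,A)$-quasi-isometries $X_k\to Y_k$ with constants $L,A$ independent of $k$. *)

theory Defs
  imports "HOL-Analysis.Analysis" "HOL-Algebra.Product_Groups" "HOL-Algebra.Group_Action" "HOL-Combinatorics.Permutations"
begin

section \<open>Quasi-isometries\<close>

definition quasi_isometry ::
  "real \<Rightarrow> real \<Rightarrow> 'a set \<Rightarrow> ('a \<Rightarrow> 'a \<Rightarrow> real) \<Rightarrow> 'b set \<Rightarrow> ('b \<Rightarrow> 'b \<Rightarrow> real) \<Rightarrow> ('a \<Rightarrow> 'b) \<Rightarrow> bool"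
  where "quasi_isometry L A X dX Y dY f \<longleftrightarrow>
    1 \<le> L \<and> 0 \<le> A \<and> f ` X \<subseteq> Y \<and>
    (\<forall>x\<in>X. \<forall>y\<in>X. dX x y / L - A \<le> dY (f x) (f y) \<and> dY (f x) (f y) \<le> L * dX x y + A) \<and>
    (\<forall>y\<in>Y. \<exists>x\<in>X. dY y (f x) \<le> A)"

definition quasi_isometric ::
  "'a set \<Rightarrow> ('a \<Rightarrow> 'a \<Rightarrow> real) \<Rightarrow> 'b set \<Rightarrow> ('b \<Rightarrow> 'b \<Rightarrow> real) \<Rightarrow> bool"
  where "quasi_isometric X dX Y dY \<longleftrightarrow> (\<exists>L A f. quasi_isometry L A X dX Y dY f)"

definition uniformly_quasi_isometric ::
  "(nat \<Rightarrow> 'a set) \<Rightarrow> (nat \<Rightarrow> 'a \<Rightarrow> 'a \<Rightarrow> real) \<Rightarrow> (nat \<Rightarrow> 'b set) \<Rightarrow> (nat \<Rightarrow> 'b \<Rightarrow> 'b \<Rightarrow> real) \<Rightarrow> bool"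
  where "uniformly_quasi_isometric X dX Y dY \<longleftrightarrow>
    (\<exists>L A. \<forall>k. \<exists>f. quasi_isometry L A (X k) (dX k) (Y k) (dY k) f)"

section \<open>Word metrics\<close>

definition finite_symmetric_generating_set :: "('g, 'x) monoid_scheme \<Rightarrow> 'g set \<Rightarrow> bool"
  where "finite_symmetric_generating_set G S \<longleftrightarrow>
    finite S \<and> S \<subseteq> carrier G \<and> (\<forall>s\<in>S. m_inv G s \<in> S) \<and> generate G S = carrier G"

definition word_length :: "('g, 'x) monoid_scheme \<Rightarrow> 'g set \<Rightarrow> 'g \<Rightarrow> nat"
  where "word_length G S g =
    (LEAST n. \<exists>ws. set ws \<subseteq> S \<and> length ws = n \<and> foldr (monoid.mult G) ws \<one>\<^bsub>G\<^esub> = g)"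

definition word_metric :: "('g, 'x) monoid_scheme \<Rightarrow> 'g set \<Rightarrow> 'g \<Rightarrow> 'g \<Rightarrow> real"
  where "word_metric G S g h = real (word_length G S (m_inv G g \<otimes>\<^bsub>G\<^esub> h))"

text \<open>Both groups are required to be finitely generated, so that the quantification over all
  choices of word metrics is never vacuous.\<close>

definition quasi_isometric_groups :: "('g, 'x) monoid_scheme \<Rightarrow> ('h, 'y) monoid_scheme \<Rightarrow> bool"
  where "quasi_isometric_groups G H \<longleftrightarrow>
    (\<exists>S. finite_symmetric_generating_set G S) \<and>
    (\<exists>T. finite_symmetric_generating_set H T) \<and>
    (\<forall>S T. finite_symmetric_generating_set G S \<longrightarrow> finite_symmetric_generating_set H T \<longrightarrow>
       quasi_isometric (carrier G) (word_metric G S) (carrier H) (word_metric H T))"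

definition free_abelian_of_rank :: "nat \<Rightarrow> (nat \<Rightarrow> int) monoid"
  where "free_abelian_of_rank n = product_group {..<n} (\<lambda>_. integer_group)"

section \<open>Smooth functions on open subsets of Euclidean space\<close>

text \<open>Points of $n$-dimensional space are functions on \<open>{..<n}\<close>, extended by \<open>undefined\<close>, so that the
  dimension is a natural number (zero allowed) and the carrier agrees with that of the
  product measure \<open>PiM {..<n} (\<lambda>_. lborel)\<close>, which is Lebesgue measure.\<close>

definition real_space :: "nat \<Rightarrow> (nat \<Rightarrow> real) topology"
  where "real_space n = product_topology (\<lambda>_. euclideanreal) {..<n}"

definition partial_deriv :: "nat \<Rightarrow> ((nat \<Rightarrow> real) \<Rightarrow> real) \<Rightarrow> (nat \<Rightarrow> real) \<Rightarrow> real"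
  where "partial_deriv i f x = deriv (\<lambda>s. f (x(i := s))) (x i)"

text \<open>\<open>Ck_on n V k f\<close>: \<open>f\<close> is of class $C^k$ on the open set \<open>V\<close> of $n$-dimensional space.\<close>

primrec Ck_on :: "nat \<Rightarrow> (nat \<Rightarrow> real) set \<Rightarrow> nat \<Rightarrow> ((nat \<Rightarrow> real) \<Rightarrow> real) \<Rightarrow> bool" where
  "Ck_on n V 0 f = continuous_map (subtopology (real_space n) V) euclideanreal f"
| "Ck_on n V (Suc k) f =
    (continuous_map (subtopology (real_space n) V) euclideanreal f \<and>
     (\<forall>i<n. (\<forall>x\<in>V. (\<lambda>s. f (x(i := s))) differentiable (at (x i))) \<and>
            Ck_on n V k (partial_deriv i f)))"

definition smooth_fun_on :: "nat \<Rightarrow> (nat \<Rightarrow> real) set \<Rightarrow> ((nat \<Rightarrow> real) \<Rightarrow> real) \<Rightarrow> bool"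
  where "smooth_fun_on n V f \<longleftrightarrow> (\<forall>k. Ck_on n V k f)"

section \<open>Riemannian manifolds\<close>

text \<open>A chart is a pair of its domain and its coordinate map. The metric tensor is given by its
  components: \<open>metric_tensor M c p i j\<close> is $g_{ij}$ at the point \<open>p\<close> in the coordinates of the
  chart \<open>c\<close>.\<close>

type_synonym 'a chart = "'a set \<times> ('a \<Rightarrow> nat \<Rightarrow> real)"

record 'a riemannian_structure =
  mtop :: "'a topology"
  mdim :: nat
  atlas :: "'a chart set"
  metric_tensor :: "'a chart \<Rightarrow> 'a \<Rightarrow> nat \<Rightarrow> nat \<Rightarrow> real"

abbreviation points :: "'a riemannian_structure \<Rightarrow> 'a set"
  where "points M \<equiv> topspace (mtop M)"

abbreviation cdom :: "'a chart \<Rightarrow> 'a set"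
  where "cdom \<equiv> fst"

abbreviation coord :: "'a chart \<Rightarrow> 'a \<Rightarrow> nat \<Rightarrow> real"
  where "coord \<equiv> snd"

abbreviation coord_inv :: "'a chart \<Rightarrow> (nat \<Rightarrow> real) \<Rightarrow> 'a"
  where "coord_inv c \<equiv> inv_into (cdom c) (coord c)"

definition is_chart :: "'a topology \<Rightarrow> nat \<Rightarrow> 'a chart \<Rightarrow> bool"
  where "is_chart X n c \<longleftrightarrow>
    openin X (cdom c) \<and> openin (real_space n) (coord c ` cdom c) \<and>
    homeomorphic_map (subtopology X (cdom c)) (subtopology (real_space n) (coord c ` cdom c)) (coord c)"

definition transition :: "'a chart \<Rightarrow> 'a chart \<Rightarrow> (nat \<Rightarrow> real) \<Rightarrow> nat \<Rightarrow> real"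
  where "transition c c' u = coord c' (coord_inv c u)"

definition smooth_manifold :: "'a riemannian_structure \<Rightarrow> bool"
  where "smooth_manifold M \<longleftrightarrow>
    points M \<noteq> {} \<and> Hausdorff_space (mtop M) \<and> second_countable (mtop M) \<and>
    (\<forall>c\<in>atlas M. is_chart (mtop M) (mdim M) c) \<and>
    (\<Union>c\<in>atlas M. cdom c) = points M \<and>
    (\<forall>c\<in>atlas M. \<forall>c'\<in>atlas M. \<forall>i<mdim M.
       smooth_fun_on (mdim M) (coord c ` (cdom c \<inter> cdom c')) (\<lambda>u. transition c c' u i))"

definition quadratic_form :: "'a riemannian_structure \<Rightarrow> 'a chart \<Rightarrow> 'a \<Rightarrow> (nat \<Rightarrow> real) \<Rightarrow> real"
  where "quadratic_form M c p v =
    (\<Sum>i<mdim M. \<Sum>j<mdim M. metric_tensor M c p i j * v i * v j)"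

definition riemannian_metric :: "'a riemannian_structure \<Rightarrow> bool"
  where "riemannian_metric M \<longleftrightarrow>
    (\<forall>c\<in>atlas M.
       (\<forall>i<mdim M. \<forall>j<mdim M.
          smooth_fun_on (mdim M) (coord c ` cdom c) (\<lambda>u. metric_tensor M c (coord_inv c u) i j)) \<and>
       (\<forall>p\<in>cdom c. \<forall>i<mdim M. \<forall>j<mdim M. metric_tensor M c p i j = metric_tensor M c p j i) \<and>
       (\<forall>p\<in>cdom c. \<forall>v. (\<exists>i<mdim M. v i \<noteq> 0) \<longrightarrow> 0 < quadratic_form M c p v)) \<and>
    (\<forall>c\<in>atlas M. \<forall>c'\<in>atlas M. \<forall>p\<in>cdom c \<inter> cdom c'. \<forall>i<mdim M. \<forall>j<mdim M.
       metric_tensor M c p i j =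
         (\<Sum>k<mdim M. \<Sum>l<mdim M.
            partial_deriv i (\<lambda>u. transition c c' u k) (coord c p) *
            partial_deriv j (\<lambda>u. transition c c' u l) (coord c p) *
            metric_tensor M c' p k l))"

definition compact_riemannian_manifold :: "'a riemannian_structure \<Rightarrow> bool"
  where "compact_riemannian_manifold M \<longleftrightarrow>
    smooth_manifold M \<and> riemannian_metric M \<and> compact_space (mtop M)"

subsection \<open>Riemannian distance\<close>

definition C1_on_interval :: "'a riemannian_structure \<Rightarrow> (real \<Rightarrow> 'a) \<Rightarrow> real \<Rightarrow> real \<Rightarrow> bool"
  where "C1_on_interval M \<gamma> a b \<longleftrightarrow>
    (\<forall>c\<in>atlas M. \<forall>u v. a \<le> u \<and> u \<le> v \<and> v \<le> b \<and> \<gamma> ` {u..v} \<subseteq> cdom c \<longrightarrow>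
       (\<forall>i<mdim M. \<exists>D. continuous_on {u..v} D \<and>
          (\<forall>t\<in>{u..v}. ((\<lambda>\<tau>. coord c (\<gamma> \<tau>) i) has_real_derivative D t) (at t within {u..v}))))"

definition piecewise_C1_curve :: "'a riemannian_structure \<Rightarrow> (real \<Rightarrow> 'a) \<Rightarrow> bool"
  where "piecewise_C1_curve M \<gamma> \<longleftrightarrow>
    pathin (mtop M) \<gamma> \<and>
    (\<exists>K (\<tau> :: nat \<Rightarrow> real). \<tau> 0 = 0 \<and> \<tau> K = 1 \<and>
       (\<forall>k<K. \<tau> k < \<tau> (Suc k) \<and> C1_on_interval M \<gamma> (\<tau> k) (\<tau> (Suc k))))"

text \<open>The speed of a curve is independent of the chart by the transformation law of the metric
  tensor; it is unspecified at the (finitely many) times where the curve is not differentiable.\<close>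

definition curve_speed :: "'a riemannian_structure \<Rightarrow> (real \<Rightarrow> 'a) \<Rightarrow> real \<Rightarrow> real"
  where "curve_speed M \<gamma> t =
    (THE s. \<exists>c\<in>atlas M. \<exists>v. \<gamma> t \<in> cdom c \<and>
       (\<forall>i<mdim M. ((\<lambda>\<tau>. coord c (\<gamma> \<tau>) i) has_real_derivative v i) (at t)) \<and>
       s = sqrt (quadratic_form M c (\<gamma> t) v))"

definition curve_length :: "'a riemannian_structure \<Rightarrow> (real \<Rightarrow> 'a) \<Rightarrow> real"
  where "curve_length M \<gamma> = integral {0..1} (curve_speed M \<gamma>)"

text \<open>Infinite between different components.\<close>

definition riemannian_dist :: "'a riemannian_structure \<Rightarrow> 'a \<Rightarrow> 'a \<Rightarrow> ennreal"
  where "riemannian_dist M x y =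
    (INF \<gamma>\<in>{\<gamma>. piecewise_C1_curve M \<gamma> \<and> \<gamma> 0 = x \<and> \<gamma> 1 = y}. ennreal (curve_length M \<gamma>))"

subsection \<open>Riemannian volume\<close>

text \<open>Determinant of the leading $n \times n$ block, by the Leibniz formula.\<close>

definition det_upto :: "nat \<Rightarrow> (nat \<Rightarrow> nat \<Rightarrow> real) \<Rightarrow> real"
  where "det_upto n a = (\<Sum>\<pi> | \<pi> permutes {..<n}. of_int (sign \<pi>) * (\<Prod>i<n. a i (\<pi> i)))"

text \<open>The Riemannian volume is the unique Borel measure that has density $\sqrt{\det g}$ in every
  chart.\<close>

definition is_riemannian_volume :: "'a riemannian_structure \<Rightarrow> 'a measure \<Rightarrow> bool"
  where "is_riemannian_volume M vol \<longleftrightarrow>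
    space vol = points M \<and>
    sets vol = sigma_sets (points M) {U. openin (mtop M) U} \<and>
    (\<forall>c\<in>atlas M. \<forall>B\<in>sets vol. B \<subseteq> cdom c \<longrightarrow>
       emeasure vol B =
         (\<integral>\<^sup>+u\<in>coord c ` B.
            ennreal (sqrt (det_upto (mdim M) (metric_tensor M c (coord_inv c u))))
          \<partial>PiM {..<mdim M} (\<lambda>_. lborel)))"

section \<open>Actions\<close>

definition isometric_action ::
  "('g, 'x) monoid_scheme \<Rightarrow> 'a riemannian_structure \<Rightarrow> ('g \<Rightarrow> 'a \<Rightarrow> 'a) \<Rightarrow> bool"
  where "isometric_action G M \<phi> \<longleftrightarrow>
    group_action G (points M) \<phi> \<and>
    (\<forall>g\<in>carrier G. \<forall>x\<in>points M. \<forall>y\<in>points M.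
       riemannian_dist M (\<phi> g x) (\<phi> g y) = riemannian_dist M x y)"

definition essentially_free ::
  "('g, 'x) monoid_scheme \<Rightarrow> 'a riemannian_structure \<Rightarrow> ('g \<Rightarrow> 'a \<Rightarrow> 'a) \<Rightarrow> bool"
  where "essentially_free G M \<phi> \<longleftrightarrow>
    (\<exists>vol. is_riemannian_volume M vol \<and>
       {x \<in> points M. stabilizer G \<phi> x \<noteq> {\<one>\<^bsub>G\<^esub>}} \<in> null_sets vol)"

section \<open>Warped cones\<close>

definition warped_admissible ::
  "'g set \<Rightarrow> ('g \<Rightarrow> 'a \<Rightarrow> 'a) \<Rightarrow> 'a riemannian_structure \<Rightarrow> real \<Rightarrow> ('a \<Rightarrow> 'a \<Rightarrow> real) \<Rightarrow> bool"
  where "warped_admissible S \<phi> M t \<rho> \<longleftrightarrow>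
    Metric_space (points M) \<rho> \<and>
    (\<forall>x\<in>points M. \<forall>y\<in>points M. ennreal (\<rho> x y) \<le> ennreal t * riemannian_dist M x y) \<and>
    (\<forall>x\<in>points M. \<forall>s\<in>S. \<rho> x (\<phi> s x) \<le> 1)"

text \<open>\<open>\<delta>\<close> is the largest admissible metric; it is determined on \<open>points M\<close>.\<close>

definition warped_metric ::
  "'g set \<Rightarrow> ('g \<Rightarrow> 'a \<Rightarrow> 'a) \<Rightarrow> 'a riemannian_structure \<Rightarrow> real \<Rightarrow> ('a \<Rightarrow> 'a \<Rightarrow> real) \<Rightarrow> bool"
  where "warped_metric S \<phi> M t \<delta> \<longleftrightarrow>
    warped_admissible S \<phi> M t \<delta> \<and>
    (\<forall>\<rho>. warped_admissible S \<phi> M t \<rho> \<longrightarrow> (\<forall>x\<in>points M. \<forall>y\<in>points M. \<rho> x y \<le> \<delta> x y))"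

definition warped_cones_quasi_isometric ::
  "'g set \<Rightarrow> ('g \<Rightarrow> 'a \<Rightarrow> 'a) \<Rightarrow> 'a riemannian_structure \<Rightarrow>
   'h set \<Rightarrow> ('h \<Rightarrow> 'b \<Rightarrow> 'b) \<Rightarrow> 'b riemannian_structure \<Rightarrow> bool"
  where "warped_cones_quasi_isometric S \<phi> M T \<psi> N \<longleftrightarrow>
    (\<exists>(t :: nat \<Rightarrow> real) (s :: nat \<Rightarrow> real) \<delta> \<epsilon>.
       incseq t \<and> filterlim t at_top sequentially \<and> (\<forall>k. 1 \<le> t k) \<and>
       incseq s \<and> filterlim s at_top sequentially \<and> (\<forall>k. 1 \<le> s k) \<and>
       (\<forall>k. warped_metric S \<phi> M (t k) (\<delta> k)) \<and>
       (\<forall>k. warped_metric T \<psi> N (s k) (\<epsilon> k)) \<and>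
       uniformly_quasi_isometric (\<lambda>_. points M) \<delta> (\<lambda>_. points N) \<epsilon>)"

end

(*
  A ball of fixed radius around a point x in the t-level of a warped cone is modelled on the group
  times Z^dim as soon as t is large and no short nontrivial group element moves x by less than a
  fixed amount: the pair (g, v) goes to the translate by g^-1 of the point with coordinates v / t in
  a bi-Lipschitz chart centred at x. So at a point x that is good in M and whose image under the
  given quasi-isometry is good in N, the quasi-isometry of the levels becomes a quasi-isometry
  between large balls of the two product groups, with uniform constants, and a diagonal argument
  produces the global one.

  Points that are good on both sides exist by counting. A maximal separated set in the t-level has at
  least const * t^dim(M) elements, while the bad ones among them carry disjoint balls of radius about
  1 / t inside a set whose volume is arbitrarily small, because the fixed point sets are null; the
  image of the set in N is again separated and coarsely dense, so the same estimate applies in N.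

  Only the bi-Lipschitz class of the Riemannian distance matters, so neither geodesics nor the
  exponential map are needed.
*)
theory Submission
  imports Defs "Jordan_Normal_Form.Determinant" "HOL-Library.Diagonal_Subsequence"
begin

text \<open>The scales \<open>t k\<close>, \<open>s k\<close> and the two dimensions are unrelated a
  priori, and a quasi-isometry transports no measure, so volumes in M and N cannot be compared
  directly. Cardinality is what both sides share: on a net P separated widely enough for the
  quasi-isometry to be injective, \<open>t k ^ n\<close> and \<open>s k ^ m\<close> are each at most
  a constant times \<open>card P\<close>, and this bounds the share of bad points in either space.
  The Riemannian distance is infinite between components. It is replaced by \<open>rdist\<close>,
  the supremum of the pseudometrics below it and below 1. The supremum inherits invariance under the
  action, and the largest metric of a level, divided by t and cut off at 1, is one of its
  competitors. Conversely the explicit metric \<open>orbit_dist\<close> is admissible, so maximality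
  puts it below the largest one. These two comparisons replace any description of the warped metric
  by chains of points. Coordinates carry the l1 distance because on integer vectors it is the word
  metric of the free abelian group for the standard basis.\<close>

definition l1_dist :: "nat \<Rightarrow> (nat \<Rightarrow> real) \<Rightarrow> (nat \<Rightarrow> real) \<Rightarrow> real"
  where "l1_dist n u v = (\<Sum>i<n. \<bar>u i - v i\<bar>)"

lemma l1_dist_nonneg [simp]: "0 \<le> l1_dist n u v"
  by (simp add: l1_dist_def sum_nonneg)

lemma l1_dist_self [simp]: "l1_dist n u u = 0"
  by (simp add: l1_dist_def)

lemma l1_dist_commute: "l1_dist n u v = l1_dist n v u"
  by (simp add: l1_dist_def abs_minus_commute)

lemma l1_dist_triangle: "l1_dist n u w \<le> l1_dist n u v + l1_dist n v w"
  unfolding l1_dist_def sum.distrib[symmetric] by (rule sum_mono) simp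

lemma l1_dist_divide: "0 < t \<Longrightarrow> l1_dist n (\<lambda>i. u i / t) (\<lambda>i. v i / t) = l1_dist n u v / t"
  unfolding l1_dist_def sum_divide_distrib by (intro sum.cong) (auto simp flip: diff_divide_distrib)

section \<open>Coarse geometry of a marked group and of its product with a free abelian
  group\<close>

section \<open>Word lengths\<close>

locale marked_group = group G for G (structure) +
  fixes S assumes gens: "finite_symmetric_generating_set G S"
begin

abbreviation len where "len \<equiv> word_length G S"

lemma finite_gens: "finite S" and gens_closed: "s \<in> S \<Longrightarrow> s \<in> carrier G"
  and gens_inv: "s \<in> S \<Longrightarrow> inv s \<in> S" and generate_gens: "generate G S = carrier G"
  using gens by (auto simp: finite_symmetric_generating_set_def)

lemma word_closed: "set ws \<subseteq> S \<Longrightarrow> foldr (\<otimes>) ws \<one> \<in> carrier G"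
  by (induction ws) (auto simp: gens_closed)

lemma word_append:
  assumes "set us \<subseteq> S" "set vs \<subseteq> S"
  shows "foldr (\<otimes>) (us @ vs) \<one> = foldr (\<otimes>) us \<one> \<otimes> foldr (\<otimes>) vs \<one>"
  using assms by (induction us) (auto simp: word_closed gens_closed m_assoc)

lemma ex_word:
  assumes "g \<in> carrier G" shows "\<exists>ws. set ws \<subseteq> S \<and> foldr (\<otimes>) ws \<one> = g"
proof -
  have "g \<in> generate G S" using assms generate_gens by simp
  then show ?thesis
  proof (induction rule: generate.induct)
    case one
    show ?case by (rule exI[of _ "[]"]) simp
  next
    case (incl h)
    then show ?case by (intro exI[of _ "[h]"]) (simp add: gens_closed)
  next
    case (inv h)
    then show ?case by (intro exI[of _ "[inv h]"]) (simp add: gens_closed gens_inv)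
  next
    case (eng h1 h2)
    then show ?case using word_append by (metis le_sup_iff set_append)
  qed
qed

lemma len_word_le: "set ws \<subseteq> S \<Longrightarrow> len (foldr (\<otimes>) ws \<one>) \<le> length ws"
  unfolding word_length_def by (rule Least_le) auto

lemma ex_shortest_word:
  assumes "g \<in> carrier G"
  shows "\<exists>ws. set ws \<subseteq> S \<and> length ws = len g \<and> foldr (\<otimes>) ws \<one> = g"
proof -
  have "\<exists>n ws. set ws \<subseteq> S \<and> length ws = n \<and> foldr (\<otimes>) ws \<one> = g"
    using ex_word[OF assms] by auto
  from LeastI_ex[OF this] show ?thesis unfolding word_length_def .
qed

lemma len_one [simp]: "len \<one> = 0"
  using len_word_le[of "[]"] by simp

lemma len_eq_0: "g \<in> carrier G \<Longrightarrow> len g = 0 \<longleftrightarrow> g = \<one>"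
  using ex_shortest_word[of g] by auto

lemma len_gen: "s \<in> S \<Longrightarrow> len s \<le> 1"
  using len_word_le[of "[s]"] gens_closed by simp

lemma len_mult:
  assumes "g \<in> carrier G" "h \<in> carrier G" shows "len (g \<otimes> h) \<le> len g + len h"
proof -
  obtain us vs where "set us \<subseteq> S" "length us = len g" "foldr (\<otimes>) us \<one> = g"
    "set vs \<subseteq> S" "length vs = len h" "foldr (\<otimes>) vs \<one> = h"
    using ex_shortest_word assms by meson
  then show ?thesis using len_word_le[of "us @ vs"] word_append[of us vs] by simp
qed

text \<open>Evaluating F along a shortest word costs at most K per letter. Applied to the length of
  the inverse, and later to the height of a product element, it bounds one length function by
  another through the values on generators.\<close>

lemma subadditive_le_len:
  fixes F :: "'a \<Rightarrow> real"
  assumes one: "F \<one> \<le> 0" and K: "\<And>s. s \<in> S \<Longrightarrow> F s \<le> K"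
    and add: "\<And>g h. g \<in> carrier G \<Longrightarrow> h \<in> carrier G \<Longrightarrow> F (g \<otimes> h) \<le> F g + F h"
    and g: "g \<in> carrier G"
  shows "F g \<le> K * len g"
proof -
  have *: "set ws \<subseteq> S \<Longrightarrow> F (foldr (\<otimes>) ws \<one>) \<le> K * length ws" for ws
  proof (induction ws)
    case (Cons s ws)
    then have "F (s \<otimes> foldr (\<otimes>) ws \<one>) \<le> K + K * length ws"
      using add[of s "foldr (\<otimes>) ws \<one>"] K[of s] by (auto simp: gens_closed word_closed)
    then show ?case by (simp add: algebra_simps)
  qed (use one in simp)
  show ?thesis using * ex_shortest_word[OF g] by metis
qed

lemma len_inv:
  assumes g: "g \<in> carrier G" shows "len (inv g) = len g"
proof -
  have le: "len (inv h) \<le> len h" if "h \<in> carrier G" for h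
  proof -
    have "real (len (inv h)) \<le> 1 * real (len h)"
    proof (rule subadditive_le_len[where F="\<lambda>g. real (len (inv g))"])
      show "real (len (inv s)) \<le> 1" if "s \<in> S" for s
        using len_gen[OF gens_inv[OF that]] by simp
      show "real (len (inv (a \<otimes> b))) \<le> real (len (inv a)) + real (len (inv b))"
        if "a \<in> carrier G" "b \<in> carrier G" for a b
        using len_mult[of "inv b" "inv a"] that by (simp add: inv_mult_group)
    qed (use that in auto)
    then show ?thesis by simp
  qed
  from le[OF g] le[of "inv g"] g show ?thesis by simp
qed

lemma finite_len_le: "finite {g \<in> carrier G. len g \<le> r}"
proof (rule finite_subset)
  show "{g \<in> carrier G. len g \<le> r} \<subseteq> (\<lambda>ws. foldr (\<otimes>) ws \<one>) ` {ws. set ws \<subseteq> S \<and> length ws \<le> r}"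
  proof
    fix g assume "g \<in> {g \<in> carrier G. len g \<le> r}"
    then show "g \<in> (\<lambda>ws. foldr (\<otimes>) ws \<one>) ` {ws. set ws \<subseteq> S \<and> length ws \<le> r}"
      using ex_shortest_word[of g] by fastforce
  qed
  show "finite ((\<lambda>ws. foldr (\<otimes>) ws \<one>) ` {ws. set ws \<subseteq> S \<and> length ws \<le> r})"
    using finite_lists_length_le[OF finite_gens] by simp
qed

lemma len_cancel:
  assumes "g \<in> carrier G" "h \<in> carrier G" "k \<in> carrier G"
  shows "len (inv g \<otimes> k) \<le> len (inv g \<otimes> h) + len (inv h \<otimes> k)"
proof -
  have "inv g \<otimes> k = (inv g \<otimes> h) \<otimes> (inv h \<otimes> k)"
    using assms by (simp add: m_assoc[symmetric]) (simp add: m_assoc)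
  with len_mult[of "inv g \<otimes> h" "inv h \<otimes> k"] assms show ?thesis by simp
qed

lemma len_inv_mult_commute:
  assumes "g \<in> carrier G" "h \<in> carrier G"
  shows "len (inv g \<otimes> h) = len (inv h \<otimes> g)"
  using len_inv[of "inv g \<otimes> h"] assms by (simp add: inv_mult_group)

section \<open>The product with a free abelian group\<close>

abbreviation prod_group where "prod_group n \<equiv> G \<times>\<times> free_abelian_of_rank n"

text \<open>The word length of the product for the letters of S in the first factor and plus or
  minus the standard basis vectors in the second. As an explicit natural number it permits
  inductions that split off one letter.\<close>

definition height :: "nat \<Rightarrow> 'a \<times> (nat \<Rightarrow> int) \<Rightarrow> nat"
  where "height n a = len (fst a) + (\<Sum>i<n. nat \<bar>snd a i\<bar>)"

text \<open>The left-invariant distance of \<open>height\<close>, as \<open>height_inv_mult\<close>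
  confirms, with the abelian part written as a real l1 distance, ready for comparison with chart
  coordinates.\<close>

definition prod_dist :: "nat \<Rightarrow> 'a \<times> (nat \<Rightarrow> int) \<Rightarrow> 'a \<times> (nat \<Rightarrow> int) \<Rightarrow> real"
  where "prod_dist n a b =
    len (inv (fst a) \<otimes> fst b) + (\<Sum>i<n. \<bar>real_of_int (snd a i) - real_of_int (snd b i)\<bar>)"

lemma group_free_abelian: "group (free_abelian_of_rank n)"
  unfolding free_abelian_of_rank_def by (simp add: group_integer_group)

lemma group_prod: "group (prod_group n)"
  by (intro DirProd_group is_group group_free_abelian)

lemma carrier_free_abelian [simp]: "carrier (free_abelian_of_rank n) = extensional {..<n}"
  by (auto simp: free_abelian_of_rank_def integer_group_def PiE_def)

lemma one_free_abelian [simp]: "\<one>\<^bsub>free_abelian_of_rank n\<^esub> = (\<lambda>i\<in>{..<n}. 0)"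
  by (simp add: free_abelian_of_rank_def integer_group_def)

lemma mult_free_abelian [simp]:
  "v \<otimes>\<^bsub>free_abelian_of_rank n\<^esub> w = (\<lambda>i\<in>{..<n}. v i + w i)"
  by (simp add: free_abelian_of_rank_def integer_group_def)

lemma fst_mult_prod [simp]: "fst (a \<otimes>\<^bsub>prod_group n\<^esub> b) = fst a \<otimes> fst b"
  by (cases a; cases b) simp

lemma snd_mult_prod [simp]:
  "snd (a \<otimes>\<^bsub>prod_group n\<^esub> b) = (\<lambda>i\<in>{..<n}. snd a i + snd b i)"
  by (cases a; cases b) (simp add: free_abelian_of_rank_def integer_group_def)

lemma one_prod: "\<one>\<^bsub>prod_group n\<^esub> = (\<one>, \<lambda>i\<in>{..<n}. 0)"
  by simp

lemma inv_prod:
  assumes "a \<in> carrier (prod_group n)"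
  shows "inv\<^bsub>prod_group n\<^esub> a = (inv (fst a), \<lambda>i\<in>{..<n}. - snd a i)"
proof -
  interpret P: group "prod_group n" by (rule group_prod)
  show ?thesis
  proof (rule P.inv_equality)
    show "(inv (fst a), \<lambda>i\<in>{..<n}. - snd a i) \<otimes>\<^bsub>prod_group n\<^esub> a = \<one>\<^bsub>prod_group n\<^esub>"
      using assms unfolding one_prod by (intro prod_eqI) (auto simp: mem_Times_iff)
  qed (use assms in \<open>auto simp: mem_Times_iff\<close>)
qed

lemma height_one: "height n \<one>\<^bsub>prod_group n\<^esub> = 0"
  by (simp add: height_def one_prod)

lemma height_mult:
  assumes "a \<in> carrier (prod_group n)" "b \<in> carrier (prod_group n)"
  shows "height n (a \<otimes>\<^bsub>prod_group n\<^esub> b) \<le> height n a + height n b"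
proof -
  have "(\<Sum>i<n. nat \<bar>snd a i + snd b i\<bar>) \<le> (\<Sum>i<n. nat \<bar>snd a i\<bar>) + (\<Sum>i<n. nat \<bar>snd b i\<bar>)"
    unfolding sum.distrib[symmetric] by (rule sum_mono) simp
  with len_mult[of "fst a" "fst b"] assms show ?thesis
    by (simp add: height_def mem_Times_iff)
qed

lemma height_inv:
  assumes "a \<in> carrier (prod_group n)"
  shows "height n (inv\<^bsub>prod_group n\<^esub> a) = height n a"
  using assms by (simp add: inv_prod height_def mem_Times_iff len_inv)

lemma height_inv_mult:
  assumes "a \<in> carrier (prod_group n)" "b \<in> carrier (prod_group n)"
  shows "real (height n (inv\<^bsub>prod_group n\<^esub> a \<otimes>\<^bsub>prod_group n\<^esub> b)) = prod_dist n a b"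
proof -
  have "real (\<Sum>i<n. nat \<bar>- snd a i + snd b i\<bar>) = (\<Sum>i<n. \<bar>real_of_int (snd a i) - real_of_int (snd b i)\<bar>)"
    unfolding of_nat_sum by (intro sum.cong) auto
  then show ?thesis using assms
    by (simp add: height_def prod_dist_def inv_prod del: of_nat_sum)
qed

text \<open>The first letter of a shortest word for the group component is split off. If that word
  is empty, the height sits in the integer vector, and a unit step towards 0 is split off from a
  nonzero coordinate.\<close>

lemma height_factor:
  assumes a: "a \<in> carrier (prod_group n)" and h: "height n a = Suc k"
  shows "\<exists>e\<in>carrier (prod_group n). \<exists>b\<in>carrier (prod_group n).
    height n e \<le> 1 \<and> height n b \<le> k \<and> a = e \<otimes>\<^bsub>prod_group n\<^esub> b"
proof -
  obtain g v where av: "a = (g, v)" by (cases a)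
  have g: "g \<in> carrier G" and v: "v \<in> extensional {..<n}" using a av by (auto simp: mem_Times_iff)
  obtain ws where ws: "set ws \<subseteq> S" "length ws = len g" "foldr (\<otimes>) ws \<one> = g"
    using ex_shortest_word[OF g] by auto
  show ?thesis
  proof (cases ws)
    case (Cons s us)
    define g' where "g' = foldr (\<otimes>) us \<one>"
    have us: "set us \<subseteq> S" "s \<in> S" using ws Cons by auto
    have g': "g' \<in> carrier G" using us word_closed by (simp add: g'_def)
    have "len g' \<le> length us" using len_word_le us by (simp add: g'_def)
    then have lg: "len g' + 1 \<le> len g" using ws Cons by simp
    have "(g, v) = (s, \<lambda>i\<in>{..<n}. 0) \<otimes>\<^bsub>prod_group n\<^esub> (g', v)"
      using ws Cons v by (intro prod_eqI) (auto simp: g'_def extensional_def restrict_def)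
    moreover have "height n (s, \<lambda>i\<in>{..<n}. 0) \<le> 1" using len_gen[OF us(2)] by (simp add: height_def)
    moreover have "height n (g', v) \<le> k" using lg h av by (simp add: height_def)
    ultimately show ?thesis using av g' us v gens_closed
      by (intro bexI[of _ "(s, \<lambda>i\<in>{..<n}. 0)"] bexI[of _ "(g', v)"]) (auto simp: mem_Times_iff)
  next
    case Nil
    then have "len g = 0" using ws by simp
    then have "(\<Sum>i<n. nat \<bar>v i\<bar>) = Suc k" using h av by (simp add: height_def)
    then have "(\<Sum>i<n. nat \<bar>v i\<bar>) \<noteq> 0" by simp
    then have "\<exists>i<n. v i \<noteq> 0"
      by (rule contrapos_np) (auto intro: sum.neutral)
    then obtain i where i: "i < n" "v i \<noteq> 0" by auto
    define w where "w = (\<lambda>j\<in>{..<n}. if j = i then v i - sgn (v i) else v j)"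
    define e where "e = (\<lambda>j\<in>{..<n}. if j = i then sgn (v i) else 0)"
    have "(\<Sum>j<n. nat \<bar>e j\<bar>) = (\<Sum>j<n. if j = i then 1 else 0)"
      using i by (intro sum.cong) (auto simp: e_def sgn_if)
    then have e1: "(\<Sum>j<n. nat \<bar>e j\<bar>) = 1" using i by simp
    have "(\<Sum>j<n. nat \<bar>v j\<bar>) = (\<Sum>j<n. nat \<bar>w j\<bar> + nat \<bar>e j\<bar>)"
      using i by (intro sum.cong) (auto simp: e_def w_def sgn_if)
    then have w1: "(\<Sum>j<n. nat \<bar>v j\<bar>) = (\<Sum>j<n. nat \<bar>w j\<bar>) + 1"
      using e1 by (simp add: sum.distrib)
    have "(g, v) = (\<one>, e) \<otimes>\<^bsub>prod_group n\<^esub> (g, w)"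
      using g v i by (intro prod_eqI) (auto simp: e_def w_def extensional_def restrict_def)
    moreover have "height n (\<one>, e) \<le> 1" using e1 by (simp add: height_def)
    moreover have "height n (g, w) \<le> k" using w1 h av by (simp add: height_def)
    ultimately show ?thesis using av g
      by (intro bexI[of _ "(\<one>, e)"] bexI[of _ "(g, w)"]) (auto simp: mem_Times_iff e_def w_def)
  qed
qed

lemma finite_height_le: "finite {a \<in> carrier (prod_group n). height n a \<le> r}"
proof (rule finite_subset)
  let ?V = "PiE {..<n} (\<lambda>_. {- int r..int r})"
  show "{a \<in> carrier (prod_group n). height n a \<le> r} \<subseteq> {g \<in> carrier G. len g \<le> r} \<times> ?V"
  proof
    fix a assume a: "a \<in> {a \<in> carrier (prod_group n). height n a \<le> r}"
    have "nat \<bar>snd a i\<bar> \<le> r" if "i < n" for i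
      using member_le_sum[of i "{..<n}" "\<lambda>i. nat \<bar>snd a i\<bar>"] that a by (simp add: height_def)
    then have "snd a i \<in> {- int r..int r}" if "i < n" for i using that by fastforce
    then show "a \<in> {g \<in> carrier G. len g \<le> r} \<times> ?V"
      using a by (cases a) (auto simp: mem_Times_iff height_def PiE_iff)
  qed
  show "finite ({g \<in> carrier G. len g \<le> r} \<times> ?V)"
    using finite_len_le by (intro finite_cartesian_product finite_PiE) auto
qed

lemma ex_gens_prod: "\<exists>T. finite_symmetric_generating_set (prod_group n) T"
proof
  \<comment> \<open>The unit ball of the height is finite and closed under inverses, and repeated
    use of \<open>height_factor\<close> shows that it generates.\<close>
  let ?T = "{a \<in> carrier (prod_group n). height n a \<le> 1}"
  interpret P: group "prod_group n" by (rule group_prod)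
  have "a \<in> generate (prod_group n) ?T" if "a \<in> carrier (prod_group n)" for a
    using that
  proof (induction "height n a" arbitrary: a rule: less_induct)
    case less
    show ?case
    proof (cases "height n a")
      case 0
      then show ?thesis using less.prems by (intro generate.incl) auto
    next
      case (Suc k)
      from height_factor[OF less.prems Suc] obtain e b where
        eb: "e \<in> ?T" "b \<in> carrier (prod_group n)" "height n b \<le> k" "a = e \<otimes>\<^bsub>prod_group n\<^esub> b" by blast
      have "b \<in> generate (prod_group n) ?T"
        by (rule less.hyps[OF _ eb(2)]) (use eb(3) Suc in linarith)
      then show ?thesis unfolding eb(4) by (rule generate.eng[OF generate.incl[OF eb(1)]])
    qed
  qed
  moreover have "generate (prod_group n) ?T \<subseteq> carrier (prod_group n)"
    by (rule P.generate_incl) auto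
  ultimately have "generate (prod_group n) ?T = carrier (prod_group n)" by blast
  then show "finite_symmetric_generating_set (prod_group n) ?T"
    unfolding finite_symmetric_generating_set_def
    using finite_height_le[of n 1] height_inv[of _ n] P.inv_closed
    by (intro conjI ballI) simp_all
qed

text \<open>Each of two lengths is at most a multiple of the other, the multiple being its maximum
  over the letters of that other: by splitting off letters in one direction, by subadditivity in the
  other. All word metrics of the product are thus bi-Lipschitz to \<open>prod_dist\<close>.\<close>

lemma word_metric_prod:
  assumes T: "finite_symmetric_generating_set (prod_group n) T"
  shows "\<exists>K\<ge>1. \<forall>a\<in>carrier (prod_group n). \<forall>b\<in>carrier (prod_group n).
    word_metric (prod_group n) T a b \<le> K * prod_dist n a b \<and>
    prod_dist n a b \<le> K * word_metric (prod_group n) T a b"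
proof -
  interpret P: marked_group "prod_group n" T
    using group_prod T by (auto simp: marked_group_def marked_group_axioms_def)
  let ?E = "{a \<in> carrier (prod_group n). height n a \<le> 1}"
  \<comment> \<open>Inserting 1 makes this maximum and the next one well defined and at least 1,
    even for an empty \<open>T\<close>.\<close>
  define K1 where "K1 = Max (insert 1 (P.len ` ?E))"
  have K1: "P.len e \<le> K1" if "e \<in> ?E" for e
    unfolding K1_def using that finite_height_le by (intro Max_ge) auto
  define K2 where "K2 = Max (insert 1 (height n ` T))"
  have K2: "height n e \<le> K2" if "e \<in> T" for e
    unfolding K2_def using that P.finite_gens by (intro Max_ge) auto
  have ge1: "1 \<le> K1" "1 \<le> K2"
    unfolding K1_def K2_def using finite_height_le P.finite_gens by (auto intro!: Max_ge)
  have up: "P.len a \<le> K1 * height n a" if "a \<in> carrier (prod_group n)" for a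
    using that
  proof (induction "height n a" arbitrary: a rule: less_induct)
    case less
    show ?case
    proof (cases "height n a")
      case 0
      then have "len (fst a) = 0" "\<forall>i<n. snd a i = 0" by (auto simp: height_def)
      then have "a = \<one>\<^bsub>prod_group n\<^esub>" using less.prems len_eq_0 unfolding one_prod
        by (intro prod_eqI) (auto simp: mem_Times_iff extensional_def restrict_def)
      then have "P.len a = 0" using P.len_one by metis
      then show ?thesis by simp
    next
      case (Suc k)
      from height_factor[OF less.prems Suc] obtain e b where
        eb: "e \<in> ?E" "b \<in> carrier (prod_group n)" "height n b \<le> k" "a = e \<otimes>\<^bsub>prod_group n\<^esub> b" by blast
      have "P.len b \<le> K1 * height n b" using less.hyps[of b] eb Suc by simp
      also have "\<dots> \<le> K1 * k" using eb by simp
      finally have "P.len b \<le> K1 * k" .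
      then show ?thesis using P.len_mult[of e b] K1[OF eb(1)] eb Suc by simp
    qed
  qed
  have lo: "real (height n a) \<le> real K2 * P.len a" if "a \<in> carrier (prod_group n)" for a
  proof (rule P.subadditive_le_len[OF _ _ _ that])
    show "real (height n (g \<otimes>\<^bsub>prod_group n\<^esub> h)) \<le> real (height n g) + real (height n h)"
      if "g \<in> carrier (prod_group n)" "h \<in> carrier (prod_group n)" for g h
      using height_mult[OF that] by linarith
  qed (use height_one K2 in auto)
  define K where "K = real (max K1 K2)"
  show ?thesis
  proof (intro exI[of _ K] conjI ballI)
    fix a b assume ab: "a \<in> carrier (prod_group n)" "b \<in> carrier (prod_group n)"
    let ?c = "inv\<^bsub>prod_group n\<^esub> a \<otimes>\<^bsub>prod_group n\<^esub> b"
    have c: "?c \<in> carrier (prod_group n)" using ab by (intro P.m_closed P.inv_closed)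
    have "real (P.len ?c) \<le> real K1 * height n ?c" using up[OF c] by (metis of_nat_le_iff of_nat_mult)
    also have "\<dots> \<le> K * height n ?c" by (intro mult_right_mono) (auto simp: K_def)
    finally show "word_metric (prod_group n) T a b \<le> K * prod_dist n a b"
      unfolding word_metric_def using height_inv_mult[OF ab] by simp
    have "real (height n ?c) \<le> K * P.len ?c"
      by (rule order_trans[OF lo[OF c]], intro mult_right_mono) (auto simp: K_def)
    then show "prod_dist n a b \<le> K * word_metric (prod_group n) T a b"
      unfolding word_metric_def using height_inv_mult[OF ab] by simp
  qed (use ge1 in \<open>auto simp: K_def\<close>)
qed

lemma prod_dist_one:
  assumes "a \<in> carrier (prod_group n)"
  shows "prod_dist n \<one>\<^bsub>prod_group n\<^esub> a = height n a"
proof -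
  have "real (\<Sum>i<n. nat \<bar>snd a i\<bar>) = (\<Sum>i<n. \<bar>real_of_int (snd a i)\<bar>)"
    unfolding of_nat_sum by (intro sum.cong) auto
  then show ?thesis using assms
    by (simp add: prod_dist_def height_def mem_Times_iff one_prod del: of_nat_sum)
qed

lemma finite_prod_ball:
  "finite {a \<in> carrier (prod_group n). prod_dist n \<one>\<^bsub>prod_group n\<^esub> a \<le> r}"
proof (rule finite_subset)
  show "{a \<in> carrier (prod_group n). prod_dist n \<one>\<^bsub>prod_group n\<^esub> a \<le> r}
      \<subseteq> {a \<in> carrier (prod_group n). height n a \<le> nat \<lfloor>r\<rfloor>}"
    using prod_dist_one[of _ n] by (auto simp: le_nat_floor simp del: one_DirProd)
qed (rule finite_height_le)

lemma prod_dist_commute: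
  assumes "a \<in> carrier (prod_group n)" "b \<in> carrier (prod_group n)"
  shows "prod_dist n a b = prod_dist n b a"
  using assms len_inv_mult_commute[of "fst a" "fst b"]
  by (simp add: prod_dist_def mem_Times_iff abs_minus_commute)

lemma prod_dist_triangle:
  assumes "a \<in> carrier (prod_group n)" "b \<in> carrier (prod_group n)" "c \<in> carrier (prod_group n)"
  shows "prod_dist n a c \<le> prod_dist n a b + prod_dist n b c"
proof -
  have "(\<Sum>i<n. \<bar>real_of_int (snd a i) - real_of_int (snd c i)\<bar>)
    \<le> (\<Sum>i<n. \<bar>real_of_int (snd a i) - real_of_int (snd b i)\<bar>) + (\<Sum>i<n. \<bar>real_of_int (snd b i) - real_of_int (snd c i)\<bar>)"
    unfolding sum.distrib[symmetric] by (rule sum_mono) simp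
  with len_cancel[of "fst a" "fst b" "fst c"] assms show ?thesis
    by (simp add: prod_dist_def mem_Times_iff)
qed

end

section \<open>Change of metrics, and compactness of families of local quasi-isometries\<close>

section \<open>Quasi-isometries as limits of local ones\<close>

text \<open>A bi-Lipschitz change of both metrics costs the factor K * K' in L and the factor K' in
  A. This carries the result from \<open>prod_dist\<close> to arbitrary word metrics.\<close>

lemma quasi_isometric_change_metrics:
  assumes qi: "quasi_isometric X dX Y dY" and K: "1 \<le> K" and K': "1 \<le> K'"
    and X: "\<And>x y. x \<in> X \<Longrightarrow> y \<in> X \<Longrightarrow> eX x y \<le> K * dX x y \<and> dX x y \<le> K * eX x y"
    and Y: "\<And>x y. x \<in> Y \<Longrightarrow> y \<in> Y \<Longrightarrow> eY x y \<le> K' * dY x y \<and> dY x y \<le> K' * eY x y"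
  shows "quasi_isometric X eX Y eY"
proof -
  obtain L A f where q: "quasi_isometry L A X dX Y dY f"
    using qi unfolding quasi_isometric_def by blast
  have f: "1 \<le> L" "0 \<le> A" "f ` X \<subseteq> Y"
    using q unfolding quasi_isometry_def by blast+
  have d: "dX x y / L - A \<le> dY (f x) (f y) \<and> dY (f x) (f y) \<le> L * dX x y + A"
    if "x \<in> X" "y \<in> X" for x y
    using q that unfolding quasi_isometry_def by blast
  have s: "\<exists>x\<in>X. dY y (f x) \<le> A" if "y \<in> Y" for y
    using q that unfolding quasi_isometry_def by blast
  have "quasi_isometry (K * K' * L) (K' * A) X eX Y eY f"
    unfolding quasi_isometry_def
  proof (intro conjI ballI)
    show "1 \<le> K * K' * L" using f K K' mult_mono[of 1 K 1 K'] mult_mono[of 1 "K * K'" 1 L] by simp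
    show "0 \<le> K' * A" using f K' by simp
    fix x y assume xy: "x \<in> X" "y \<in> X"
    then have fxy: "f x \<in> Y" "f y \<in> Y" using f by auto
    have "eX x y \<le> K * dX x y" using X xy by simp
    also have "dX x y \<le> L * (dY (f x) (f y) + A)"
      using d[OF xy] f by (simp add: field_simps)
    also have "dY (f x) (f y) \<le> K' * eY (f x) (f y)" using Y fxy by simp
    finally have 1: "eX x y \<le> K * (L * (K' * eY (f x) (f y) + A))" using K f by simp
    have "eX x y / (K * K' * L) \<le> K * (L * (K' * eY (f x) (f y) + A)) / (K * K' * L)"
      using 1 K K' f by (intro divide_right_mono) auto
    also have "\<dots> = eY (f x) (f y) + A / K'" using K K' f by (simp add: field_simps)
    also have "A / K' \<le> A" using K' f by (simp add: field_simps mult_le_cancel_left1)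
    also have "A \<le> K' * A" using K' f by (simp add: mult_le_cancel_right1)
    finally show "eX x y / (K * K' * L) - K' * A \<le> eY (f x) (f y)" by simp
    have "eY (f x) (f y) \<le> K' * dY (f x) (f y)" using Y fxy by simp
    also have "dY (f x) (f y) \<le> L * dX x y + A" using d xy by simp
    also have "dX x y \<le> K * eX x y" using X xy by simp
    finally show "eY (f x) (f y) \<le> K * K' * L * eX x y + K' * A"
      using K' f by (simp add: algebra_simps)
  next
    fix y assume "y \<in> Y"
    then obtain x where x: "x \<in> X" "dY y (f x) \<le> A" using s by blast
    then have "eY y (f x) \<le> K' * dY y (f x)" using Y f \<open>y \<in> Y\<close> by blast
    also have "\<dots> \<le> K' * A" using x K' by simp
    finally show "\<exists>x\<in>X. eY y (f x) \<le> K' * A" using x(1) by blast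
  qed (use f in blast)+
  then show ?thesis unfolding quasi_isometric_def by (intro exI)
qed

text \<open>A discrete Tychonoff argument: values eventually confined to a finite set repeat
  infinitely often, so some subsequence is constant at a given point; diagonalising over the
  countable set X serves all points.\<close>

lemma subsequence_pointwise_constant:
  fixes f :: "nat \<Rightarrow> 'a \<Rightarrow> 'b"
  assumes X: "countable X" and fin: "\<And>x. x \<in> X \<Longrightarrow> \<exists>B. finite B \<and> (\<forall>\<^sub>F k in sequentially. f k x \<in> B)"
  shows "\<exists>r g. strict_mono (r :: nat \<Rightarrow> nat) \<and> (\<forall>x\<in>X. \<forall>\<^sub>F k in sequentially. f (r k) x = g x)"
proof (cases "X = {}")
  case True
  then show ?thesis by (intro exI[of _ id]) (auto simp: strict_mono_def)
next
  case False
  define P where "P n s \<longleftrightarrow> (\<exists>b. \<forall>\<^sub>F k in sequentially. f (s k) (from_nat_into X n) = b)" for n s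
  interpret subseqs P
  proof
    fix n and s :: "nat \<Rightarrow> nat" assume s: "strict_mono s"
    define x where "x = from_nat_into X n"
    have "x \<in> X" using False by (simp add: x_def from_nat_into)
    then obtain B where B: "finite B" "\<forall>\<^sub>F k in sequentially. f k x \<in> B" using fin by blast
    have "\<forall>\<^sub>F k in sequentially. f (s k) x \<in> B"
      using filterlim_subseq[OF s] B(2) by (auto simp: filterlim_iff)
    then obtain k0 where k0: "\<And>k. k \<ge> k0 \<Longrightarrow> f (s k) x \<in> B" by (auto simp: eventually_sequentially)
    have "finite ((\<lambda>k. f (s k) x) ` {k0..})"
      by (rule finite_subset[OF _ B(1)]) (use k0 in auto)
    then obtain k1 where "infinite {k \<in> {k0..}. f (s k) x = f (s k1) x}"
      using pigeonhole_infinite[of "{k0..}" "\<lambda>k. f (s k) x"] infinite_Ici by blast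
    then have "infinite {k. f (s k) x = f (s k1) x}"
      by (elim infinite_super[rotated]) auto
    from infinite_enumerate[OF this] obtain r :: "nat \<Rightarrow> nat" where
      r: "strict_mono r" "\<forall>k. r k \<in> {k. f (s k) x = f (s k1) x}" by blast
    then show "\<exists>r. strict_mono r \<and> P n (s \<circ> r)"
      unfolding P_def x_def[symmetric] by (intro exI[of _ r]) auto
  qed
  have "P n diagseq" for n
  proof -
    \<comment> \<open>From index n + 1 on, the diagonal sequence is a subsequence of the one chosen
      for the point with number n; eventual constancy ignores the shift.\<close>
    have "P n (diagseq \<circ> ((+) (Suc n)))"
    proof (rule diagseq_holds)
      fix s r :: "nat \<Rightarrow> nat" and m assume r: "strict_mono r" and "P m s"
      then show "P m (s \<circ> r)" unfolding P_def
        using filterlim_subseq[OF r] by (auto simp: filterlim_iff)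
    qed
    then obtain b where "\<forall>\<^sub>F k in sequentially. f (diagseq (Suc n + k)) (from_nat_into X n) = b"
      unfolding P_def comp_def by (elim exE)
    then obtain N where N: "\<forall>k\<ge>N. f (diagseq (Suc n + k)) (from_nat_into X n) = b"
      unfolding eventually_sequentially ..
    have "f (diagseq k) (from_nat_into X n) = b" if "k \<ge> N + Suc n" for k
      using N[rule_format, of "k - Suc n"] that by simp
    then show ?thesis unfolding P_def eventually_sequentially by blast
  qed
  then have P: "\<exists>b. \<forall>\<^sub>F k in sequentially. f (diagseq k) (from_nat_into X n) = b" for n
    unfolding P_def .
  have "\<forall>x\<in>X. \<exists>b. \<forall>\<^sub>F k in sequentially. f (diagseq k) x = b"
  proof
    fix x assume "x \<in> X"
    then obtain n where "from_nat_into X n = x" using from_nat_into_surj[OF X] by blast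
    then show "\<exists>b. \<forall>\<^sub>F k in sequentially. f (diagseq k) x = b" using P[of n] by simp
  qed
  from bchoice[OF this] subseq_diagseq show ?thesis by blast
qed

text \<open>The local maps send the base point within A of \<open>y0\<close>, so their values at
  each point stay in one ball of Y, which is finite; a pointwise eventually constant subsequence
  then defines the global map. Both inequalities pass to the limit because they concern two points
  at a time. Coarse surjectivity does too, since the approximate preimages of a given point all lie
  in one finite ball of X.\<close>

lemma quasi_isometric_of_local:
  fixes dX :: "'a \<Rightarrow> 'a \<Rightarrow> real" and dY :: "'b \<Rightarrow> 'b \<Rightarrow> real"
  assumes L: "1 \<le> L" and A: "0 \<le> A" and x0: "x0 \<in> X"
    and triY: "\<And>a b c. a \<in> Y \<Longrightarrow> b \<in> Y \<Longrightarrow> c \<in> Y \<Longrightarrow> dY a c \<le> dY a b + dY b c"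
    and finX: "\<And>r. finite {x \<in> X. dX x0 x \<le> r}"
    and finY: "\<And>r. finite {y \<in> Y. dY y0 y \<le> r}" and y0: "y0 \<in> Y"
    and loc: "\<And>R::nat. \<exists>D\<ge>R. \<exists>f. dY y0 (f x0) \<le> A \<and> (\<forall>x\<in>X. dX x0 x \<le> D \<longrightarrow> f x \<in> Y) \<and>
      (\<forall>x\<in>X. \<forall>y\<in>X. dX x0 x \<le> D \<longrightarrow> dX x0 y \<le> D \<longrightarrow>
         dX x y / L - A \<le> dY (f x) (f y) \<and> dY (f x) (f y) \<le> L * dX x y + A) \<and>
      (\<forall>y\<in>Y. dY y0 y \<le> R \<longrightarrow> (\<exists>x\<in>X. dX x0 x \<le> D \<and> dY (f x) y \<le> A \<and> dY y (f x) \<le> A))"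
  shows "quasi_isometric X dX Y dY"
proof -
  from loc obtain D f where D: "\<And>R::nat. real R \<le> D R"
    and f0: "\<And>R::nat. dY y0 (f R x0) \<le> A"
    and fY: "\<And>R x. x \<in> X \<Longrightarrow> dX x0 x \<le> D R \<Longrightarrow> f R x \<in> Y"
    and fqi: "\<And>R x y. x \<in> X \<Longrightarrow> y \<in> X \<Longrightarrow> dX x0 x \<le> D R \<Longrightarrow> dX x0 y \<le> D R \<Longrightarrow>
         dX x y / L - A \<le> dY (f R x) (f R y) \<and> dY (f R x) (f R y) \<le> L * dX x y + A"
    and fs: "\<And>R y. y \<in> Y \<Longrightarrow> dY y0 y \<le> R \<Longrightarrow> \<exists>x\<in>X. dX x0 x \<le> D R \<and> dY (f R x) y \<le> A \<and> dY y (f R x) \<le> A"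
    by metis
  have "X = (\<Union>n. {x \<in> X. dX x0 x \<le> real n})"
    by (simp add: set_eq_iff real_arch_simple)
  moreover have "countable (\<Union>n. {x \<in> X. dX x0 x \<le> real n})"
    by (intro countable_UN countable_finite finX countableI_type)
  ultimately have cX: "countable X" by simp
  have evD: "\<forall>\<^sub>F k in sequentially. r \<le> D k" for r
  proof -
    obtain n where "r \<le> real n" using real_arch_simple by blast
    then show ?thesis using D by (intro eventually_sequentiallyI[of n]) (meson of_nat_mono order_trans)
  qed
  have x0D: "\<forall>\<^sub>F k in sequentially. dX x0 x0 \<le> D k" by (rule evD)
  have bnd: "\<exists>B. finite B \<and> (\<forall>\<^sub>F k in sequentially. f k x \<in> B)" if x: "x \<in> X" for x
  proof (intro exI conjI)
    show "finite {y \<in> Y. dY y0 y \<le> A + (L * dX x0 x + A)}" by (rule finY)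
    show "\<forall>\<^sub>F k in sequentially. f k x \<in> {y \<in> Y. dY y0 y \<le> A + (L * dX x0 x + A)}"
      using evD[of "dX x0 x"] x0D
    proof eventually_elim
      case (elim k)
      have "dY y0 (f k x) \<le> dY y0 (f k x0) + dY (f k x0) (f k x)"
        using elim x x0 y0 fY by (intro triY) auto
      with fqi[OF x0 x, of k] f0[of k] elim x show ?case by (auto intro!: fY)
    qed
  qed
  have "\<exists>r g. strict_mono (r :: nat \<Rightarrow> nat) \<and> (\<forall>x\<in>X. \<forall>\<^sub>F k in sequentially. f (r k) x = g x)"
    by (rule subsequence_pointwise_constant[OF cX bnd])
  then obtain r g where r: "strict_mono (r::nat\<Rightarrow>nat)"
    and rg: "\<forall>x\<in>X. \<forall>\<^sub>F k in sequentially. f (r k) x = g x" by blast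
  have g: "\<forall>\<^sub>F k in sequentially. f (r k) x = g x" if "x \<in> X" for x
    using rg that by simp
  have evDr: "\<forall>\<^sub>F k in sequentially. R \<le> D (r k)" for R
    using filterlim_subseq[OF r] evD[of R] by (auto simp: filterlim_iff)
  have gY: "g x \<in> Y" if "x \<in> X" for x
  proof -
    have "\<forall>\<^sub>F k in sequentially. g x \<in> Y"
      using g[OF that] evDr[of "dX x0 x"] by eventually_elim (use fY that in metis)
    then show ?thesis by simp
  qed
  have gqi: "dX x y / L - A \<le> dY (g x) (g y) \<and> dY (g x) (g y) \<le> L * dX x y + A"
    if "x \<in> X" "y \<in> X" for x y
  proof -
    have "\<forall>\<^sub>F k in sequentially. dX x y / L - A \<le> dY (g x) (g y) \<and> dY (g x) (g y) \<le> L * dX x y + A"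
      using g[OF that(1)] g[OF that(2)] evDr[of "dX x0 x"] evDr[of "dX x0 y"]
      by eventually_elim (use fqi that in metis)
    then show ?thesis by simp
  qed
  have gs: "\<exists>x\<in>X. dY y (g x) \<le> A" if y: "y \<in> Y" for y
  proof -
    define R where "R = L * (A + dY y0 y + A + dY y0 y0 + A + A)"
    \<comment> \<open>By the lower inequality every approximate preimage of y lies in this ball,
      whose radius does not depend on k. The ball is finite, so the maps eventually agree with g on
      all of it at once.\<close>
    let ?B = "{x \<in> X. dX x0 x \<le> L * (dY (g x0) y0 + dY y0 y + 2 * A)}"
    obtain n :: nat where n: "dY y0 y \<le> real n" using real_arch_simple by blast
    have "\<forall>\<^sub>F k in sequentially. \<forall>x\<in>?B. f (r k) x = g x"
      using g by (intro eventually_ball_finite finX) auto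
    moreover have "\<forall>\<^sub>F k in sequentially. n \<le> r k"
      using filterlim_subseq[OF r] by (auto simp: filterlim_at_top)
    ultimately have "\<forall>\<^sub>F k in sequentially. \<exists>x\<in>X. dY y (g x) \<le> A"
      using evDr[of "dX x0 x0"] g[OF x0]
    proof eventually_elim
      case (elim k)
      then have "dY y0 y \<le> real (r k)" using n by linarith
      from fs[OF y this] obtain x where x: "x \<in> X" "dX x0 x \<le> D (r k)"
        "dY (f (r k) x) y \<le> A" "dY y (f (r k) x) \<le> A" by auto
      have "dX x0 x / L - A \<le> dY (g x0) (f (r k) x)"
        using fqi[OF x0 x(1), of "r k"] elim x by auto
      also have "\<dots> \<le> dY (g x0) y0 + (dY y0 y + dY y (f (r k) x))"
        using triY[of "g x0" y0 "f (r k) x"] triY[of y0 y "f (r k) x"] gY[OF x0] y0 y fY[OF x(1,2)] by linarith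
      finally have "dX x0 x \<le> L * (dY (g x0) y0 + dY y0 y + 2 * A)"
        using x(4) L pos_divide_le_eq[of L "dX x0 x" "dY (g x0) y0 + dY y0 y + 2 * A"]
        by (simp add: mult.commute[of L])
      then have "f (r k) x = g x" using elim x by auto
      then show ?case using x by auto
    qed
    then show ?thesis by simp
  qed
  have "quasi_isometry L A X dX Y dY g"
    unfolding quasi_isometry_def using L A gY gqi gs by auto
  then show ?thesis unfolding quasi_isometric_def by (intro exI)
qed

section \<open>Levels of a warped cone under metric-measure axioms\<close>

section \<open>Isometric actions on spaces with uniform bi-Lipschitz charts\<close>

text \<open>The map \<open>\<kappa>\<close> runs from coordinates to the space. One constant serves
  as bi-Lipschitz bound and as scale: 1 / K^2 is the distance at which the bound K keeps coordinates
  below 1 / K.\<close>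

definition lipschitz_chart ::
  "'a set \<Rightarrow> ('a \<Rightarrow> 'a \<Rightarrow> real) \<Rightarrow> nat \<Rightarrow> real \<Rightarrow> 'a \<Rightarrow> ((nat \<Rightarrow> real) \<Rightarrow> 'a) \<Rightarrow> bool"
  where "lipschitz_chart X d n K x \<kappa> \<longleftrightarrow> \<kappa> (\<lambda>_. 0) = x \<and>
    (\<forall>u v. l1_dist n (\<lambda>_. 0) u \<le> 1 / K \<longrightarrow> l1_dist n (\<lambda>_. 0) v \<le> 1 / K \<longrightarrow>
       \<kappa> u \<in> X \<and> d (\<kappa> u) (\<kappa> v) \<le> K * l1_dist n u v \<and> l1_dist n u v \<le> K * d (\<kappa> u) (\<kappa> v)) \<and>
    (\<forall>y\<in>X. d x y < 1 / K\<^sup>2 \<longrightarrow> (\<exists>u. l1_dist n (\<lambda>_. 0) u \<le> 1 / K \<and> y = \<kappa> u))"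

text \<open>The interface between Riemannian and coarse geometry: uniform charts, n-regularity of
  the measure at scales up to 1 / K, an isometric action, and null fixed point sets. The instance
  takes \<open>rdist\<close> for d and the Riemannian volume for the measure.\<close>

locale warped_space = marked_group G S + group_action G X \<phi> + Metric_space X d + finite_measure \<mu>
  for G :: "('a, 'c) monoid_scheme" (structure) and S and \<phi> :: "'a \<Rightarrow> 'b \<Rightarrow> 'b" and X d \<mu> +
  fixes n :: nat and K :: real
  assumes K: "1 \<le> K" and nonempty: "X \<noteq> {}"
    and borel: "openin mtopology U \<Longrightarrow> U \<in> sets \<mu>"
    and isometry: "g \<in> carrier G \<Longrightarrow> x \<in> X \<Longrightarrow> y \<in> X \<Longrightarrow> d (\<phi> g x) (\<phi> g y) = d x y"
    and fix_null: "g \<in> carrier G \<Longrightarrow> g \<noteq> \<one> \<Longrightarrow> {x \<in> X. \<phi> g x = x} \<in> null_sets \<mu>"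
    and ball_lower: "x \<in> X \<Longrightarrow> 0 < r \<Longrightarrow> r \<le> 1 / K \<Longrightarrow> r ^ n \<le> K * measure \<mu> (mball x r)"
    and ball_upper: "x \<in> X \<Longrightarrow> 0 < r \<Longrightarrow> r \<le> 1 / K \<Longrightarrow> measure \<mu> (mball x r) \<le> K * r ^ n"
    and chart: "x \<in> X \<Longrightarrow> \<exists>\<kappa>. lipschitz_chart X d n K x \<kappa>"
begin

lemma act_closed: "g \<in> carrier G \<Longrightarrow> x \<in> X \<Longrightarrow> \<phi> g x \<in> X"
  by (rule element_image[OF _ _ refl])

lemma act_one: "x \<in> X \<Longrightarrow> \<phi> \<one> x = x"
  using id_eq_one by (metis restrict_apply')

lemma act_mult: "g \<in> carrier G \<Longrightarrow> h \<in> carrier G \<Longrightarrow> x \<in> X \<Longrightarrow> \<phi> (g \<otimes> h) x = \<phi> g (\<phi> h x)"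
  using composition_rule by simp

lemma act_inv: "g \<in> carrier G \<Longrightarrow> x \<in> X \<Longrightarrow> \<phi> (inv g) (\<phi> g x) = x"
  using act_mult[of "inv g" g x] act_one by simp

lemma act_inv': "g \<in> carrier G \<Longrightarrow> x \<in> X \<Longrightarrow> \<phi> g (\<phi> (inv g) x) = x"
  using act_mult[of g "inv g" x] act_one by simp

text \<open>Consequences of being the largest admissible metric, in the form in which the coarse
  argument uses them. The upper bound is restricted to \<open>d x y < 1\<close> since d will be cut
  off at 1, and the slack 1 in the last clause replaces an attained infimum over the group.\<close>

definition level :: "real \<Rightarrow> ('b \<Rightarrow> 'b \<Rightarrow> real) \<Rightarrow> bool"
  where "level t \<delta> \<longleftrightarrow> Metric_space X \<delta> \<and>
    (\<forall>x\<in>X. \<forall>y\<in>X. d x y < 1 \<longrightarrow> \<delta> x y \<le> t * d x y) \<and>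
    (\<forall>x\<in>X. \<forall>s\<in>S. \<delta> x (\<phi> s x) \<le> 1) \<and>
    (\<forall>x\<in>X. \<forall>y\<in>X. \<exists>g\<in>carrier G. len g + t * d (\<phi> g x) y \<le> \<delta> x y + 1)"

text \<open>Freeness at x made quantitative; \<open>few_bad_points\<close> shows that separated sets
  of points violating it are small.\<close>

definition good :: "real \<Rightarrow> real \<Rightarrow> 'b \<Rightarrow> bool"
  where "good R \<epsilon> x \<longleftrightarrow> (\<forall>g\<in>carrier G. g \<noteq> \<one> \<longrightarrow> real (len g) \<le> R \<longrightarrow> \<epsilon> \<le> d (\<phi> g x) x)"

lemma good_mono: "good R \<epsilon> x \<Longrightarrow> \<epsilon>' \<le> \<epsilon> \<Longrightarrow> good R \<epsilon>' x"
  unfolding good_def by (meson order_trans)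

text \<open>Each letter of a word is a jump of length at most 1, and the triangle inequality adds
  the jumps up.\<close>

lemma level_act:
  assumes \<delta>: "level t \<delta>" and g: "g \<in> carrier G" and x: "x \<in> X"
  shows "\<delta> x (\<phi> g x) \<le> len g"
proof -
  interpret D: Metric_space X \<delta> using \<delta> by (simp add: level_def)
  have "set ws \<subseteq> S \<Longrightarrow> \<delta> x (\<phi> (foldr (\<otimes>) ws \<one>) x) \<le> length ws" for ws
  proof (induction ws)
    case (Cons s ws)
    define h where "h = foldr (\<otimes>) ws \<one>"
    have h: "h \<in> carrier G" using Cons word_closed by (simp add: h_def)
    have s: "s \<in> S" "s \<in> carrier G" using Cons gens_closed by auto
    have hx: "\<phi> h x \<in> X" using h x by (rule act_closed)
    have "\<delta> x (\<phi> s (\<phi> h x)) \<le> \<delta> x (\<phi> h x) + \<delta> (\<phi> h x) (\<phi> s (\<phi> h x))"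
      using D.triangle[OF x hx act_closed[OF s(2) hx]] .
    also have "\<delta> (\<phi> h x) (\<phi> s (\<phi> h x)) \<le> 1" using \<delta> s hx by (simp add: level_def)
    also have "\<delta> x (\<phi> h x) \<le> length ws" using Cons by (simp add: h_def)
    finally show ?case using act_mult[OF s(2) h x] by (simp add: h_def)
  qed (use x in \<open>simp add: act_one\<close>)
  with ex_shortest_word[OF g] show ?thesis by metis
qed

text \<open>The additive error consists of the rounding error \<open>K * n\<close> of integer
  coordinates and the slack 1 of \<open>level\<close>. In the last clause put E =
  \<open>\<delta> x y + 1\<close>: the group element reaching y has length at most E and the rounded
  vector has size at most K * E + n, and both together must fit into height R.\<close>

definition models :: "real \<Rightarrow> ('b \<Rightarrow> 'b \<Rightarrow> real) \<Rightarrow> 'b \<Rightarrow> ('a \<times> (nat \<Rightarrow> int) \<Rightarrow> 'b) \<Rightarrow> bool"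
  where "models R \<delta> x F \<longleftrightarrow> F \<one>\<^bsub>prod_group n\<^esub> = x \<and>
    (\<forall>a\<in>carrier (prod_group n). real (height n a) \<le> R \<longrightarrow> F a \<in> X) \<and>
    (\<forall>a\<in>carrier (prod_group n). \<forall>b\<in>carrier (prod_group n). real (height n a) \<le> R \<longrightarrow> real (height n b) \<le> R \<longrightarrow>
       prod_dist n a b \<le> K * (\<delta> (F a) (F b) + (K * n + 1)) \<and>
       \<delta> (F a) (F b) \<le> K * prod_dist n a b + (K * n + 1)) \<and>
    (\<forall>y\<in>X. (\<delta> x y + 1) * (1 + K) + n \<le> R \<longrightarrow>
       (\<exists>a\<in>carrier (prod_group n). real (height n a) \<le> R \<and> \<delta> y (F a) \<le> K * n + 1))"

lemma modelsD:
  assumes "models R \<delta> x F"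
  shows "F \<one>\<^bsub>prod_group n\<^esub> = x"
    "a \<in> carrier (prod_group n) \<Longrightarrow> real (height n a) \<le> R \<Longrightarrow> F a \<in> X"
    "a \<in> carrier (prod_group n) \<Longrightarrow> b \<in> carrier (prod_group n) \<Longrightarrow> real (height n a) \<le> R \<Longrightarrow> real (height n b) \<le> R \<Longrightarrow>
       prod_dist n a b \<le> K * (\<delta> (F a) (F b) + (K * n + 1)) \<and>
       \<delta> (F a) (F b) \<le> K * prod_dist n a b + (K * n + 1)"
    "y \<in> X \<Longrightarrow> (\<delta> x y + 1) * (1 + K) + n \<le> R \<Longrightarrow>
       \<exists>a\<in>carrier (prod_group n). real (height n a) \<le> R \<and> \<delta> y (F a) \<le> K * n + 1"
  using assms unfolding models_def by blast+

text \<open>Upper bound: from F (g, v) to F (h, w) one jumps within the orbit by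
  \<open>inv h \<otimes> g\<close>, at the cost of the word distance of g and h, and then moves
  inside the translated chart. Lower bound: an element that nearly realises \<delta> differs from
  \<open>inv h \<otimes> g\<close> by some \<zeta> that almost fixes x, so goodness forces \<zeta>
  to be the unit, and the word part and the chart part separate. Hence the hypotheses:
  \<open>R1\<close> dominates the length of \<zeta>, \<open>\<epsilon> * t\<close> exceeds t times
  its displacement of x, and t is so large that vectors of size R / t lie in the chart.\<close>

lemma local_model:
  fixes R R1 t \<epsilon> :: real
  assumes \<delta>: "level t \<delta>" and x: "x \<in> X" and good: "good R1 \<epsilon> x"
    and R: "1 \<le> R" and R1: "2 * R + 2 * K * R + 1 \<le> R1"
    and t: "2 * K\<^sup>2 * R + 1 \<le> t" "4 * K * R + 1 < \<epsilon> * t"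
  shows "\<exists>F. models R \<delta> x F"
proof -
  interpret D: Metric_space X \<delta> using \<delta> by (simp add: level_def)
  obtain \<kappa> where "lipschitz_chart X d n K x \<kappa>" using chart[OF x] by blast
  then have \<kappa>0: "\<kappa> (\<lambda>_. 0) = x"
    and \<kappa>: "\<And>u v. l1_dist n (\<lambda>_. 0) u \<le> 1 / K \<Longrightarrow> l1_dist n (\<lambda>_. 0) v \<le> 1 / K \<Longrightarrow>
       \<kappa> u \<in> X \<and> d (\<kappa> u) (\<kappa> v) \<le> K * l1_dist n u v \<and> l1_dist n u v \<le> K * d (\<kappa> u) (\<kappa> v)"
    and \<kappa>onto: "\<And>y. y \<in> X \<Longrightarrow> d x y < 1 / K\<^sup>2 \<Longrightarrow> \<exists>u. l1_dist n (\<lambda>_. 0) u \<le> 1 / K \<and> y = \<kappa> u"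
    unfolding lipschitz_chart_def by auto
  have KK: "K \<le> K\<^sup>2" "1 \<le> K\<^sup>2" using K self_le_power[of K 2] one_le_power[of K 2] by auto
  have KR: "R \<le> K * R" "K * R \<le> K\<^sup>2 * R"
    using K KK R by (auto simp: mult_le_cancel_right1 mult_right_mono)
  have t0: "t > 0" "K * R * 2 < t" "R * K \<le> t" "R * K\<^sup>2 \<le> t"
  proof -
    have "2 * K\<^sup>2 * R = 2 * (K\<^sup>2 * R)" by simp
    then have *: "2 * (K\<^sup>2 * R) + 1 \<le> t" using t by simp
    have c: "K * R * 2 = 2 * (K * R)" "R * K = K * R" "R * K\<^sup>2 = K\<^sup>2 * R" by simp_all
    show "t > 0" "K * R * 2 < t" "R * K \<le> t" "R * K\<^sup>2 \<le> t"
      unfolding c using * KR R by linarith+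
  qed
  have \<delta>_le: "\<delta> y z \<le> t * d y z" if "y \<in> X" "z \<in> X" "d y z < 1" for y z
    using \<delta> that by (simp add: level_def)
  define P where "P = (\<lambda>a :: 'a \<times> (nat \<Rightarrow> int). \<kappa> (\<lambda>i. real_of_int (snd a i) / t))"
  define F where "F = (\<lambda>a. \<phi> (inv (fst a)) (P a))"
  have l1P: "l1_dist n (\<lambda>i. real_of_int (v i) / t) (\<lambda>i. real_of_int (w i) / t)
      = (\<Sum>i<n. \<bar>real_of_int (v i) - real_of_int (w i)\<bar>) / t" for v w
    by (subst l1_dist_divide[OF t0(1)]) (simp add: l1_dist_def)
  have P0: "l1_dist n (\<lambda>_. 0) (\<lambda>i. real_of_int (snd a i) / t) \<le> R / t" if "height n a \<le> R" for a :: "'a \<times> (nat \<Rightarrow> int)"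
  proof -
    have "real (\<Sum>i<n. nat \<bar>snd a i\<bar>) = (\<Sum>i<n. \<bar>real_of_int (snd a i)\<bar>)"
      unfolding of_nat_sum by (intro sum.cong) auto
    then have "(\<Sum>i<n. \<bar>real_of_int (snd a i)\<bar>) \<le> R" using that by (simp add: height_def)
    then show ?thesis using l1P[of "\<lambda>_. 0" "snd a"] t0 by (simp add: divide_right_mono)
  qed
  have RtK: "R / t \<le> 1 / K" using t0 K by (simp add: field_simps)
  have PX: "P a \<in> X" if "height n a \<le> R" for a
    using \<kappa>[of "\<lambda>i. real_of_int (snd a i) / t" "\<lambda>i. real_of_int (snd a i) / t"] P0[OF that] RtK
    unfolding P_def by auto
  have Pd: "t * d (P a) (P b) \<le> K * (\<Sum>i<n. \<bar>real_of_int (snd a i) - real_of_int (snd b i)\<bar>)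
      \<and> (\<Sum>i<n. \<bar>real_of_int (snd a i) - real_of_int (snd b i)\<bar>) \<le> K * (t * d (P a) (P b))"
    if "height n a \<le> R" "height n b \<le> R" for a b
    using \<kappa>[of "\<lambda>i. real_of_int (snd a i) / t" "\<lambda>i. real_of_int (snd b i) / t"]
      P0[OF that(1)] P0[OF that(2)] RtK t0(1) l1P[of "snd a" "snd b"]
    unfolding P_def by (auto simp: field_simps)
  have Px: "d x (P a) \<le> K * R / t" if "height n a \<le> R" for a
  proof -
    have "d (\<kappa> (\<lambda>_. 0)) (P a) \<le> K * l1_dist n (\<lambda>_. 0) (\<lambda>i. real_of_int (snd a i) / t)"
      using \<kappa>[of "\<lambda>_. 0" "\<lambda>i. real_of_int (snd a i) / t"] P0[OF that] RtK K
      unfolding P_def by simp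
    also have "\<dots> \<le> K * (R / t)" using P0[OF that] K by (intro mult_left_mono) auto
    finally show ?thesis using \<kappa>0 by simp
  qed
  have PP1: "d (P a) (P b) < 1" if "height n a \<le> R" "height n b \<le> R" for a b
  proof -
    have "d (P a) (P b) \<le> d x (P a) + d x (P b)"
      using triangle[OF PX[OF that(1)] x PX[OF that(2)]] commute[of x "P a"] by simp
    also have "\<dots> \<le> K * R / t + K * R / t" using Px that by (intro add_mono) auto
    also have "\<dots> < 1" using t0 by (simp add: field_simps)
    finally show ?thesis .
  qed
  have FX: "F a \<in> X" if "a \<in> carrier (prod_group n)" "height n a \<le> R" for a
    unfolding F_def using that PX by (intro act_closed) auto
  have upper: "\<delta> (F a) (F b) \<le> K * prod_dist n a b"
    if a: "a \<in> carrier (prod_group n)" "height n a \<le> R" and b: "b \<in> carrier (prod_group n)" "height n b \<le> R" for a b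
  proof -
    obtain g v where av: "a = (g, v)" by (cases a)
    obtain h w where bw: "b = (h, w)" by (cases b)
    have gh: "g \<in> carrier G" "h \<in> carrier G" using a b av bw by auto
    \<comment> \<open>The group part of b applied to the chart point of a: it is in the orbit of
      \<open>F a\<close> and in the same translated chart as \<open>F b\<close>.\<close>
    let ?y = "\<phi> (inv h) (P a)"
    have y: "?y \<in> X" using gh PX a by (intro act_closed) auto
    have "?y = \<phi> (inv h \<otimes> g) (F a)"
      using gh PX a act_mult[of "inv h" g "F a"] FX[OF a] act_inv'[OF gh(1) PX[OF a(2)]]
      by (simp add: F_def av)
    then have 1: "\<delta> (F a) ?y \<le> len (inv g \<otimes> h)"
      using level_act[OF \<delta> _ FX[OF a], of "inv h \<otimes> g"] gh len_inv_mult_commute by simp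
    have d: "d ?y (F b) = d (P a) (P b)"
      unfolding F_def bw fst_conv using gh PX a b bw by (intro isometry) auto
    then have "\<delta> ?y (F b) \<le> t * d (P a) (P b)"
      using \<delta>_le[OF y FX[OF b]] PP1[OF a(2) b(2)] by simp
    also have "\<dots> \<le> K * (\<Sum>i<n. \<bar>real_of_int (v i) - real_of_int (w i)\<bar>)"
      using Pd[OF a(2) b(2)] av bw by simp
    finally have 2: "\<delta> ?y (F b) \<le> K * (\<Sum>i<n. \<bar>real_of_int (v i) - real_of_int (w i)\<bar>)" .
    have "\<delta> (F a) (F b) \<le> len (inv g \<otimes> h) + K * (\<Sum>i<n. \<bar>real_of_int (v i) - real_of_int (w i)\<bar>)"
      using D.triangle[OF FX[OF a] y FX[OF b]] 1 2 by linarith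
    also have "real (len (inv g \<otimes> h)) \<le> K * len (inv g \<otimes> h)"
      using K by (simp add: mult_le_cancel_right1)
    finally show ?thesis by (simp add: prod_dist_def av bw distrib_left)
  qed
  have dist_le: "prod_dist n a b \<le> 2 * R"
    if a: "a \<in> carrier (prod_group n)" "height n a \<le> R" and b: "b \<in> carrier (prod_group n)" "height n b \<le> R" for a b
  proof -
    interpret Q: group "prod_group n" by (rule group_prod)
    have "prod_dist n a b \<le> prod_dist n a \<one>\<^bsub>prod_group n\<^esub> + prod_dist n \<one>\<^bsub>prod_group n\<^esub> b"
      using a b Q.one_closed by (intro prod_dist_triangle)
    also have "prod_dist n a \<one>\<^bsub>prod_group n\<^esub> = height n a"
      using prod_dist_commute[OF a(1) Q.one_closed] prod_dist_one[OF a(1)] by simp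
    finally show ?thesis using a b prod_dist_one[OF b(1)] by linarith
  qed
  have lower: "prod_dist n a b \<le> K * (\<delta> (F a) (F b) + 1)"
    if a: "a \<in> carrier (prod_group n)" "height n a \<le> R" and b: "b \<in> carrier (prod_group n)" "height n b \<le> R" for a b
  proof -
    obtain g v where av: "a = (g, v)" by (cases a)
    obtain h w where bw: "b = (h, w)" by (cases b)
    have gh: "g \<in> carrier G" "h \<in> carrier G" using a b av bw by auto
    obtain \<xi> where \<xi>: "\<xi> \<in> carrier G" "len \<xi> + t * d (\<phi> \<xi> (F a)) (F b) \<le> \<delta> (F a) (F b) + 1"
      using \<delta> FX[OF a] FX[OF b] unfolding level_def by blast
    have "K * prod_dist n a b \<le> K * (2 * R)"
      using dist_le[OF a b] K by (intro mult_left_mono) auto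
    then have bnd: "\<delta> (F a) (F b) \<le> 2 * K * R" using upper[OF a b] by simp
    \<comment> \<open>Applying h to both points turns \<xi> into an element that carries
      \<open>P a\<close> close to \<open>P b\<close>, both of which are near x.\<close>
    define \<zeta> where "\<zeta> = h \<otimes> \<xi> \<otimes> inv g"
    have \<zeta>: "\<zeta> \<in> carrier G" using gh \<xi> by (simp add: \<zeta>_def)
    have "d (\<phi> \<xi> (F a)) (F b) = d (\<phi> h (\<phi> \<xi> (F a))) (\<phi> h (F b))"
      using gh \<xi> FX a b act_closed by (intro isometry[symmetric]) auto
    also have "\<phi> h (F b) = P b" using act_inv' gh PX b by (simp add: F_def bw)
    also have "\<phi> h (\<phi> \<xi> (F a)) = \<phi> \<zeta> (P a)"
      unfolding F_def av fst_conv \<zeta>_def using gh \<xi> PX a av act_closed by (simp add: act_mult)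
    finally have dz: "d (\<phi> \<xi> (F a)) (F b) = d (\<phi> \<zeta> (P a)) (P b)" .
    have "\<zeta> = \<one>"
    proof (rule ccontr)
      assume ne: "\<zeta> \<noteq> \<one>"
      have lh: "len h \<le> R" "len g \<le> R" using a(2) b(2) unfolding height_def av bw fst_conv by linarith+
      have "0 \<le> t * d (\<phi> \<xi> (F a)) (F b)" using t0 by simp
      then have l\<xi>: "len \<xi> \<le> 2 * K * R + 1" using \<xi> bnd by linarith
      have "len \<zeta> \<le> len h + len \<xi> + len g"
        using len_mult[of "h \<otimes> \<xi>" "inv g"] len_mult[of h \<xi>] gh \<xi> len_inv[OF gh(1)]
        by (simp add: \<zeta>_def)
      then have "len \<zeta> \<le> R1" using lh l\<xi> R1 by linarith
      then have "\<epsilon> \<le> d (\<phi> \<zeta> x) x" using good ne \<zeta> by (simp add: good_def)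
      also have "\<dots> \<le> d (\<phi> \<zeta> x) (\<phi> \<zeta> (P a)) + d (\<phi> \<zeta> (P a)) (P b) + d (P b) x"
        using triangle[of "\<phi> \<zeta> x" "\<phi> \<zeta> (P a)" x] triangle[of "\<phi> \<zeta> (P a)" "P b" x] x \<zeta> PX a b act_closed
        by fastforce
      also have "d (\<phi> \<zeta> x) (\<phi> \<zeta> (P a)) = d x (P a)" using \<zeta> x PX a by (intro isometry) auto
      also have "d (P b) x = d x (P b)" by (rule commute)
      finally have "\<epsilon> \<le> K * R / t + d (\<phi> \<xi> (F a)) (F b) + K * R / t"
        using Px[OF a(2)] Px[OF b(2)] dz by linarith
      \<comment> \<open>Scaled by t, the two detours between x and the chart points cost 2 K R, and
        the choice of \<xi> costs at most 2 K R + 1.\<close>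
      then have "\<epsilon> * t \<le> (K * R / t + d (\<phi> \<xi> (F a)) (F b) + K * R / t) * t"
        using t0 by (intro mult_right_mono) auto
      also have "\<dots> = 2 * K * R + t * d (\<phi> \<xi> (F a)) (F b)" using t0 by (simp add: field_simps)
      also have "\<dots> \<le> 4 * K * R + 1" using \<xi> bnd by simp
      finally show False using t by simp
    qed
    then have "h \<otimes> \<xi> = g" using gh \<xi> unfolding \<zeta>_def
      by (metis inv_equality inv_inv m_closed inv_closed)
    then have "\<xi> = inv h \<otimes> g" using gh \<xi> by (metis inv_solve_left)
    then have "len \<xi> = len (inv g \<otimes> h)" using len_inv_mult_commute[OF gh] by simp
    moreover have "d (\<phi> \<xi> (F a)) (F b) = d (P a) (P b)"
      using dz \<open>\<zeta> = \<one>\<close> act_one PX a by simp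
    ultimately have 1: "len (inv g \<otimes> h) + t * d (P a) (P b) \<le> \<delta> (F a) (F b) + 1"
      using \<xi> by simp
    have "(\<Sum>i<n. \<bar>real_of_int (v i) - real_of_int (w i)\<bar>) \<le> K * (t * d (P a) (P b))"
      using Pd[OF a(2) b(2)] av bw by simp
    moreover have "real (len (inv g \<otimes> h)) \<le> K * len (inv g \<otimes> h)"
      using K by (simp add: mult_le_cancel_right1)
    ultimately have "prod_dist n a b \<le> K * (len (inv g \<otimes> h) + t * d (P a) (P b))"
      by (simp add: prod_dist_def av bw distrib_left)
    also have "\<dots> \<le> K * (\<delta> (F a) (F b) + 1)" using 1 K by (intro mult_left_mono) auto
    finally show ?thesis .
  qed
  have onto: "\<exists>a\<in>carrier (prod_group n). height n a \<le> R \<and> \<delta> y (F a) \<le> K * n"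
    if y: "y \<in> X" and Ry: "(\<delta> x y + 1) * (1 + K) + n \<le> R" for y
  proof -
    define E where "E = \<delta> x y + 1"
    have E: "1 \<le> E" "E + K * E + n \<le> R" using Ry by (auto simp: E_def algebra_simps)
    obtain g where g: "g \<in> carrier G" "len g + t * d (\<phi> g x) y \<le> E"
      using \<delta> x y unfolding level_def E_def by blast
    define z where "z = \<phi> (inv g) y"
    have z: "z \<in> X" "\<phi> g z = y" using g y act_closed act_inv' by (auto simp: z_def)
    have "d (\<phi> g x) y = d x z" using isometry[OF g(1) x z(1)] z by simp
    then have tz: "t * d x z \<le> E" "len g \<le> E" using g t0 by (auto simp: zero_le_mult_iff intro: order_trans[rotated])
    \<comment> \<open>Together with t at least K^2 R this brings z within 1 / K^2 of x, where the
      chart is onto.\<close>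
    have "E < R" using E K by (smt (verit) mult_pos_pos of_nat_0_le_iff)
    moreover have "R \<le> t / K\<^sup>2" using t0 KK K pos_le_divide_eq[of "K\<^sup>2" R t] by simp
    ultimately have "t * d x z < t / K\<^sup>2" using tz by linarith
    then have "t * d x z < t * (1 / K\<^sup>2)" by simp
    then have "d x z < 1 / K\<^sup>2" using t0(1) mult_less_cancel_left_pos by blast
    from \<kappa>onto[OF z(1) this] obtain u where u: "l1_dist n (\<lambda>_. 0) u \<le> 1 / K" "z = \<kappa> u" by blast
    have "l1_dist n (\<lambda>_. 0) u \<le> K * d x z"
      using \<kappa>[of "\<lambda>_. 0" u] u \<kappa>0 K by simp
    then have "t * l1_dist n (\<lambda>_. 0) u \<le> K * (t * d x z)" using t0 by simp
    also have "\<dots> \<le> K * E" using tz K by (intro mult_left_mono) auto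
    finally have tu: "t * l1_dist n (\<lambda>_. 0) u \<le> K * E" .
    \<comment> \<open>Rounding down costs at most 1 per coordinate, hence n in the sum, K * n / t in
      d and K * n in \<delta>.\<close>
    define v where "v = (\<lambda>i\<in>{..<n}. \<lfloor>t * u i\<rfloor>)"
    \<comment> \<open>\<open>F\<close> applies the inverse of its first component, so g enters
      inverted.\<close>
    define a where "a = (inv g, v)"
    have a: "a \<in> carrier (prod_group n)" using g by (simp add: a_def v_def)
    have fl: "\<bar>t * u i - real_of_int \<lfloor>t * u i\<rfloor>\<bar> \<le> 1" for i
      by linarith
    have "(\<Sum>i<n. \<bar>t * u i - real_of_int (v i)\<bar>) \<le> (\<Sum>i<n. 1)"
      using fl by (intro sum_mono) (auto simp: v_def)
    then have uv: "(\<Sum>i<n. \<bar>t * u i - real_of_int (v i)\<bar>) \<le> n" by simp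
    have "real (\<Sum>i<n. nat \<bar>v i\<bar>) = (\<Sum>i<n. \<bar>real_of_int (v i)\<bar>)"
      unfolding of_nat_sum by (intro sum.cong) auto
    also have "\<dots> \<le> (\<Sum>i<n. t * \<bar>u i\<bar> + \<bar>t * u i - real_of_int (v i)\<bar>)"
    proof (rule sum_mono)
      fix i
      have "\<bar>t * u i\<bar> = t * \<bar>u i\<bar>" using t0 by (simp add: abs_mult)
      then show "\<bar>real_of_int (v i)\<bar> \<le> t * \<bar>u i\<bar> + \<bar>t * u i - real_of_int (v i)\<bar>" by linarith
    qed
    also have "\<dots> \<le> K * E + n"
      using uv tu by (simp add: sum.distrib l1_dist_def sum_distrib_left)
    finally have ha: "height n a \<le> R"
      using E tz len_inv[OF g(1)] by (simp add: height_def a_def)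
    have Fa: "F a = \<phi> g (P a)" using g by (simp add: F_def a_def)
    have "d y (F a) = d z (P a)" unfolding Fa z(2)[symmetric] using g z PX[OF ha] by (intro isometry)
    also have "\<dots> \<le> K * l1_dist n u (\<lambda>i. real_of_int (v i) / t)"
      using \<kappa>[OF u(1), of "\<lambda>i. real_of_int (v i) / t"] P0[OF ha] RtK u by (simp add: P_def a_def)
    also have "l1_dist n u (\<lambda>i. real_of_int (v i) / t)
        = l1_dist n (\<lambda>i. (t * u i) / t) (\<lambda>i. real_of_int (v i) / t)" using t0 by simp
    also have "\<dots> \<le> n / t"
      unfolding l1_dist_divide[OF t0(1)] using uv t0 by (simp add: l1_dist_def divide_right_mono)
    finally have dya: "d y (F a) \<le> K * (n / t)" using K by (simp add: mult_left_mono)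
    have "real n \<le> R" using E K by (smt (verit) mult_pos_pos)
    then have "K * real n \<le> K * R" using K by (intro mult_left_mono) auto
    then have "K * real n < t" using t0 KR R by linarith
    then have "K * (n / t) < 1" using t0(1) by (simp add: field_simps)
    then have "d y (F a) < 1" using dya by linarith
    then have "\<delta> y (F a) \<le> t * d y (F a)" using \<delta>_le y FX[OF a ha] by blast
    also have "\<dots> \<le> t * (K * (n / t))" using dya t0 by (intro mult_left_mono) auto
    also have "\<dots> = K * n" using t0 by simp
    finally show ?thesis using a ha by blast
  qed
  show ?thesis
    unfolding models_def
  proof (intro exI[of _ F] conjI ballI impI)
    show "F \<one>\<^bsub>prod_group n\<^esub> = x"
    proof -
      \<comment> \<open>The unit vector of the product is \<open>undefined\<close> outside the index
        range, so it is not the zero function but only at l1 distance 0 from it; the Lipschitz bound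
        of \<kappa> identifies the two images.\<close>
      define o0 where "o0 = (\<lambda>i. real_of_int (snd \<one>\<^bsub>prod_group n\<^esub> i) / t)"
      have "l1_dist n (\<lambda>_. 0) o0 = 0" by (simp add: l1_dist_def o0_def)
      then have "d (\<kappa> (\<lambda>_. 0)) (\<kappa> o0) \<le> 0" "\<kappa> o0 \<in> X" "\<kappa> (\<lambda>_. 0) \<in> X"
        using \<kappa>[of "\<lambda>_. 0" o0] \<kappa>[of o0 o0] K by auto
      then have "\<kappa> o0 = \<kappa> (\<lambda>_. 0)"
        using zero[of "\<kappa> (\<lambda>_. 0)" "\<kappa> o0"] nonneg[of "\<kappa> (\<lambda>_. 0)" "\<kappa> o0"] by auto
      then have "P \<one>\<^bsub>prod_group n\<^esub> = \<kappa> (\<lambda>_. 0)" by (simp add: P_def o0_def)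
      then show ?thesis using \<kappa>0 act_one x by (simp add: F_def)
    qed
  next
    fix a assume "a \<in> carrier (prod_group n)" "height n a \<le> R" then show "F a \<in> X" by (rule FX)
  next
    fix a b
    assume *: "a \<in> carrier (prod_group n)" "b \<in> carrier (prod_group n)" "height n a \<le> R" "height n b \<le> R"
    have "K * (\<delta> (F a) (F b) + 1) \<le> K * (\<delta> (F a) (F b) + (K * n + 1))"
      using K by (intro mult_left_mono) auto
    then show "prod_dist n a b \<le> K * (\<delta> (F a) (F b) + (K * n + 1))"
      using lower[OF *(1,3,2,4)] by linarith
    have "0 \<le> K * n" using K by simp
    then show "\<delta> (F a) (F b) \<le> K * prod_dist n a b + (K * n + 1)"
      using upper[OF *(1,3,2,4)] by linarith
  next
    fix y assume "y \<in> X" "(\<delta> x y + 1) * (1 + K) + n \<le> R"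
    from onto[OF this] show "\<exists>a\<in>carrier (prod_group n). height n a \<le> R \<and> \<delta> y (F a) \<le> K * n + 1"
      by (metis add_increasing2 order_trans zero_le_one order_refl)
  qed
qed

section \<open>Packing and covering estimates at a level\<close>

lemma mball_sets: "mball x r \<in> sets \<mu>"
  by (intro borel openin_mball)

text \<open>Balls of half the separation are disjoint, and each has volume at least r^n / K.\<close>

lemma card_separated:
  assumes P: "finite P" "P \<subseteq> X" and r: "0 < r" "r \<le> 1 / K"
    and sep: "\<And>p q. p \<in> P \<Longrightarrow> q \<in> P \<Longrightarrow> p \<noteq> q \<Longrightarrow> 2 * r \<le> d p q"
    and W: "W \<in> sets \<mu>" "\<And>p. p \<in> P \<Longrightarrow> mball p r \<subseteq> W"
  shows "real (card P) * r ^ n \<le> K * measure \<mu> W"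
proof -
  have disj: "disjoint_family_on (\<lambda>p. mball p r) P"
    unfolding disjoint_family_on_def
  proof (intro ballI impI equals0I)
    fix p q z assume pq: "p \<in> P" "q \<in> P" "p \<noteq> q" and z: "z \<in> mball p r \<inter> mball q r"
    then have "d p q < 2 * r"
      using triangle[of p z q] commute[of q z] P by (auto simp: in_mball)
    then show False using sep[OF pq] by simp
  qed
  have "real (card P) * r ^ n = (\<Sum>p\<in>P. r ^ n)" by simp
  also have "\<dots> \<le> (\<Sum>p\<in>P. K * measure \<mu> (mball p r))"
    using P r by (intro sum_mono ball_lower) auto
  also have "\<dots> = K * measure \<mu> (\<Union>p\<in>P. mball p r)"
    using P disj mball_sets by (subst finite_measure_finite_Union) (auto simp: sum_distrib_left)
  also have "\<dots> \<le> K * measure \<mu> W"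
    using W K by (intro mult_left_mono finite_measure_mono) auto
  finally show ?thesis .
qed

text \<open>The finitely many short nontrivial elements have null fixed point sets, so by continuity
  from above the sets \<open>W k\<close> of nearly fixed points have volume tending to 0. The index
  k depends on \<eta> and R alone; then \<open>card_separated\<close> is applied inside
  \<open>W k\<close>, uniformly in P and r.\<close>

lemma few_bad_points:
  assumes \<eta>: "0 < \<eta>"
  shows "\<exists>\<epsilon>>0. \<forall>P r. finite P \<longrightarrow> P \<subseteq> X \<longrightarrow> 0 < r \<longrightarrow> r \<le> \<epsilon> \<longrightarrow>
    (\<forall>p\<in>P. \<forall>q\<in>P. p \<noteq> q \<longrightarrow> 2 * r \<le> d p q) \<longrightarrow> (\<forall>p\<in>P. \<not> good R \<epsilon> p) \<longrightarrow> real (card P) * r ^ n \<le> \<eta>"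
proof -
  define B where "B = {g \<in> carrier G. g \<noteq> \<one> \<and> real (len g) \<le> R}"
  have finB: "finite B"
    by (rule finite_subset[OF _ finite_len_le[of "nat \<lfloor>R\<rfloor>"]]) (auto simp: B_def le_nat_floor)
  \<comment> \<open>Origin of the numerator 3: a bad centre is moved by less than 1 / (k + 1), and
    for a point within r \<le> 1 / (k + 1) of it the bound grows by twice that radius, the action
    being isometric.\<close>
  define W where "W k = (\<Union>g\<in>B. {x \<in> X. d (\<phi> g x) x < 3 / Suc k})" for k
  have Wsets: "W k \<in> sets \<mu>" for k
    unfolding W_def
  proof (intro sets.finite_UN finB borel)
    fix g assume g: "g \<in> B"
    show "openin mtopology {x \<in> X. d (\<phi> g x) x < 3 / Suc k}"
      unfolding openin_mtopology
    proof (intro conjI allI impI)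
      fix x assume x: "x \<in> {x \<in> X. d (\<phi> g x) x < 3 / Suc k}"
      define r where "r = (3 / Suc k - d (\<phi> g x) x) / 2"
      have "r > 0" using x by (simp add: r_def)
      moreover have "y \<in> {x \<in> X. d (\<phi> g x) x < 3 / Suc k}" if y: "y \<in> mball x r" for y
      proof -
        have "d (\<phi> g y) y \<le> d (\<phi> g y) (\<phi> g x) + d (\<phi> g x) x + d x y"
          using triangle[of "\<phi> g y" "\<phi> g x" y] triangle[of "\<phi> g x" x y] act_closed g x y
          by (fastforce simp: B_def)
        also have "d (\<phi> g y) (\<phi> g x) = d x y"
          using isometry[of g y x] g x y commute by (auto simp: B_def)
        finally have "d (\<phi> g y) y < 3 / Suc k" using y by (auto simp: r_def)
        then show ?thesis using y by simp
      qed
      ultimately show "\<exists>r>0. mball x r \<subseteq> {x \<in> X. d (\<phi> g x) x < 3 / Suc k}" by blast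
    qed auto
  qed
  have "decseq W"
  proof (rule decseq_SucI)
    fix k
    have "(3::real) / Suc (Suc k) \<le> 3 / Suc k" by (intro divide_left_mono) auto
    then show "W (Suc k) \<subseteq> W k" unfolding W_def by fastforce
  qed
  then have lim: "(\<lambda>k. measure \<mu> (W k)) \<longlonglongrightarrow> measure \<mu> (\<Inter>k. W k)"
    using Wsets by (intro finite_Lim_measure_decseq) auto
  have "(\<Inter>k. W k) \<subseteq> (\<Union>g\<in>B. {x \<in> X. \<phi> g x = x})"
  proof
    fix x assume x: "x \<in> (\<Inter>k. W k)"
    show "x \<in> (\<Union>g\<in>B. {x \<in> X. \<phi> g x = x})"
    proof (rule ccontr)
      assume neg: "x \<notin> (\<Union>g\<in>B. {x \<in> X. \<phi> g x = x})"
      have xX: "x \<in> X" using x by (auto simp: W_def)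
      have pos: "0 < d (\<phi> g x) x" if "g \<in> B" for g
        using neg xX that act_closed[of g x] zero[of "\<phi> g x" x] nonneg[of "\<phi> g x" x]
        by (fastforce simp: B_def order_less_le)
      \<comment> \<open>A minimum of finitely many positive displacements is positive; the value 1
        covers an empty B.\<close>
      define m where "m = Min (insert 1 ((\<lambda>g. d (\<phi> g x) x) ` B))"
      have "0 < m" using pos finB by (auto simp: m_def)
      then obtain k where k: "3 / m < real (Suc k)" by (meson reals_Archimedean2 less_trans lessI of_nat_less_iff)
      then have "3 / Suc k < m" using \<open>0 < m\<close> by (simp add: field_simps)
      moreover obtain g where "g \<in> B" "d (\<phi> g x) x < 3 / Suc k" using x by (auto simp: W_def)
      moreover have "m \<le> d (\<phi> g x) x" using \<open>g \<in> B\<close> finB by (auto simp: m_def)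
      ultimately show False by linarith
    qed
  qed
  moreover have "(\<Union>g\<in>B. {x \<in> X. \<phi> g x = x}) \<in> null_sets \<mu>"
    using finB fix_null by (intro null_sets_UN' countable_finite) (auto simp: B_def)
  moreover have "(\<Inter>k. W k) \<in> sets \<mu>" using Wsets by auto
  ultimately have "(\<Inter>k. W k) \<in> null_sets \<mu>" by (meson null_sets_subset)
  then have "measure \<mu> (\<Inter>k. W k) = 0" by (simp add: measure_def null_setsD1)
  with lim have "(\<lambda>k. measure \<mu> (W k)) \<longlonglongrightarrow> 0" by simp
  then have "\<forall>\<^sub>F k in sequentially. measure \<mu> (W k) < \<eta> / K"
    using \<eta> K by (intro order_tendstoD) auto
  moreover have "\<forall>\<^sub>F k in sequentially. inverse (real (Suc k)) < 1 / K"
    using LIMSEQ_inverse_real_of_nat K by (intro order_tendstoD) auto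
  ultimately have "\<forall>\<^sub>F k in sequentially. measure \<mu> (W k) < \<eta> / K \<and> inverse (real (Suc k)) < 1 / K"
    by (rule eventually_conj)
  then obtain k where k: "measure \<mu> (W k) < \<eta> / K" "inverse (real (Suc k)) < 1 / K"
    by (auto simp: eventually_sequentially)
  show ?thesis
  proof (intro exI[of _ "1 / Suc k"] conjI allI impI)
    fix P r assume P: "finite P" "P \<subseteq> X" "0 < r" "r \<le> 1 / real (Suc k)"
      "\<forall>p\<in>P. \<forall>q\<in>P. p \<noteq> q \<longrightarrow> 2 * r \<le> d p q" and bad: "\<forall>p\<in>P. \<not> good R (1 / real (Suc k)) p"
    have "real (card P) * r ^ n \<le> K * measure \<mu> (W k)"
    proof (rule card_separated[OF P(1-3) _ _ Wsets])
      show "r \<le> 1 / K" using P(4) k(2) by (simp add: inverse_eq_divide)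
      fix p assume p: "p \<in> P"
      then obtain g where g: "g \<in> B" "d (\<phi> g p) p < 1 / Suc k"
        using bad unfolding good_def B_def by force
      have "z \<in> W k" if z: "z \<in> mball p r" for z
      proof -
        have "d (\<phi> g z) z \<le> d (\<phi> g z) (\<phi> g p) + d (\<phi> g p) p + d p z"
          using triangle[of "\<phi> g z" "\<phi> g p" z] triangle[of "\<phi> g p" p z] act_closed g P p z
          by (fastforce simp: B_def)
        also have "d (\<phi> g z) (\<phi> g p) = d p z"
          using isometry[of g z p] g P p z commute by (auto simp: B_def)
        finally have "d (\<phi> g z) z < 1 / Suc k + 1 / Suc k + 1 / Suc k"
          using g z P by (auto simp: in_mball)
        then show ?thesis using g z by (auto simp: W_def)
      qed
      then show "mball p r \<subseteq> W k" by blast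
    qed (use P in auto)
    also have "\<dots> \<le> \<eta>" using k(1) K by (simp add: field_simps)
    finally show "real (card P) * r ^ n \<le> \<eta>" .
  qed simp
qed

text \<open>If P is C-dense for \<delta>, every point is d-close to a translate of P by one of the
  finitely many elements of length at most C + 1. So \<open>card P * card B\<close> balls of radius
  (C + 2) / t cover X, and comparing volumes bounds t^n.\<close>

lemma dense_card:
  assumes C: "0 \<le> C"
  shows "\<exists>Q>0. \<forall>t \<delta> P. level t \<delta> \<longrightarrow> K * (C + 2) \<le> t \<longrightarrow> finite P \<longrightarrow> P \<subseteq> X \<longrightarrow>
    (\<forall>y\<in>X. \<exists>p\<in>P. \<delta> p y \<le> C) \<longrightarrow> t ^ n \<le> Q * real (card P)"
proof -
  define B where "B = {g \<in> carrier G. real (len g) \<le> C + 1}"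
  have finB: "finite B"
    by (rule finite_subset[OF _ finite_len_le[of "nat \<lfloor>C + 1\<rfloor>"]]) (use le_nat_floor[of _ "C + 1"] in \<open>unfold B_def, blast\<close>)
  have Xsets: "X \<in> sets \<mu>" using borel openin_topspace by (metis topspace_mtopology)
  have V: "0 < measure \<mu> X"
  proof -
    obtain x where x: "x \<in> X" using nonempty by blast
    have "(1 / K) ^ n \<le> K * measure \<mu> (mball x (1 / K))" using K by (intro ball_lower x) auto
    then have "0 < K * measure \<mu> (mball x (1 / K))" using K by (smt (verit) zero_less_divide_1_iff zero_less_power)
    moreover have "measure \<mu> (mball x (1 / K)) \<le> measure \<mu> X"
      using Xsets mball_subset_mspace by (intro finite_measure_mono)
    ultimately show ?thesis using K by (smt (verit) mult_nonneg_nonpos)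
  qed
  have "\<one> \<in> B" using C by (simp add: B_def)
  then have cB: "card B > 0" using finB by (auto simp: card_gt_0_iff)
  define Q where "Q = card B * K * (C + 2) ^ n / measure \<mu> X"
  show ?thesis
  proof (intro exI[of _ Q] conjI allI impI)
    show "0 < Q" using V cB C K by (simp add: Q_def)
    fix t \<delta> P assume \<delta>: "level t \<delta>" and t: "K * (C + 2) \<le> t" and P: "finite P" "P \<subseteq> X"
      and dense: "\<forall>y\<in>X. \<exists>p\<in>P. \<delta> p y \<le> C"
    have "0 < K * (C + 2)" using K C by simp
    then have t0: "t > 0" using t by linarith
    \<comment> \<open>C + 1 accounts for the slack of \<open>level\<close>; one more makes the
      inequality strict, as open balls require.\<close>
    define r where "r = (C + 2) / t"
    have r: "0 < r" "r \<le> 1 / K" using t0 t C K by (auto simp: r_def field_simps)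
    have "X \<subseteq> (\<Union>(p, g)\<in>P \<times> B. mball (\<phi> g p) r)"
    proof
      fix y assume y: "y \<in> X"
      then obtain p where p: "p \<in> P" "\<delta> p y \<le> C" using dense by blast
      then obtain g where g: "g \<in> carrier G" "len g + t * d (\<phi> g p) y \<le> C + 1"
        using \<delta> y P unfolding level_def by (smt (verit) subsetD)
      have "0 \<le> t * d (\<phi> g p) y" using t0 by simp
      then have "g \<in> B" "t * d (\<phi> g p) y < C + 2" using g by (auto simp: B_def)
      then have "y \<in> mball (\<phi> g p) r"
        using act_closed[OF g(1)] p P y t0 by (auto simp: r_def field_simps)
      then show "y \<in> (\<Union>(p, g)\<in>P \<times> B. mball (\<phi> g p) r)" using p \<open>g \<in> B\<close> by auto
    qed
    then have "measure \<mu> X \<le> measure \<mu> (\<Union>(p, g)\<in>P \<times> B. mball (\<phi> g p) r)"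
      using P finB mball_sets by (intro finite_measure_mono sets.finite_UN) auto
    also have "\<dots> \<le> (\<Sum>(p, g)\<in>P \<times> B. measure \<mu> (mball (\<phi> g p) r))"
      unfolding case_prod_unfold using P finB mball_sets by (intro measure_UNION_le) auto
    also have "\<dots> \<le> (\<Sum>(p, g)\<in>P \<times> B. K * r ^ n)"
      unfolding case_prod_unfold using P r act_closed
      by (intro sum_mono ball_upper) (auto simp: B_def)
    also have "\<dots> = card P * card B * (K * r ^ n)" by (simp add: card_cartesian_product)
    finally have "measure \<mu> X * t ^ n \<le> card P * card B * (K * r ^ n) * t ^ n"
      using t0 by (intro mult_right_mono) auto
    also have "\<dots> = card P * (card B * K * (C + 2) ^ n)"
      using t0 by (simp add: r_def power_divide)
    finally show "t ^ n \<le> Q * real (card P)" using V by (simp add: Q_def field_simps)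
  qed
qed

text \<open>The comparison of \<delta> with t * d is available for d < 1; otherwise C / t \<le> 1
  suffices.\<close>

lemma level_separated:
  assumes "level t \<delta>" "p \<in> X" "q \<in> X" "C \<le> \<delta> p q" "0 < t" "C \<le> t"
  shows "C / t \<le> d p q"
proof (cases "d p q < 1")
  case True
  then have "\<delta> p q \<le> t * d p q" using assms by (simp add: level_def)
  then show ?thesis using assms by (simp add: field_simps)
next
  case False
  moreover have "C / t \<le> 1" using assms by simp
  ultimately show ?thesis by linarith
qed

text \<open>The packing estimate bounds the cardinality of separated sets, so one of largest
  cardinality exists; any point far from it could be added.\<close>

lemma ex_net:
  assumes \<delta>: "level t \<delta>" and C: "0 < C" "K * C \<le> t"
  shows "\<exists>P. finite P \<and> P \<subseteq> X \<and> (\<forall>p\<in>P. \<forall>q\<in>P. p \<noteq> q \<longrightarrow> C \<le> \<delta> p q) \<and> (\<forall>y\<in>X. \<exists>p\<in>P. \<delta> p y \<le> C)"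
proof -
  interpret D: Metric_space X \<delta> using \<delta> by (simp add: level_def)
  define sep where "sep P \<longleftrightarrow> finite P \<and> P \<subseteq> X \<and> (\<forall>p\<in>P. \<forall>q\<in>P. p \<noteq> q \<longrightarrow> C \<le> \<delta> p q)" for P
  have KC: "C \<le> K * C" using K C by (simp add: mult_le_cancel_right1)
  have t: "0 < t" "C \<le> t" using C KC by linarith+
  define r where "r = C / t / 2"
  have r: "0 < r" "r \<le> 1 / K" using t C K by (auto simp: r_def field_simps)
  have Xsets: "X \<in> sets \<mu>" using borel openin_topspace by (metis topspace_mtopology)
  have bound: "card P < nat \<lceil>K * measure \<mu> X / r ^ n\<rceil> + 1" if "sep P" for P
  proof -
    have "real (card P) * r ^ n \<le> K * measure \<mu> X"
    proof (rule card_separated[OF _ _ r _ Xsets mball_subset_mspace])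
      show "2 * r \<le> d p q" if "p \<in> P" "q \<in> P" "p \<noteq> q" for p q
        using level_separated[OF \<delta> _ _ _ t, of p q] that \<open>sep P\<close> by (auto simp: sep_def r_def)
    qed (use that in \<open>auto simp: sep_def\<close>)
    then have "real (card P) \<le> K * measure \<mu> X / r ^ n" using r by (simp add: field_simps)
    then show ?thesis by linarith
  qed
  have "sep {}" by (simp add: sep_def)
  then have "\<exists>P. sep P \<and> (\<forall>P'. sep P' \<longrightarrow> card P' \<le> card P)"
    using bound by (intro ex_has_greatest_nat) auto
  then obtain P where P: "sep P" "\<And>P'. sep P' \<Longrightarrow> card P' \<le> card P" by blast
  have "\<exists>p\<in>P. \<delta> p y \<le> C" if y: "y \<in> X" for y
  proof (rule ccontr)
    assume neg: "\<not> ?thesis"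
    then have "y \<notin> P" using C D.mdist_zero[OF y] by (metis less_imp_le)
    moreover have "sep (insert y P)"
      using P(1) neg y D.commute by (auto simp: sep_def intro: less_imp_le)
    ultimately show False using P(2)[of "insert y P"] P(1) by (simp add: sep_def)
  qed
  then show ?thesis using P(1) by (auto simp: sep_def)
qed

end

section \<open>From uniformly quasi-isometric levels to the product groups\<close>

section \<open>Comparing two sequences of levels\<close>

lemma quasi_isometryD:
  assumes "quasi_isometry L A X dX Y dY f"
  shows "1 \<le> L" "0 \<le> A" "x \<in> X \<Longrightarrow> f x \<in> Y"
    "x \<in> X \<Longrightarrow> y \<in> X \<Longrightarrow> dX x y \<le> L * (dY (f x) (f y) + A)"
    "x \<in> X \<Longrightarrow> y \<in> X \<Longrightarrow> dY (f x) (f y) \<le> L * dX x y + A"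
    "z \<in> Y \<Longrightarrow> \<exists>x\<in>X. dY z (f x) \<le> A"
proof -
  note q = assms[unfolded quasi_isometry_def]
  show L: "1 \<le> L" "0 \<le> A" "x \<in> X \<Longrightarrow> f x \<in> Y" using q by auto
  show "x \<in> X \<Longrightarrow> y \<in> X \<Longrightarrow> dY (f x) (f y) \<le> L * dX x y + A" using q by blast
  show "z \<in> Y \<Longrightarrow> \<exists>x\<in>X. dY z (f x) \<le> A" using q by blast
  assume "x \<in> X" "y \<in> X"
  then have "dX x y / L - A \<le> dY (f x) (f y)" using q by blast
  then have "dX x y / L \<le> dY (f x) (f y) + A" by simp
  then show "dX x y \<le> L * (dY (f x) (f y) + A)" using L(1) by (simp add: divide_le_eq mult.commute)
qed

locale warped_pair =
  M: warped_space G S \<phi> X d \<mu> n K + N: warped_space H T \<psi> Y e \<nu> m K'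
  for G :: "('a, 'c) monoid_scheme" and S and \<phi> :: "'a \<Rightarrow> 'b \<Rightarrow> 'b" and X d \<mu> n K
    and H :: "('e, 'f) monoid_scheme" and T and \<psi> :: "'e \<Rightarrow> 'g \<Rightarrow> 'g" and Y e \<nu> m K' +
  fixes t s :: "nat \<Rightarrow> real" and \<delta> \<epsilon> f L A
  assumes t: "filterlim t at_top sequentially" and s: "filterlim s at_top sequentially"
    and M_level: "M.level (t k) (\<delta> k)" and N_level: "N.level (s k) (\<epsilon> k)"
    and f: "quasi_isometry L A X (\<delta> k) Y (\<epsilon> k) (f k)"
begin

lemma L: "1 \<le> L" and A: "0 \<le> A" and f_closed: "x \<in> X \<Longrightarrow> f k x \<in> Y"
  and f_lower: "x \<in> X \<Longrightarrow> y \<in> X \<Longrightarrow> \<delta> k x y \<le> L * (\<epsilon> k (f k x) (f k y) + A)"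
  and f_upper: "x \<in> X \<Longrightarrow> y \<in> X \<Longrightarrow> \<epsilon> k (f k x) (f k y) \<le> L * \<delta> k x y + A"
  and f_onto: "z \<in> Y \<Longrightarrow> \<exists>x\<in>X. \<epsilon> k z (f k x) \<le> A"
  using quasi_isometryD[OF f] by blast+

text \<open>At most a quarter of a net is bad in M and at most a quarter has a bad image in N, so
  some point is good on both sides. Each quarter comes from combining \<open>few_bad_points\<close>
  with \<open>dense_card\<close> in the same space.\<close>

lemma ex_good_point:
  "\<exists>\<eta>>0. \<forall>\<^sub>F k in sequentially. \<exists>x\<in>X. M.good R \<eta> x \<and> N.good R' \<eta> (f k x)"
proof -
  \<comment> \<open>With separation L * (A + 1) the lower inequality leaves the images at distance
    at least 1; \<open>C'\<close> is the density of the image of a C-dense set.\<close>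
  define C where "C = L * (A + 1)"
  define C' where "C' = 2 * A + L * C"
  have C: "1 \<le> C" "0 \<le> C'" using L A mult_mono[of 1 L 1 "A + 1"] by (auto simp: C_def C'_def)
  obtain Q where Q: "Q > 0" "\<And>t \<delta> P. M.level t \<delta> \<Longrightarrow> K * (C + 2) \<le> t \<Longrightarrow> finite P \<Longrightarrow> P \<subseteq> X \<Longrightarrow>
    (\<forall>y\<in>X. \<exists>p\<in>P. \<delta> p y \<le> C) \<Longrightarrow> t ^ n \<le> Q * real (card P)"
    using M.dense_card[of C] C by auto
  obtain Q' where Q': "Q' > 0" "\<And>t \<delta> P. N.level t \<delta> \<Longrightarrow> K' * (C' + 2) \<le> t \<Longrightarrow> finite P \<Longrightarrow> P \<subseteq> Y \<Longrightarrow>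
    (\<forall>y\<in>Y. \<exists>p\<in>P. \<delta> p y \<le> C') \<Longrightarrow> t ^ m \<le> Q' * real (card P)"
    using N.dense_card[of C'] C by auto
  \<comment> \<open>Chosen so that the radii C / (2 t) and 1 / (2 s) and the density constants Q and
    Q' turn the volume bounds into a quarter of \<open>card P\<close>.\<close>
  define b where "b = 1 / (4 * Q * (2 / C) ^ n)"
  define b' where "b' = 1 / (4 * Q' * 2 ^ m)"
  have b: "0 < b" "0 < b'" using Q(1) Q'(1) C by (auto simp: b_def b'_def)
  obtain \<eta> where \<eta>: "\<eta> > 0" "\<And>P r. finite P \<Longrightarrow> P \<subseteq> X \<Longrightarrow> 0 < r \<Longrightarrow> r \<le> \<eta> \<Longrightarrow>
    (\<forall>p\<in>P. \<forall>q\<in>P. p \<noteq> q \<longrightarrow> 2 * r \<le> d p q) \<Longrightarrow> (\<forall>p\<in>P. \<not> M.good R \<eta> p) \<Longrightarrow> real (card P) * r ^ n \<le> b"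
    using M.few_bad_points[OF b(1), of R] by auto
  obtain \<eta>' where \<eta>': "\<eta>' > 0" "\<And>P r. finite P \<Longrightarrow> P \<subseteq> Y \<Longrightarrow> 0 < r \<Longrightarrow> r \<le> \<eta>' \<Longrightarrow>
    (\<forall>p\<in>P. \<forall>q\<in>P. p \<noteq> q \<longrightarrow> 2 * r \<le> e p q) \<Longrightarrow> (\<forall>p\<in>P. \<not> N.good R' \<eta>' p) \<Longrightarrow> real (card P) * r ^ m \<le> b'"
    using N.few_bad_points[OF b(2), of R'] by auto
  define t0 where "t0 = max (K * (C + 2)) (C / \<eta>)"
  define s0 where "s0 = max (K' * (C' + 2)) (1 / \<eta>')"
  have "\<forall>\<^sub>F k in sequentially. t0 \<le> t k" "\<forall>\<^sub>F k in sequentially. s0 \<le> s k"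
    using t s by (auto simp: filterlim_at_top)
  then have "\<forall>\<^sub>F k in sequentially. \<exists>x\<in>X. M.good R (min \<eta> \<eta>') x \<and> N.good R' (min \<eta> \<eta>') (f k x)"
  proof eventually_elim
    case (elim k)
    have tk: "K * (C + 2) \<le> t k" "C / \<eta> \<le> t k" and sk: "K' * (C' + 2) \<le> s k" "1 / \<eta>' \<le> s k"
      using elim by (auto simp: t0_def s0_def)
    have K1: "C + 2 \<le> K * (C + 2)" "C' + 2 \<le> K' * (C' + 2)" "K * C \<le> K * (C + 2)"
      using M.K N.K C by (auto simp: mult_le_cancel_right1)
    have t1: "0 < t k" "C \<le> t k" "K * C \<le> t k" and s1: "0 < s k" "1 \<le> s k"
      using tk sk K1 C by linarith+
    interpret D: Metric_space X "\<delta> k" using M_level by (simp add: M.level_def)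
    interpret E: Metric_space Y "\<epsilon> k" using N_level by (simp add: N.level_def)
    have "0 < C" using C by simp
    from M.ex_net[OF M_level this t1(3)] obtain P where P': "finite P" "P \<subseteq> X"
      "\<forall>p\<in>P. \<forall>q\<in>P. p \<noteq> q \<longrightarrow> C \<le> \<delta> k p q" "\<forall>y\<in>X. \<exists>p\<in>P. \<delta> k p y \<le> C"
      by (elim exE conjE)
    have P: "finite P" "P \<subseteq> X" "\<And>p q. p \<in> P \<Longrightarrow> q \<in> P \<Longrightarrow> p \<noteq> q \<Longrightarrow> C \<le> \<delta> k p q"
      "\<And>y. y \<in> X \<Longrightarrow> \<exists>p\<in>P. \<delta> k p y \<le> C"
      using P' by simp_all
    have sep: "1 \<le> \<epsilon> k (f k p) (f k q)" if "p \<in> P" "q \<in> P" "p \<noteq> q" for p q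
    proof -
      have "L * (A + 1) \<le> L * (\<epsilon> k (f k p) (f k q) + A)"
        using P(3)[OF that] f_lower[OF subsetD[OF P(2) that(1)] subsetD[OF P(2) that(2)], of k]
        by (simp add: C_def)
      then show ?thesis using L by simp
    qed
    \<comment> \<open>Injectivity makes the image as large as P, so one cardinality serves both
      spaces.\<close>
    have inj: "inj_on (f k) P"
    proof (rule inj_onI, rule ccontr)
      fix p q assume pq: "p \<in> P" "q \<in> P" "f k p = f k q" "p \<noteq> q"
      then have "\<epsilon> k (f k p) (f k q) = 0" using f_closed P(2) by (auto intro!: E.mdist_zero)
      then show False using sep[OF pq(1,2,4)] by simp
    qed
    have fP: "f k ` P \<subseteq> Y" using f_closed P by auto
    have cM: "t k ^ n \<le> Q * real (card P)" using Q(2)[OF M_level tk(1) P(1,2)] P(4) by blast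
    have dense': "\<exists>p\<in>f k ` P. \<epsilon> k p y \<le> C'" if y: "y \<in> Y" for y
    proof -
      obtain x where x: "x \<in> X" "\<epsilon> k y (f k x) \<le> A" using f_onto y by blast
      obtain p where p: "p \<in> P" "\<delta> k p x \<le> C" using P(4) x by blast
      have "\<epsilon> k (f k p) (f k x) \<le> L * \<delta> k p x + A" using f_upper p P x by blast
      also have "\<dots> \<le> L * C + A" using p L by simp
      finally have "\<epsilon> k (f k p) y \<le> C'"
        using E.triangle[of "f k p" "f k x" y] E.commute[of y "f k x"] x p P f_closed y
        by (fastforce simp: C'_def)
      then show ?thesis using p by blast
    qed
    have "s k ^ m \<le> Q' * real (card (f k ` P))"
      using Q'(2)[OF N_level sk(1) _ fP] P(1) dense' by blast
    then have cN: "s k ^ m \<le> Q' * real (card P)" using card_image[OF inj] by simp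
    define B where "B = {p \<in> P. \<not> M.good R \<eta> p}"
    define B' where "B' = {p \<in> P. \<not> N.good R' \<eta>' (f k p)}"
    define r where "r = C / t k"
    have r: "r \<le> \<eta>" "0 < r" using tk(2) t1 \<eta>(1) C by (auto simp: r_def field_simps)
    have "real (card B) * (r / 2) ^ n \<le> b"
    proof (rule \<eta>(2))
      show "\<forall>p\<in>B. \<forall>q\<in>B. p \<noteq> q \<longrightarrow> 2 * (r / 2) \<le> d p q"
        using M.level_separated[OF M_level _ _ P(3) t1(1,2)] P(2) by (auto simp: B_def r_def)
    qed (use P r in \<open>auto simp: B_def\<close>)
    then have "real (card B) \<le> b * (2 / C) ^ n * t k ^ n"
      using t1 C by (simp add: r_def power_divide field_simps)
    also have "\<dots> \<le> b * (2 / C) ^ n * (Q * real (card P))"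
      using cM b C by (intro mult_left_mono) auto
    also have "\<dots> = real (card P) / 4" using Q(1) C by (simp add: b_def field_simps)
    finally have 1: "real (card B) \<le> real (card P) / 4" .
    define r' where "r' = 1 / s k"
    have r': "r' \<le> \<eta>'" "0 < r'" using sk(2) s1 \<eta>'(1) by (auto simp: r'_def field_simps)
    have "real (card (f k ` B')) * (r' / 2) ^ m \<le> b'"
    proof (rule \<eta>'(2))
      show "\<forall>p\<in>f k ` B'. \<forall>q\<in>f k ` B'. p \<noteq> q \<longrightarrow> 2 * (r' / 2) \<le> e p q"
      proof (intro ballI impI)
        fix y z assume yz: "y \<in> f k ` B'" "z \<in> f k ` B'" "y \<noteq> z"
        then have "1 \<le> \<epsilon> k y z" using sep by (auto simp: B'_def)
        then show "2 * (r' / 2) \<le> e y z"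
          using N.level_separated[OF N_level _ _ _ s1] yz fP by (auto simp: B'_def r'_def)
      qed
    qed (use P r' fP in \<open>auto simp: B'_def\<close>)
    then have "real (card (f k ` B')) \<le> b' * 2 ^ m * s k ^ m"
      using s1 by (simp add: r'_def power_divide field_simps)
    also have "\<dots> \<le> b' * 2 ^ m * (Q' * real (card P))"
      using cN b by (intro mult_left_mono) auto
    also have "\<dots> = real (card P) / 4" using Q'(1) by (simp add: b'_def field_simps)
    finally have 2: "real (card B') \<le> real (card P) / 4"
      using card_image[OF inj_on_subset[OF inj, of B']] by (auto simp: B'_def)
    have "P \<noteq> {}" using P(4) M.nonempty by blast
    then have "card P > 0" using P(1) by auto
    moreover have "card (B \<union> B') \<le> card B + card B'" by (rule card_Un_le)
    ultimately have "card (B \<union> B') < card P" using 1 2 by linarith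
    then have "\<not> P \<subseteq> B \<union> B'" using card_mono[of "B \<union> B'" P] P(1) by (auto simp: B_def B'_def)
    then obtain p where p: "p \<in> P" "M.good R \<eta> p" "N.good R' \<eta>' (f k p)" by (auto simp: B_def B'_def)
    then show ?case using P(2) M.good_mono[OF p(2)] N.good_mono[OF p(3)] by (meson min.cobounded1 min.cobounded2 subsetD)
  qed
  moreover have "0 < min \<eta> \<eta>'" using \<eta> \<eta>' by simp
  ultimately show ?thesis by blast
qed

text \<open>The local map is the model of M followed by f and read back in the model of N. In B, the
  term L * C comes from the model of M, one A from the upper bound for f and a second one from its
  coarse surjectivity; 2 * C' pays for reading back two points and another C' for the bound of the
  model of N. The factor K' converts to \<open>prod_dist\<close>.\<close>

lemma ex_local_quasi_isometry:
  fixes R :: nat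
  defines "C \<equiv> K * real n + 1" and "C' \<equiv> K' * real m + 1"
  defines "B \<equiv> K' * (2 * A + L * C + 3 * C')"
  shows "\<exists>D\<ge>real R. \<exists>g. N.prod_dist m \<one>\<^bsub>N.prod_group m\<^esub> (g \<one>\<^bsub>M.prod_group n\<^esub>) \<le> B \<and>
    (\<forall>a\<in>carrier (M.prod_group n). M.prod_dist n \<one>\<^bsub>M.prod_group n\<^esub> a \<le> D \<longrightarrow> g a \<in> carrier (N.prod_group m)) \<and>
    (\<forall>a\<in>carrier (M.prod_group n). \<forall>b\<in>carrier (M.prod_group n).
       M.prod_dist n \<one>\<^bsub>M.prod_group n\<^esub> a \<le> D \<longrightarrow> M.prod_dist n \<one>\<^bsub>M.prod_group n\<^esub> b \<le> D \<longrightarrow>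
       M.prod_dist n a b / (K * K' * L) - B \<le> N.prod_dist m (g a) (g b) \<and>
       N.prod_dist m (g a) (g b) \<le> (K * K' * L) * M.prod_dist n a b + B) \<and>
    (\<forall>y\<in>carrier (N.prod_group m). N.prod_dist m \<one>\<^bsub>N.prod_group m\<^esub> y \<le> R \<longrightarrow>
       (\<exists>a\<in>carrier (M.prod_group n). M.prod_dist n \<one>\<^bsub>M.prod_group n\<^esub> a \<le> D \<and>
          N.prod_dist m (g a) y \<le> B \<and> N.prod_dist m y (g a) \<le> B))"
proof -
  have C: "1 \<le> C" "1 \<le> C'" using M.K N.K by (auto simp: C_def C'_def)
  have K: "1 \<le> K" "1 \<le> K'" by (rule M.K, rule N.K)
  have pos: "0 \<le> L * C" "0 \<le> L * A" using L A C by auto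
  \<comment> \<open>The radii are chosen in the order R, Z, D, E, D'. Z bounds the distance in M
    from x to a lift of a point of the R-ball of N, D lets the model of M cover that distance, E
    bounds where f sends the D-ball, and D' lets the model of N cover E. The level k is taken large
    after that.\<close>
  define Z where "Z = L * (K' * R + C' + 2 * A)"
  define D where "D = max (real R) (max 1 ((Z + 1) * (1 + K) + n))"
  define E where "E = L * (K * D + C) + A"
  define D' where "D' = max (real R) (max 1 ((E + 1) * (1 + K') + m))"
  have D: "real R \<le> D" "1 \<le> D" "(Z + 1) * (1 + K) + n \<le> D" by (auto simp: D_def)
  have D': "real R \<le> D'" "1 \<le> D'" "(E + 1) * (1 + K') + m \<le> D'" by (auto simp: D'_def)
  obtain \<eta> where \<eta>: "\<eta> > 0" "\<forall>\<^sub>F k in sequentially. \<exists>x\<in>X.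
      M.good (2 * D + 2 * K * D + 1) \<eta> x \<and> N.good (2 * D' + 2 * K' * D' + 1) \<eta> (f k x)"
    using ex_good_point by blast
  have "\<forall>\<^sub>F k in sequentially. 2 * K\<^sup>2 * D + 1 \<le> t k" "\<forall>\<^sub>F k in sequentially. 2 * K'\<^sup>2 * D' + 1 \<le> s k"
    using t s unfolding filterlim_at_top by blast+
  moreover have "\<forall>\<^sub>F k in sequentially. (4 * K * D + 1) / \<eta> < t k"
    "\<forall>\<^sub>F k in sequentially. (4 * K' * D' + 1) / \<eta> < s k"
    using t s unfolding filterlim_at_top_dense by blast+
  ultimately have "\<forall>\<^sub>F k in sequentially. (2 * K\<^sup>2 * D + 1 \<le> t k \<and> (4 * K * D + 1) / \<eta> < t k \<and>
     2 * K'\<^sup>2 * D' + 1 \<le> s k \<and> (4 * K' * D' + 1) / \<eta> < s k) \<and> (\<exists>x\<in>X.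
      M.good (2 * D + 2 * K * D + 1) \<eta> x \<and> N.good (2 * D' + 2 * K' * D' + 1) \<eta> (f k x))"
    using \<eta>(2) by eventually_elim blast
  then obtain k x where k: "2 * K\<^sup>2 * D + 1 \<le> t k" "(4 * K * D + 1) / \<eta> < t k"
     "2 * K'\<^sup>2 * D' + 1 \<le> s k" "(4 * K' * D' + 1) / \<eta> < s k"
    and x: "x \<in> X" "M.good (2 * D + 2 * K * D + 1) \<eta> x" "N.good (2 * D' + 2 * K' * D' + 1) \<eta> (f k x)"
    unfolding eventually_sequentially by blast
  interpret DM: Metric_space X "\<delta> k" using M_level by (simp add: M.level_def)
  interpret DN: Metric_space Y "\<epsilon> k" using N_level by (simp add: N.level_def)
  interpret PM: group "M.prod_group n" by (rule M.group_prod)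
  interpret PN: group "N.prod_group m" by (rule N.group_prod)
  let ?P = "carrier (M.prod_group n)" and ?Q = "carrier (N.prod_group m)"
  have "4 * K * D + 1 < \<eta> * t k" "4 * K' * D' + 1 < \<eta> * s k"
    using k(2,4) \<eta>(1) by (auto simp: field_simps)
  then obtain F F' where mF: "M.models D (\<delta> k) x F" and mF': "N.models D' (\<epsilon> k) (f k x) F'"
    using M.local_model[OF M_level x(1,2) D(2) order_refl k(1)]
      N.local_model[OF N_level f_closed[OF x(1)] x(3) D'(2) order_refl k(3)] by blast
  note F1 = M.modelsD(1)[OF mF] and F = M.modelsD(2)[OF mF]
    and FK = M.modelsD(3)[OF mF, folded C_def] and Fs = M.modelsD(4)[OF mF, folded C_def]
    and F'1 = N.modelsD(1)[OF mF'] and F' = N.modelsD(2)[OF mF']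
    and F'K = N.modelsD(3)[OF mF', folded C'_def] and F's = N.modelsD(4)[OF mF', folded C'_def]
  have one: "\<one>\<^bsub>M.prod_group n\<^esub> \<in> ?P" "M.height n \<one>\<^bsub>M.prod_group n\<^esub> \<le> D"
    "\<one>\<^bsub>N.prod_group m\<^esub> \<in> ?Q" "N.height m \<one>\<^bsub>N.prod_group m\<^esub> \<le> D'"
    using D D' M.height_one[of n] N.height_one[of m] by simp_all
  have ex_g: "\<exists>b. b \<in> ?Q \<and> N.height m b \<le> D' \<and> \<epsilon> k (f k (F a)) (F' b) \<le> C'"
    if a: "a \<in> ?P" "M.height n a \<le> D" for a
  proof -
    have "\<delta> k x (F a) \<le> K * M.prod_dist n \<one>\<^bsub>M.prod_group n\<^esub> a + C"
      using FK[OF one(1) a(1) one(2) a(2)] F1 by simp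
    also have "\<dots> \<le> K * D + C" using a M.prod_dist_one[OF a(1)] K by (simp add: mult_left_mono)
    finally have "L * \<delta> k x (F a) + A \<le> E" using L by (simp add: E_def mult_left_mono)
    then have "\<epsilon> k (f k x) (f k (F a)) \<le> E" using f_upper[OF x(1) F[OF a], of k] by linarith
    then have "(\<epsilon> k (f k x) (f k (F a)) + 1) * (1 + K') + m \<le> D'"
      using D'(3) K by (smt (verit) mult_right_mono)
    from F's[OF f_closed[OF F[OF a]] this] show ?thesis by blast
  qed
  define g where "g a = (SOME b. b \<in> ?Q \<and> N.height m b \<le> D' \<and> \<epsilon> k (f k (F a)) (F' b) \<le> C')" for a
  have g: "g a \<in> ?Q \<and> N.height m (g a) \<le> D' \<and> \<epsilon> k (f k (F a)) (F' (g a)) \<le> C'"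
    if "a \<in> ?P" "M.height n a \<le> D" for a
    unfolding g_def by (rule someI_ex[OF ex_g[OF that]])
  \<comment> \<open>Reading back moves each of the two endpoints by at most
    \<open>C'\<close>.\<close>
  have diff: "\<bar>\<epsilon> k (F' (g a)) (F' (g b)) - \<epsilon> k (f k (F a)) (f k (F b))\<bar> \<le> 2 * C'"
    if a: "a \<in> ?P" "M.height n a \<le> D" and b: "b \<in> ?P" "M.height n b \<le> D" for a b
  proof -
    have in_Y: "F' (g a) \<in> Y" "F' (g b) \<in> Y" "f k (F a) \<in> Y" "f k (F b) \<in> Y"
      using g[OF a] g[OF b] F' f_closed F a b by auto
    show ?thesis
      using g[OF a] g[OF b] DN.triangle[OF in_Y(1,3,2)] DN.triangle[OF in_Y(3,4,2)]
        DN.triangle[OF in_Y(3,1,4)] DN.triangle[OF in_Y(1,2,4)]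
        DN.commute[of "F' (g a)" "f k (F a)"] DN.commute[of "F' (g b)" "f k (F b)"]
      by linarith
  qed
  have B: "B = K' * (2 * A) + K' * (L * C) + 3 * (K' * C')" by (simp add: B_def algebra_simps)
  have B0: "0 \<le> K' * (2 * A)" "0 \<le> K' * (L * C)" "0 \<le> K' * C'" using K A pos C by auto
  show ?thesis
  proof (intro exI[of _ D] exI[of _ g] conjI ballI impI)
    show "real R \<le> D" by (rule D)
    show "N.prod_dist m \<one>\<^bsub>N.prod_group m\<^esub> (g \<one>\<^bsub>M.prod_group n\<^esub>) \<le> B"
    proof -
      note g1 = g[OF one(1,2)]
      have "N.prod_dist m \<one>\<^bsub>N.prod_group m\<^esub> (g \<one>\<^bsub>M.prod_group n\<^esub>)
          \<le> K' * (\<epsilon> k (f k x) (F' (g \<one>\<^bsub>M.prod_group n\<^esub>)) + C')"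
        using F'K[OF one(3) _ one(4), of "g \<one>\<^bsub>M.prod_group n\<^esub>"] g1 F'1 by simp
      also have "\<dots> \<le> K' * (C' + C')" using g1 F1 K by (intro mult_left_mono) auto
      finally show ?thesis using B B0 by (simp add: algebra_simps)
    qed
  next
    fix a assume "a \<in> ?P" "M.prod_dist n \<one>\<^bsub>M.prod_group n\<^esub> a \<le> D"
    then show "g a \<in> ?Q" using g M.prod_dist_one by simp
  next
    fix a b assume ab: "a \<in> ?P" "b \<in> ?P"
      and "M.prod_dist n \<one>\<^bsub>M.prod_group n\<^esub> a \<le> D" "M.prod_dist n \<one>\<^bsub>M.prod_group n\<^esub> b \<le> D"
    then have h: "M.height n a \<le> D" "M.height n b \<le> D"
      using M.prod_dist_one[OF ab(1)] M.prod_dist_one[OF ab(2)] by simp_all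
    note ga = g[OF ab(1) h(1)] and gb = g[OF ab(2) h(2)]
    note d = diff[OF ab(1) h(1) ab(2) h(2)]
    have FX: "F a \<in> X" "F b \<in> X" using F ab h by auto
    let ?\<rho> = "M.prod_dist n a b" and ?\<sigma> = "N.prod_dist m (g a) (g b)"
    have s1: "?\<sigma> \<le> K' * (\<epsilon> k (F' (g a)) (F' (g b)) + C')"
      and s2: "\<epsilon> k (F' (g a)) (F' (g b)) \<le> K' * ?\<sigma> + C'" using F'K ga gb by auto
    have r1: "?\<rho> \<le> K * (\<delta> k (F a) (F b) + C)" and r2: "\<delta> k (F a) (F b) \<le> K * ?\<rho> + C"
      using FK ab h by auto
    note u = f_upper[OF FX, of k] and l = f_lower[OF FX, of k]
    have "?\<sigma> \<le> K' * (L * \<delta> k (F a) (F b) + A + 3 * C')"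
      by (rule order_trans[OF s1]) (use d u K in \<open>intro mult_left_mono; linarith\<close>)
    also have "\<dots> \<le> K' * (L * (K * ?\<rho> + C) + A + 3 * C')"
      using r2 K L by (intro mult_left_mono add_right_mono) auto
    also have "\<dots> = K * K' * L * ?\<rho> + (K' * (L * C) + K' * A + 3 * (K' * C'))"
      by (simp add: algebra_simps)
    also have "\<dots> \<le> K * K' * L * ?\<rho> + B" using B B0 by simp
    finally show "?\<sigma> \<le> (K * K' * L) * ?\<rho> + B" .
    have "?\<rho> \<le> K * (L * (K' * ?\<sigma> + 3 * C' + A) + C)"
    proof -
      have "\<epsilon> k (f k (F a)) (f k (F b)) + A \<le> K' * ?\<sigma> + 3 * C' + A" using d s2 by linarith
      then have "L * (\<epsilon> k (f k (F a)) (f k (F b)) + A) \<le> L * (K' * ?\<sigma> + 3 * C' + A)"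
        using L by (intro mult_left_mono) auto
      then have "\<delta> k (F a) (F b) + C \<le> L * (K' * ?\<sigma> + 3 * C' + A) + C" using l by linarith
      then have "K * (\<delta> k (F a) (F b) + C) \<le> K * (L * (K' * ?\<sigma> + 3 * C' + A) + C)"
        using K by (intro mult_left_mono) auto
      then show ?thesis using r1 by linarith
    qed
    also have "\<dots> = K * K' * L * ?\<sigma> + K * L * (3 * C' + A) + K * C" by (simp add: algebra_simps)
    also have "\<dots> \<le> K * K' * L * ?\<sigma> + K * K' * L * B"
    proof -
      \<comment> \<open>Enough to absorb all additive constants into K * K' * L * B, so that the
        division below leaves B.\<close>
      have "3 * C' + A + C \<le> K' * B"
      proof -
        have "1 * (3 * C' + A + C) \<le> K' * (K' * (3 * C' + 2 * A + L * C))"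
        proof -
          have "C \<le> L * C" using L C by (simp add: mult_le_cancel_right1)
          then have 1: "3 * C' + A + C \<le> 3 * C' + 2 * A + L * C" using A by simp
          also have "\<dots> \<le> K' * (3 * C' + 2 * A + L * C)"
            using K A pos C mult_right_mono[of 1 K' "3 * C' + 2 * A + L * C"] by simp
          finally show ?thesis using K A pos C
            by (intro mult_mono) auto
        qed
        then show ?thesis by (simp add: B_def add_ac)
      qed
      then have "K * L * (3 * C' + A + C) \<le> K * L * (K' * B)" using K L by (intro mult_left_mono) auto
      moreover have "K * C \<le> K * L * C"
        using K L C mult_right_mono[of 1 L "K * C"] by (simp add: mult_ac)
      ultimately show ?thesis by (simp add: algebra_simps)
    qed
    finally have "?\<rho> \<le> (K * K' * L) * (?\<sigma> + B)" by (simp add: algebra_simps)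
    moreover have "0 < K * K' * L" using K L by simp
    ultimately show "?\<rho> / (K * K' * L) - B \<le> ?\<sigma>" by (simp add: divide_le_eq mult.commute diff_le_eq)
  next
    fix y assume y: "y \<in> ?Q" and "N.prod_dist m \<one>\<^bsub>N.prod_group m\<^esub> y \<le> R"
    then have hR: "N.height m y \<le> R" and h: "N.height m y \<le> D'" using N.prod_dist_one[OF y] D'(1) by simp_all
    \<comment> \<open>The element y is sent into N, lifted along f to z and expressed in the model
      of M; Z and D were chosen to keep z within range of that model.\<close>
    have F'y: "F' y \<in> Y" using F' y h by blast
    obtain z where z: "z \<in> X" "\<epsilon> k (F' y) (f k z) \<le> A" using f_onto[OF F'y] by blast
    have "\<epsilon> k (f k x) (F' y) \<le> K' * N.prod_dist m \<one>\<^bsub>N.prod_group m\<^esub> y + C'"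
      using F'K[OF one(3) y one(4) h] F'1 by simp
    also have "\<dots> \<le> K' * R + C'" using hR N.prod_dist_one[OF y] K by (simp add: mult_left_mono)
    finally have "\<epsilon> k (f k x) (f k z) + A \<le> K' * R + C' + 2 * A"
      using DN.triangle[OF f_closed[OF x(1), of k] F'y f_closed[OF z(1), of k]] z by linarith
    then have "L * (\<epsilon> k (f k x) (f k z) + A) \<le> Z" unfolding Z_def using L by (intro mult_left_mono) auto
    then have "\<delta> k x z \<le> Z" using f_lower[OF x(1) z(1), of k] by linarith
    then have "(\<delta> k x z + 1) * (1 + K) + n \<le> D" using D(3) K by (smt (verit) mult_right_mono)
    then obtain a where a: "a \<in> ?P" "M.height n a \<le> D" "\<delta> k z (F a) \<le> C" using Fs[OF z(1)] by blast
    note ga = g[OF a(1,2)]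
    have in_Y: "f k z \<in> Y" "f k (F a) \<in> Y" "F' (g a) \<in> Y" using z f_closed F a ga F' by auto
    have "\<epsilon> k (f k z) (f k (F a)) \<le> L * \<delta> k z (F a) + A" using f_upper z F a by blast
    also have "\<dots> \<le> L * C + A" using a L by simp
    finally have "\<epsilon> k (F' y) (F' (g a)) \<le> 2 * A + L * C + C'"
      using DN.triangle[OF F'y in_Y(1,3)] DN.triangle[OF in_Y(1,2,3)] z ga by linarith
    then have "K' * (\<epsilon> k (F' y) (F' (g a)) + C') \<le> K' * (2 * A + L * C + 2 * C')"
      using K by (intro mult_left_mono) auto
    moreover have "N.prod_dist m y (g a) \<le> K' * (\<epsilon> k (F' y) (F' (g a)) + C')"
      using F'K[OF y _ h] ga by blast
    ultimately have "N.prod_dist m y (g a) \<le> B" using B B0 by (simp add: algebra_simps)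
    moreover have "N.prod_dist m (g a) y = N.prod_dist m y (g a)"
      using N.prod_dist_commute y ga by blast
    ultimately show "\<exists>a\<in>?P. M.prod_dist n \<one>\<^bsub>M.prod_group n\<^esub> a \<le> D \<and>
          N.prod_dist m (g a) y \<le> B \<and> N.prod_dist m y (g a) \<le> B"
      using a M.prod_dist_one[OF a(1)] by (intro bexI[of _ a]) simp_all
  qed
qed

lemma quasi_isometric_prod:
  "quasi_isometric (carrier (M.prod_group n)) (M.prod_dist n) (carrier (N.prod_group m)) (N.prod_dist m)"
proof -
  interpret PM: group "M.prod_group n" by (rule M.group_prod)
  interpret PN: group "N.prod_group m" by (rule N.group_prod)
  have KKL: "1 \<le> K * K' * L"
    using M.K N.K L mult_mono[of 1 K 1 K'] mult_mono[of 1 "K * K'" 1 L] by simp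
  have B: "0 \<le> K' * (2 * A + L * (K * real n + 1) + 3 * (K' * real m + 1))"
    using M.K N.K L A by (intro mult_nonneg_nonneg add_nonneg_nonneg) auto
  show ?thesis
    by (rule quasi_isometric_of_local[OF KKL B PM.one_closed _ M.finite_prod_ball N.finite_prod_ball
          PN.one_closed ex_local_quasi_isometry])
      (rule N.prod_dist_triangle)
qed

lemma quasi_isometric_groups_prod: "quasi_isometric_groups (M.prod_group n) (N.prod_group m)"
  unfolding quasi_isometric_groups_def
proof (intro conjI allI impI)
  show "\<exists>S. finite_symmetric_generating_set (M.prod_group n) S" by (rule M.ex_gens_prod)
  show "\<exists>T. finite_symmetric_generating_set (N.prod_group m) T" by (rule N.ex_gens_prod)
  fix U V
  assume U: "finite_symmetric_generating_set (M.prod_group n) U"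
    and V: "finite_symmetric_generating_set (N.prod_group m) V"
  obtain k where k: "1 \<le> k" "\<forall>a\<in>carrier (M.prod_group n). \<forall>b\<in>carrier (M.prod_group n).
    word_metric (M.prod_group n) U a b \<le> k * M.prod_dist n a b \<and> M.prod_dist n a b \<le> k * word_metric (M.prod_group n) U a b"
    using M.word_metric_prod[OF U] by blast
  obtain k' where k': "1 \<le> k'" "\<forall>a\<in>carrier (N.prod_group m). \<forall>b\<in>carrier (N.prod_group m).
    word_metric (N.prod_group m) V a b \<le> k' * N.prod_dist m a b \<and> N.prod_dist m a b \<le> k' * word_metric (N.prod_group m) V a b"
    using N.word_metric_prod[OF V] by blast
  show "quasi_isometric (carrier (M.prod_group n)) (word_metric (M.prod_group n) U)
     (carrier (N.prod_group m)) (word_metric (N.prod_group m) V)"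
    by (rule quasi_isometric_change_metrics[OF quasi_isometric_prod k(1) k'(1)]) (use k(2) k'(2) in blast)+
qed

end

section \<open>An explicit admissible metric for an isometric action\<close>

section \<open>The largest metric on a level\<close>

context warped_space
begin

text \<open>Under an isometric action the jumps of a chain can be moved to its beginning, so chains
  made of one group element and one stretch already yield a metric. The value 0 outside X serves the
  nonnegativity and symmetry axioms of \<open>Metric_space\<close>, which range over the whole
  type.\<close>

definition orbit_dist :: "real \<Rightarrow> 'b \<Rightarrow> 'b \<Rightarrow> real"
  where "orbit_dist t x y =
    (if x \<in> X \<and> y \<in> X then INF g\<in>carrier G. real (len g) + t * d (\<phi> g x) y else 0)"

lemma orbit_dist_bdd: "0 \<le> t \<Longrightarrow> bdd_below ((\<lambda>g. real (len g) + t * d (\<phi> g x) y) ` carrier G)"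
  by (rule bdd_belowI[of _ 0]) auto

lemma orbit_dist_le:
  assumes "0 \<le> t" "x \<in> X" "y \<in> X" "g \<in> carrier G"
  shows "orbit_dist t x y \<le> real (len g) + t * d (\<phi> g x) y"
  unfolding orbit_dist_def using assms cINF_lower[OF orbit_dist_bdd[OF assms(1), of x y] assms(4)] by simp

lemma orbit_dist_less:
  assumes "0 \<le> t" "x \<in> X" "y \<in> X" "orbit_dist t x y < r"
  shows "\<exists>g\<in>carrier G. real (len g) + t * d (\<phi> g x) y < r"
proof -
  have "(INF g\<in>carrier G. real (len g) + t * d (\<phi> g x) y) < r" using assms by (simp add: orbit_dist_def)
  then show ?thesis using cINF_less_iff[OF _ orbit_dist_bdd[OF assms(1), of x y]] by auto
qed

lemma orbit_dist_nonneg: "0 \<le> t \<Longrightarrow> 0 \<le> orbit_dist t x y"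
  unfolding orbit_dist_def by (auto intro!: cINF_greatest)

text \<open>Symmetry inverts the group element, and the triangle inequality multiplies two of them.
  Definiteness uses that word length is integral: below distance 1 the unit is the only
  competitor.\<close>

lemma orbit_dist_metric:
  assumes t: "0 < t" shows "Metric_space X (orbit_dist t)"
proof
  have t0: "0 \<le> t" using t by simp
  show "0 \<le> orbit_dist t x y" for x y by (rule orbit_dist_nonneg[OF t0])
  have sym: "orbit_dist t y x \<le> orbit_dist t x y" if x: "x \<in> X" and y: "y \<in> X" for x y
  proof (rule field_le_epsilon)
    fix e :: real assume "0 < e"
    then have "orbit_dist t x y < orbit_dist t x y + e" by simp
    from orbit_dist_less[OF t0 x y this] obtain g where
      g: "g \<in> carrier G" "real (len g) + t * d (\<phi> g x) y < orbit_dist t x y + e" by blast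
    have "d (\<phi> (inv g) y) x = d (\<phi> (inv g) y) (\<phi> (inv g) (\<phi> g x))" using act_inv[OF g(1) x] by simp
    also have "\<dots> = d y (\<phi> g x)" using g(1) x y act_closed by (intro isometry) auto
    finally have "d (\<phi> (inv g) y) x = d (\<phi> g x) y" using commute by simp
    then have "orbit_dist t y x \<le> real (len g) + t * d (\<phi> g x) y"
      using orbit_dist_le[OF t0 y x, of "inv g"] g(1) len_inv[OF g(1)] by simp
    then show "orbit_dist t y x \<le> orbit_dist t x y + e" using g(2) by linarith
  qed
  show "orbit_dist t x y = orbit_dist t y x" for x y
  proof (cases "x \<in> X \<and> y \<in> X")
    case True
    then show ?thesis using sym[of x y] sym[of y x] by simp
  next
    case False
    then show ?thesis by (auto simp: orbit_dist_def)
  qed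
  show "orbit_dist t x y = 0 \<longleftrightarrow> x = y" if x: "x \<in> X" and y: "y \<in> X" for x y
  proof
    assume "x = y"
    then show "orbit_dist t x y = 0"
      using orbit_dist_le[OF t0 x y one_closed] act_one[OF x] x orbit_dist_nonneg[OF t0, of x y] by simp
  next
    assume 0: "orbit_dist t x y = 0"
    have "d x y \<le> e" if e: "0 < e" for e
    proof -
      have "orbit_dist t x y < min 1 (t * e)" using 0 e t by simp
      from orbit_dist_less[OF t0 x y this] obtain g where
        g: "g \<in> carrier G" "real (len g) + t * d (\<phi> g x) y < min 1 (t * e)" by blast
      have "0 \<le> t * d (\<phi> g x) y" using t0 by simp
      then have l: "real (len g) < 1" "t * d (\<phi> g x) y < t * e" using g(2) by auto
      then have "g = \<one>" using len_eq_0[OF g(1)] by simp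
      then have "t * d x y < t * e" using l act_one[OF x] by simp
      then show ?thesis using t by simp
    qed
    then have "d x y \<le> 0" by (rule field_le_epsilon[of "d x y" 0, simplified])
    then show "x = y" using zero[OF x y] nonneg[of x y] by linarith
  qed
  show "orbit_dist t x z \<le> orbit_dist t x y + orbit_dist t y z" if x: "x \<in> X" and y: "y \<in> X" and z: "z \<in> X" for x y z
  proof (rule field_le_epsilon)
    fix e :: real assume "0 < e"
    then have "orbit_dist t x y < orbit_dist t x y + e / 2" "orbit_dist t y z < orbit_dist t y z + e / 2" by auto
    with orbit_dist_less[OF t0 x y] orbit_dist_less[OF t0 y z] obtain g h where
      g: "g \<in> carrier G" "real (len g) + t * d (\<phi> g x) y < orbit_dist t x y + e / 2" and
      h: "h \<in> carrier G" "real (len h) + t * d (\<phi> h y) z < orbit_dist t y z + e / 2" by meson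
    have cl: "\<phi> g x \<in> X" "\<phi> h y \<in> X" "\<phi> h (\<phi> g x) \<in> X" using act_closed g(1) h(1) x y by auto
    have "d (\<phi> (h \<otimes> g) x) z \<le> d (\<phi> h (\<phi> g x)) (\<phi> h y) + d (\<phi> h y) z"
      using triangle[OF cl(3,2) z] act_mult[OF h(1) g(1) x] by simp
    also have "d (\<phi> h (\<phi> g x)) (\<phi> h y) = d (\<phi> g x) y" by (rule isometry[OF h(1) cl(1) y])
    finally have "t * d (\<phi> (h \<otimes> g) x) z \<le> t * (d (\<phi> g x) y + d (\<phi> h y) z)"
      using t0 by (intro mult_left_mono)
    moreover have "orbit_dist t x z \<le> real (len (h \<otimes> g)) + t * d (\<phi> (h \<otimes> g) x) z"
      using g(1) h(1) by (intro orbit_dist_le[OF t0 x z]) simp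
    moreover have "len (h \<otimes> g) \<le> len h + len g" by (rule len_mult[OF h(1) g(1)])
    ultimately show "orbit_dist t x z \<le> orbit_dist t x y + orbit_dist t y z + e"
      using g(2) h(2) by (simp add: distrib_left)
  qed
qed

lemma orbit_dist_le_scaled: "0 \<le> t \<Longrightarrow> x \<in> X \<Longrightarrow> y \<in> X \<Longrightarrow> orbit_dist t x y \<le> t * d x y"
  using orbit_dist_le[OF _ _ _ one_closed] act_one by simp

lemma orbit_dist_gen: "0 \<le> t \<Longrightarrow> x \<in> X \<Longrightarrow> s \<in> S \<Longrightarrow> orbit_dist t x (\<phi> s x) \<le> 1"
  using orbit_dist_le[of t x "\<phi> s x" s] gens_closed[of s] act_closed[of s x] len_gen[of s] by fastforce

text \<open>An element that comes within 1 of the infimum is the one that \<open>level\<close> asks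
  for.\<close>

lemma level_if_ge_orbit_dist:
  assumes t: "0 < t" and m: "Metric_space X \<delta>"
    and le: "\<And>x y. x \<in> X \<Longrightarrow> y \<in> X \<Longrightarrow> d x y < 1 \<Longrightarrow> \<delta> x y \<le> t * d x y"
    and gen: "\<And>x s. x \<in> X \<Longrightarrow> s \<in> S \<Longrightarrow> \<delta> x (\<phi> s x) \<le> 1"
    and ge: "\<And>x y. x \<in> X \<Longrightarrow> y \<in> X \<Longrightarrow> orbit_dist t x y \<le> \<delta> x y"
  shows "level t \<delta>"
proof -
  have "\<exists>g\<in>carrier G. real (len g) + t * d (\<phi> g x) y \<le> \<delta> x y + 1" if "x \<in> X" "y \<in> X" for x y
  proof -
    have "orbit_dist t x y < \<delta> x y + 1" using ge[OF that] by simp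
    from orbit_dist_less[OF less_imp_le[OF t] that this] show ?thesis by (meson less_imp_le)
  qed
  then show ?thesis unfolding level_def using m le gen by simp
qed

end

section \<open>Topology and differential calculus in coordinates\<close>

section \<open>Coordinate spaces\<close>

lemma topspace_real_space [simp]: "topspace (real_space n) = extensional {..<n}"
  by (auto simp: real_space_def PiE_def)

lemma continuous_map_coordinate: "i < n \<Longrightarrow> continuous_map (real_space n) euclideanreal (\<lambda>u. u i)"
  unfolding real_space_def by (rule continuous_map_product_coordinates) simp

lemma continuous_map_l1_dist: "continuous_map (real_space n) euclideanreal (l1_dist n u)"
  unfolding l1_dist_def
  by (intro continuous_map_sum continuous_map_real_abs continuous_map_diff continuous_map_coordinate) auto

definition l1_ball :: "nat \<Rightarrow> (nat \<Rightarrow> real) \<Rightarrow> real \<Rightarrow> (nat \<Rightarrow> real) set"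
  where "l1_ball n u r = {v \<in> extensional {..<n}. l1_dist n u v \<le> r}"

lemma l1_ball_mono: "r \<le> r' \<Longrightarrow> l1_ball n u r \<subseteq> l1_ball n u r'"
  by (auto simp: l1_ball_def)

lemma mem_l1_ball: "v \<in> l1_ball n u r \<longleftrightarrow> v \<in> extensional {..<n} \<and> l1_dist n u v \<le> r"
  by (simp add: l1_ball_def)

lemma abs_diff_le_l1_dist: "i < n \<Longrightarrow> \<bar>u i - v i\<bar> \<le> l1_dist n u v"
  unfolding l1_dist_def by (rule member_le_sum) auto

lemma l1_dist_eq_0:
  assumes "u \<in> extensional {..<n}" "v \<in> extensional {..<n}" "l1_dist n u v \<le> 0"
  shows "u = v"
proof
  fix i show "u i = v i"
    using assms abs_diff_le_l1_dist[of i n u v] by (cases "i < n") (auto simp: extensional_def)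
qed

lemma closedin_l1_ball: "closedin (real_space n) (l1_ball n u r)"
  using closedin_continuous_map_preimage[OF continuous_map_l1_dist[of n u], of "{..r}"]
  by (simp add: l1_ball_def)

lemma compactin_l1_ball: "compactin (real_space n) (l1_ball n u r)"
proof (rule closed_compactin[OF _ _ closedin_l1_ball])
  show "compactin (real_space n) (PiE {..<n} (\<lambda>i. {u i - r..u i + r}))"
    unfolding real_space_def by (simp add: compactin_PiE)
  show "l1_ball n u r \<subseteq> PiE {..<n} (\<lambda>i. {u i - r..u i + r})"
  proof
    fix v assume "v \<in> l1_ball n u r"
    then show "v \<in> PiE {..<n} (\<lambda>i. {u i - r..u i + r})"
      using abs_diff_le_l1_dist[of _ n u v] by (force simp: PiE_iff mem_l1_ball abs_le_iff)
  qed
qed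

lemma openin_l1_dist_less: "openin (real_space n) {v \<in> extensional {..<n}. l1_dist n u v < r}"
  using openin_continuous_map_preimage[OF continuous_map_l1_dist[of n u], of "{..<r}"] by simp

text \<open>Compares the product topology with the l1 distance: a basic box leaves a positive margin
  in each of finitely many coordinates, and half the least margin works.\<close>

lemma openin_contains_l1_ball:
  assumes V: "openin (real_space n) V" and u: "u \<in> V"
  shows "\<exists>r>0. l1_ball n u r \<subseteq> V"
proof -
  have "\<exists>U. finite {i \<in> {..<n}. U i \<noteq> topspace euclideanreal} \<and>
      (\<forall>i\<in>{..<n}. openin euclideanreal (U i)) \<and> u \<in> PiE {..<n} U \<and> PiE {..<n} U \<subseteq> V"
    using V[unfolded real_space_def openin_product_topology_alt] u by (rule bspec)
  then obtain U :: "nat \<Rightarrow> real set" where U': "\<forall>i\<in>{..<n}. openin euclideanreal (U i)" and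
    U2: "u \<in> PiE {..<n} U" "PiE {..<n} U \<subseteq> V" by (elim exE conjE)
  have U: "open (U i)" if "i < n" for i using U' that by simp
  have "\<forall>i\<in>{..<n}. \<exists>e. e > 0 \<and> (\<forall>y. \<bar>y - u i\<bar> < e \<longrightarrow> y \<in> U i)"
  proof
    fix i assume i: "i \<in> {..<n}"
    have "u i \<in> U i" by (rule PiE_mem[OF U2(1) i])
    then obtain e where "e > 0" "ball (u i) e \<subseteq> U i" using U i open_contains_ball by blast
    then show "\<exists>e. e > 0 \<and> (\<forall>y. \<bar>y - u i\<bar> < e \<longrightarrow> y \<in> U i)"
      by (intro exI[of _ e]) (auto simp: dist_real_def abs_minus_commute subset_iff)
  qed
  from bchoice[OF this] obtain e where "\<forall>i\<in>{..<n}. e i > 0 \<and> (\<forall>y. \<bar>y - u i\<bar> < e i \<longrightarrow> y \<in> U i)" ..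
  then have e: "\<And>i. i < n \<Longrightarrow> e i > 0" "\<And>i y. i < n \<Longrightarrow> \<bar>y - u i\<bar> < e i \<Longrightarrow> y \<in> U i" by auto
  \<comment> \<open>The inserted 1 covers dimension 0; halving makes the comparison with each margin
    strict, as the l1 balls are closed.\<close>
  define r where "r = Min (insert 1 (e ` {..<n})) / 2"
  have m: "0 < Min (insert 1 (e ` {..<n}))" using e(1) by simp
  have r: "0 < r" "r < e i" if "i < n" for i
  proof -
    have "Min (insert 1 (e ` {..<n})) \<le> e i" using that by (intro Min_le) auto
    then show "0 < r" "r < e i" unfolding r_def using m by linarith+
  qed
  have "v \<in> PiE {..<n} U" if v: "v \<in> l1_ball n u r" for v
  proof -
    have "v i \<in> U i" if i: "i < n" for i
      using e(2)[OF i, of "v i"] abs_diff_le_l1_dist[OF i, of u v] r(2)[OF i] v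
      by (simp add: mem_l1_ball abs_minus_commute)
    then show ?thesis using v by (simp add: mem_l1_ball PiE_iff)
  qed
  moreover have "0 < r" using m by (simp add: r_def)
  ultimately show ?thesis using U2(2) by blast
qed

lemma continuous_map_l1:
  assumes g: "continuous_map (subtopology (real_space n) V) euclideanreal g"
    and V: "openin (real_space n) V" and u: "u \<in> V" and e: "0 < e"
  shows "\<exists>r>0. \<forall>v\<in>l1_ball n u r. v \<in> V \<and> \<bar>g v - g u\<bar> < e"
proof -
  have VX: "V \<subseteq> extensional {..<n}" using openin_subset[OF V] by simp
  have "openin (subtopology (real_space n) V) {v \<in> topspace (subtopology (real_space n) V). g v \<in> ball (g u) e}"
    by (rule openin_continuous_map_preimage[OF g]) simp
  then have "openin (real_space n) {v \<in> V. g v \<in> ball (g u) e}"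
    using V VX by (simp add: openin_open_subtopology Int_absorb1 Int_absorb2 Collect_conj_eq[symmetric])
  from openin_contains_l1_ball[OF this, of u] u e
  show ?thesis by (auto simp: dist_real_def abs_minus_commute)
qed

section \<open>The chain rule along curves\<close>

text \<open>Going from u to v one coordinate at a time, the mean value theorem turns each step into
  a partial derivative at a point no further from u than v is; continuity of the partial derivatives
  gives the limit. This is total differentiability in the form of Caratheodory, with slopes that
  converge.\<close>

lemma difference_quotients:
  assumes V: "openin (real_space n) V" and f: "Ck_on n V (Suc 0) f" and u: "u \<in> V"
  shows "\<exists>G r. r > 0 \<and> (\<forall>v\<in>l1_ball n u r. f v - f u = (\<Sum>i<n. G i v * (v i - u i))) \<and>
    (\<forall>i<n. \<forall>e>0. \<exists>\<rho>>0. \<forall>v\<in>l1_ball n u \<rho>. \<bar>G i v - partial_deriv i f u\<bar> < e)"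
proof -
  obtain r where r: "r > 0" "l1_ball n u r \<subseteq> V" using openin_contains_l1_ball[OF V u] by blast
  have ux: "u \<in> extensional {..<n}" using openin_subset[OF V] u by auto
  \<comment> \<open>The first i coordinates are already replaced, so for v in the coordinate space
    the sequence runs from u at i = 0 to v at i = n.\<close>
  define z where "z i v = (\<lambda>j. if j < i then v j else u j)" for i :: nat and v :: "nat \<Rightarrow> real"
  \<comment> \<open>Where a step is trivial the quotient gets its limit value, which keeps both the
    expansion and the estimate valid.\<close>
  define G where "G i v = (if v i = u i then partial_deriv i f u
     else (f (z (Suc i) v) - f (z i v)) / (v i - u i))" for i v
  have zS: "z (Suc i) v = (z i v)(i := v i)" "z i v = (z i v)(i := u i)" for i v
    by (auto simp: z_def less_Suc_eq)
  have mid: "\<exists>y\<in>l1_ball n u (l1_dist n u v). G i v = partial_deriv i f y"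
    if v: "v \<in> l1_ball n u r" and i: "i < n" for i v
  proof (cases "v i = u i")
    case True
    then show ?thesis using ux by (intro bexI[of _ u]) (auto simp: G_def mem_l1_ball)
  next
    case False
    have in_ball: "(z i v)(i := s) \<in> l1_ball n u (l1_dist n u v)"
      if s: "min (u i) (v i) \<le> s" "s \<le> max (u i) (v i)" for s
    proof -
      have "\<bar>u j - ((z i v)(i := s)) j\<bar> \<le> \<bar>u j - v j\<bar>" for j
        using s by (auto simp: z_def)
      then have "l1_dist n u ((z i v)(i := s)) \<le> l1_dist n u v"
        unfolding l1_dist_def by (intro sum_mono)
      moreover have "(z i v)(i := s) \<in> extensional {..<n}"
        using ux v i by (auto simp: z_def extensional_def mem_l1_ball)
      ultimately show ?thesis by (simp add: mem_l1_ball)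
    qed
    define g where "g s = f ((z i v)(i := s))" for s
    have deriv: "(g has_real_derivative partial_deriv i f ((z i v)(i := s))) (at s)"
      if s: "min (u i) (v i) \<le> s" "s \<le> max (u i) (v i)" for s
    proof -
      have "(z i v)(i := s) \<in> V" using in_ball[OF s] r v by (auto simp: mem_l1_ball)
      moreover have "\<forall>x\<in>V. (\<lambda>\<tau>. f (x(i := \<tau>))) differentiable (at (x i))" using f i by simp
      ultimately have "(\<lambda>\<tau>. f ((z i v)(i := s, i := \<tau>))) differentiable (at (((z i v)(i := s)) i))"
        by (rule bspec[rotated])
      then have "(g has_real_derivative deriv g s) (at s)"
        by (simp add: g_def[abs_def] DERIV_deriv_iff_real_differentiable)
      moreover have "deriv g s = partial_deriv i f ((z i v)(i := s))"
        by (simp add: partial_deriv_def g_def[abs_def])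
      ultimately show ?thesis by simp
    qed
    have "\<exists>s. min (u i) (v i) \<le> s \<and> s \<le> max (u i) (v i) \<and>
        g (v i) - g (u i) = (v i - u i) * partial_deriv i f ((z i v)(i := s))"
    proof (cases "u i < v i")
      case True
      then obtain s where "u i < s" "s < v i"
        "g (v i) - g (u i) = (v i - u i) * partial_deriv i f ((z i v)(i := s))"
        using MVT2[of "u i" "v i" g "\<lambda>s. partial_deriv i f ((z i v)(i := s))"] deriv by auto
      then show ?thesis using True by (intro exI[of _ s]) auto
    next
      case neg: False
      with False have lt: "v i < u i" by simp
      then obtain s where "v i < s" "s < u i"
        "g (u i) - g (v i) = (u i - v i) * partial_deriv i f ((z i v)(i := s))"
        using MVT2[of "v i" "u i" g "\<lambda>s. partial_deriv i f ((z i v)(i := s))"] deriv by auto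
      then show ?thesis using lt by (intro exI[of _ s]) (auto simp: algebra_simps)
    qed
    then obtain s where s: "min (u i) (v i) \<le> s" "s \<le> max (u i) (v i)"
      "g (v i) - g (u i) = (v i - u i) * partial_deriv i f ((z i v)(i := s))" by blast
    have "g (v i) = f (z (Suc i) v)" "g (u i) = f (z i v)" unfolding g_def using zS by metis+
    then have "G i v = partial_deriv i f ((z i v)(i := s))" using s(3) False by (simp add: G_def)
    then show ?thesis using in_ball[OF s(1,2)] by blast
  qed
  show ?thesis
  proof (rule exI[of _ G], rule exI[of _ r], intro conjI ballI allI impI)
    show "r > 0" by (rule r)
    fix v assume v: "v \<in> l1_ball n u r"
    have zn: "z n v = v" "z 0 v = u"
      using ux v by (auto simp: z_def extensional_def mem_l1_ball fun_eq_iff)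
    have "f v - f u = (\<Sum>i<n. f (z (Suc i) v) - f (z i v))"
      using sum_lessThan_telescope[of "\<lambda>i. f (z i v)" n] zn by simp
    also have "\<dots> = (\<Sum>i<n. G i v * (v i - u i))"
    proof (rule sum.cong[OF refl])
      fix i
      have "z (Suc i) v = z i v" if "v i = u i" using zS[of i v] that by metis
      then show "f (z (Suc i) v) - f (z i v) = G i v * (v i - u i)" by (simp add: G_def)
    qed
    finally show "f v - f u = (\<Sum>i<n. G i v * (v i - u i))" .
  next
    fix i and e :: real assume i: "i < n" and e: "e > 0"
    have "continuous_map (subtopology (real_space n) V) euclideanreal (partial_deriv i f)"
      using f i by simp
    from continuous_map_l1[OF this V u e] obtain \<rho> where
      \<rho>: "\<rho> > 0" "\<And>v. v \<in> l1_ball n u \<rho> \<Longrightarrow> \<bar>partial_deriv i f v - partial_deriv i f u\<bar> < e" by blast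
    show "\<exists>\<rho>>0. \<forall>v\<in>l1_ball n u \<rho>. \<bar>G i v - partial_deriv i f u\<bar> < e"
    proof (intro exI[of _ "min \<rho> r"] conjI ballI)
      fix v assume v: "v \<in> l1_ball n u (min \<rho> r)"
      then have "v \<in> l1_ball n u r" by (simp add: mem_l1_ball)
      from mid[OF this i] obtain y where "y \<in> l1_ball n u (l1_dist n u v)" "G i v = partial_deriv i f y" by blast
      moreover have "l1_dist n u v \<le> \<rho>" using v by (simp add: mem_l1_ball)
      ultimately show "\<bar>G i v - partial_deriv i f u\<bar> < e" using \<rho>(2) l1_ball_mono by fastforce
    qed (use \<rho> r in simp)
  qed
qed

text \<open>Dividing the expansion of \<open>difference_quotients\<close> by the time increment
  leaves products of convergent factors. Derivatives within T include one-sided ones at the ends of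
  an interval.\<close>

lemma chain_rule:
  assumes V: "openin (real_space n) V" and f: "Ck_on n V (Suc 0) f"
    and t: "t \<in> T" and c: "\<And>\<tau>. \<tau> \<in> T \<Longrightarrow> c \<tau> \<in> V"
    and D: "\<And>i. i < n \<Longrightarrow> ((\<lambda>\<tau>. c \<tau> i) has_real_derivative D i) (at t within T)"
  shows "((\<lambda>\<tau>. f (c \<tau>)) has_real_derivative (\<Sum>i<n. partial_deriv i f (c t) * D i)) (at t within T)"
proof -
  from difference_quotients[OF V f c[OF t]] obtain G r where r: "r > 0" and
    G: "\<forall>v\<in>l1_ball n (c t) r. f v - f (c t) = (\<Sum>i<n. G i v * (v i - c t i))" and
    Glim: "\<forall>i<n. \<forall>e>0. \<exists>\<rho>>0. \<forall>v\<in>l1_ball n (c t) \<rho>. \<bar>G i v - partial_deriv i f (c t)\<bar> < e"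
    by (elim exE conjE)
  have inT: "\<forall>\<^sub>F \<tau> in at t within T. \<tau> \<in> T" by (simp add: eventually_at_filter)
  have ext: "c \<tau> \<in> extensional {..<n}" if "\<tau> \<in> T" for \<tau>
    using openin_subset[OF V] c[OF that] by auto
  have near: "\<forall>\<^sub>F \<tau> in at t within T. c \<tau> \<in> l1_ball n (c t) \<rho>" if \<rho>: "\<rho> > 0" for \<rho>
  proof -
    have "((\<lambda>\<tau>. l1_dist n (c t) (c \<tau>)) \<longlongrightarrow> (\<Sum>i<n. \<bar>c t i - c t i\<bar>)) (at t within T)"
      unfolding l1_dist_def
    proof (intro tendsto_sum tendsto_rabs tendsto_diff tendsto_const)
      fix i assume "i \<in> {..<n}"
      then have "continuous (at t within T) (\<lambda>\<tau>. c \<tau> i)" using D DERIV_continuous by blast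
      then show "((\<lambda>\<tau>. c \<tau> i) \<longlongrightarrow> c t i) (at t within T)" by (simp add: continuous_within)
    qed
    then have "\<forall>\<^sub>F \<tau> in at t within T. l1_dist n (c t) (c \<tau>) < \<rho>"
      using \<rho> by (intro order_tendstoD) auto
    with inT show ?thesis by eventually_elim (simp add: mem_l1_ball ext)
  qed
  have "((\<lambda>\<tau>. \<Sum>i<n. G i (c \<tau>) * ((c \<tau> i - c t i) / (\<tau> - t))) \<longlongrightarrow> (\<Sum>i<n. partial_deriv i f (c t) * D i)) (at t within T)"
  proof (intro tendsto_sum tendsto_mult)
    fix i assume "i \<in> {..<n}"
    then have i: "i < n" by simp
    show "((\<lambda>\<tau>. (c \<tau> i - c t i) / (\<tau> - t)) \<longlongrightarrow> D i) (at t within T)"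
      using D[OF i] by (simp add: has_field_derivative_iff)
    show "((\<lambda>\<tau>. G i (c \<tau>)) \<longlongrightarrow> partial_deriv i f (c t)) (at t within T)"
    proof (rule tendstoI)
      fix e :: real assume "e > 0"
      with Glim i have "\<exists>\<rho>>0. \<forall>v\<in>l1_ball n (c t) \<rho>. \<bar>G i v - partial_deriv i f (c t)\<bar> < e" by simp
      then obtain \<rho> where \<rho>: "\<rho> > 0"
        "\<forall>v\<in>l1_ball n (c t) \<rho>. \<bar>G i v - partial_deriv i f (c t)\<bar> < e" by blast
      from near[OF \<rho>(1)] show "\<forall>\<^sub>F \<tau> in at t within T. dist (G i (c \<tau>)) (partial_deriv i f (c t)) < e"
        by eventually_elim (use \<rho>(2) in \<open>simp add: dist_real_def\<close>)
    qed
  qed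
  moreover have "\<forall>\<^sub>F \<tau> in at t within T.
     (\<Sum>i<n. G i (c \<tau>) * ((c \<tau> i - c t i) / (\<tau> - t))) = (f (c \<tau>) - f (c t)) / (\<tau> - t)"
    using near[OF r] by eventually_elim (simp add: G sum_divide_distrib)
  ultimately show ?thesis
    unfolding has_field_derivative_iff by (rule Lim_transform_eventually)
qed

section \<open>Speed and length of curves in a compact Riemannian manifold\<close>

section \<open>Charts and curves in Riemannian manifolds\<close>

lemma quadratic_form_cong:
  "(\<And>i. i < mdim M \<Longrightarrow> v i = w i) \<Longrightarrow> quadratic_form M c p v = quadratic_form M c p w"
  unfolding quadratic_form_def by (intro sum.cong) auto

lemma quadratic_form_scale:
  "quadratic_form M c p (\<lambda>i. a * v i) = a\<^sup>2 * quadratic_form M c p v"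
  unfolding quadratic_form_def sum_distrib_left
  by (intro sum.cong) (auto simp: power2_eq_square)

locale compact_riemannian =
  fixes M :: "'a riemannian_structure"
  assumes crm: "compact_riemannian_manifold M"
begin

abbreviation n where "n \<equiv> mdim M"
abbreviation img where "img c \<equiv> coord c ` cdom c"
abbreviation img_top where "img_top c \<equiv> subtopology (real_space n) (img c)"

lemma Hausdorff: "Hausdorff_space (mtop M)" and nonempty_points: "points M \<noteq> {}"
  and compact_points: "compact_space (mtop M)"
  and cover: "(\<Union>c\<in>atlas M. cdom c) = points M"
  using crm by (auto simp: compact_riemannian_manifold_def smooth_manifold_def)

lemma ex_chart: "p \<in> points M \<Longrightarrow> \<exists>c\<in>atlas M. p \<in> cdom c"
  using cover by blast

lemma cdom_open: "c \<in> atlas M \<Longrightarrow> openin (mtop M) (cdom c)"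
  and img_open: "c \<in> atlas M \<Longrightarrow> openin (real_space n) (img c)"
  and coord_homeo: "c \<in> atlas M \<Longrightarrow> homeomorphic_map (subtopology (mtop M) (cdom c)) (img_top c) (coord c)"
  using crm by (auto simp: compact_riemannian_manifold_def smooth_manifold_def is_chart_def)

lemma cdom_subset: "c \<in> atlas M \<Longrightarrow> cdom c \<subseteq> points M"
  using cdom_open openin_subset by blast

lemma coord_extensional: "c \<in> atlas M \<Longrightarrow> p \<in> cdom c \<Longrightarrow> coord c p \<in> extensional {..<n}"
  using openin_subset[OF img_open, of c] by (simp add: image_subset_iff)

lemma coord_inj: "c \<in> atlas M \<Longrightarrow> inj_on (coord c) (cdom c)"
  using homeomorphic_imp_injective_map[OF coord_homeo] cdom_subset
  by (simp add: Int_absorb1)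

lemma coord_inv_coord [simp]: "c \<in> atlas M \<Longrightarrow> p \<in> cdom c \<Longrightarrow> coord_inv c (coord c p) = p"
  by (rule inv_into_f_f[OF coord_inj])

lemma coord_coord_inv [simp]: "u \<in> img c \<Longrightarrow> coord c (coord_inv c u) = u"
  by (rule f_inv_into_f)

lemma coord_inv_in: "u \<in> img c \<Longrightarrow> coord_inv c u \<in> cdom c"
  by (rule inv_into_into)

lemma coord_inv_point: "c \<in> atlas M \<Longrightarrow> u \<in> img c \<Longrightarrow> coord_inv c u \<in> points M"
  by (rule subsetD[OF cdom_subset coord_inv_in])

lemma continuous_coord:
  "c \<in> atlas M \<Longrightarrow> continuous_map (subtopology (mtop M) (cdom c)) (img_top c) (coord c)"
  by (rule homeomorphic_imp_continuous_map[OF coord_homeo])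

lemma continuous_coord_inv:
  assumes c: "c \<in> atlas M"
  shows "continuous_map (img_top c) (subtopology (mtop M) (cdom c)) (coord_inv c)"
proof -
  obtain g where g: "homeomorphic_maps (subtopology (mtop M) (cdom c)) (img_top c) (coord c) g"
    using coord_homeo[OF c] homeomorphic_map_maps by blast
  have "g u = coord_inv c u" if u: "u \<in> topspace (img_top c)" for u
  proof -
    from u obtain p where p: "p \<in> cdom c" "u = coord c p" by auto
    then have "g (coord c p) = p"
      using g cdom_subset[OF c] by (auto simp: homeomorphic_maps_def)
    then show ?thesis using p c by simp
  qed
  moreover have "continuous_map (img_top c) (subtopology (mtop M) (cdom c)) g"
    using g by (simp add: homeomorphic_maps_def)
  ultimately show ?thesis by (rule continuous_map_eq[rotated])
qed

lemma continuous_metric_tensor: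
  assumes "c \<in> atlas M" "i < n" "j < n"
  shows "continuous_map (img_top c) euclideanreal (\<lambda>u. metric_tensor M c (coord_inv c u) i j)"
proof -
  have "smooth_fun_on n (img c) (\<lambda>u. metric_tensor M c (coord_inv c u) i j)"
    using crm assms by (simp add: compact_riemannian_manifold_def riemannian_metric_def)
  then have "Ck_on n (img c) 0 (\<lambda>u. metric_tensor M c (coord_inv c u) i j)"
    unfolding smooth_fun_on_def by blast
  then show ?thesis by simp
qed

lemma quadratic_form_pos:
  assumes "c \<in> atlas M" "p \<in> cdom c" "i < n" "v i \<noteq> 0"
  shows "0 < quadratic_form M c p v"
proof -
  have "\<forall>p\<in>cdom c. \<forall>v. (\<exists>i<n. v i \<noteq> 0) \<longrightarrow> 0 < quadratic_form M c p v"
    using crm assms(1) by (simp add: compact_riemannian_manifold_def riemannian_metric_def)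
  then show ?thesis using assms by blast
qed

lemma quadratic_form_nonneg:
  assumes "c \<in> atlas M" "p \<in> cdom c"
  shows "0 \<le> quadratic_form M c p v"
proof (cases "\<exists>i<n. v i \<noteq> 0")
  case True
  then show ?thesis using quadratic_form_pos[OF assms] less_imp_le by blast
next
  case False
  then show ?thesis by (simp add: quadratic_form_def)
qed

lemma openin_overlap:
  assumes c: "c \<in> atlas M" and U: "openin (mtop M) U"
  shows "openin (real_space n) (coord c ` (cdom c \<inter> U))"
proof -
  have "openin (subtopology (mtop M) (cdom c)) (cdom c \<inter> U)"
    using U by (auto simp: openin_subtopology)
  then have "openin (img_top c) (coord c ` (cdom c \<inter> U))"
    using homeomorphic_imp_open_map[OF coord_homeo[OF c]] by (simp add: open_map_def)
  then show ?thesis using openin_open_subtopology[OF img_open[OF c]] by blast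
qed

lemma smooth_transition:
  assumes "c \<in> atlas M" "c' \<in> atlas M" "k < n"
  shows "Ck_on n (coord c ` (cdom c \<inter> cdom c')) (Suc 0) (\<lambda>u. transition c c' u k)"
proof -
  have "smooth_fun_on n (coord c ` (cdom c \<inter> cdom c')) (\<lambda>u. transition c c' u k)"
    using crm assms by (simp add: compact_riemannian_manifold_def smooth_manifold_def)
  then show ?thesis unfolding smooth_fun_on_def by blast
qed

text \<open>The transformation law of the metric tensor is substituted, and adjacent swaps of sums
  bring the index order i, j, k, l to k, l, i, j.\<close>

lemma quadratic_form_transition:
  assumes c: "c \<in> atlas M" "c' \<in> atlas M" and p: "p \<in> cdom c" "p \<in> cdom c'"
  defines "J \<equiv> \<lambda>i k. partial_deriv i (\<lambda>u. transition c c' u k) (coord c p)"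
  shows "quadratic_form M c p v = quadratic_form M c' p (\<lambda>k. \<Sum>i<n. J i k * v i)"
proof -
  have g: "metric_tensor M c p i j = (\<Sum>k<n. \<Sum>l<n. J i k * J j l * metric_tensor M c' p k l)"
    if "i < n" "j < n" for i j
  proof -
    have "\<forall>c\<in>atlas M. \<forall>c'\<in>atlas M. \<forall>p\<in>cdom c \<inter> cdom c'. \<forall>i<n. \<forall>j<n.
       metric_tensor M c p i j =
         (\<Sum>k<n. \<Sum>l<n. partial_deriv i (\<lambda>u. transition c c' u k) (coord c p) *
            partial_deriv j (\<lambda>u. transition c c' u l) (coord c p) * metric_tensor M c' p k l)"
      using crm unfolding compact_riemannian_manifold_def riemannian_metric_def by (elim conjE)
    then show ?thesis using c p that unfolding J_def by blast
  qed
  let ?g = "metric_tensor M c' p"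
  have "quadratic_form M c p v = (\<Sum>i<n. \<Sum>j<n. \<Sum>k<n. \<Sum>l<n. J i k * J j l * ?g k l * v i * v j)"
    unfolding quadratic_form_def by (intro sum.cong refl) (simp add: g sum_distrib_right)
  also have "\<dots> = (\<Sum>i<n. \<Sum>k<n. \<Sum>j<n. \<Sum>l<n. J i k * J j l * ?g k l * v i * v j)"
    by (intro sum.cong refl sum.swap)
  also have "\<dots> = (\<Sum>k<n. \<Sum>i<n. \<Sum>j<n. \<Sum>l<n. J i k * J j l * ?g k l * v i * v j)"
    by (rule sum.swap)
  also have "\<dots> = (\<Sum>k<n. \<Sum>i<n. \<Sum>l<n. \<Sum>j<n. J i k * J j l * ?g k l * v i * v j)"
    by (intro sum.cong refl sum.swap)
  also have "\<dots> = (\<Sum>k<n. \<Sum>l<n. \<Sum>i<n. \<Sum>j<n. J i k * J j l * ?g k l * v i * v j)"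
    by (intro sum.cong refl sum.swap)
  also have "\<dots> = quadratic_form M c' p (\<lambda>k. \<Sum>i<n. J i k * v i)"
    unfolding quadratic_form_def
    by (intro sum.cong refl) (simp add: sum_product sum_distrib_left mult_ac)
  finally show ?thesis .
qed

lemma path_nbhd:
  assumes \<gamma>: "pathin (mtop M) \<gamma>" and t: "t \<in> {0..1}" and U: "openin (mtop M) U" "\<gamma> t \<in> U"
  shows "\<exists>e>0. \<forall>\<tau>\<in>{0..1}. \<bar>\<tau> - t\<bar> < e \<longrightarrow> \<gamma> \<tau> \<in> U"
proof -
  have "openin (top_of_set {0..1}) {\<tau> \<in> topspace (top_of_set {0..1}). \<gamma> \<tau> \<in> U}"
    using \<gamma> U(1) unfolding pathin_def by (rule openin_continuous_map_preimage)
  then have "openin (top_of_set {0..1}) {\<tau> \<in> {0..1}. \<gamma> \<tau> \<in> U}" by simp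
  moreover have "t \<in> {\<tau> \<in> {0..1}. \<gamma> \<tau> \<in> U}" using t U by simp
  ultimately obtain e where e: "e > 0" "ball t e \<inter> {0..1} \<subseteq> {\<tau> \<in> {0..1}. \<gamma> \<tau> \<in> U}"
    unfolding openin_contains_ball by blast
  show ?thesis
  proof (intro exI[of _ e] conjI ballI impI)
    fix \<tau> :: real assume "\<tau> \<in> {0..1}" "\<bar>\<tau> - t\<bar> < e"
    then have "\<tau> \<in> ball t e \<inter> {0..1}" by (simp add: dist_real_def abs_minus_commute)
    then show "\<gamma> \<tau> \<in> U" using e by blast
  qed (rule e)
qed

lemma continuous_on_curve:
  assumes \<gamma>: "pathin (mtop M) \<gamma>" and c: "c \<in> atlas M" and I: "I \<subseteq> {0..1}" "\<gamma> ` I \<subseteq> cdom c"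
    and g: "continuous_map (img_top c) euclideanreal g"
  shows "continuous_on I (\<lambda>\<tau>. g (coord c (\<gamma> \<tau>)))"
proof -
  have "continuous_map (top_of_set I) (mtop M) \<gamma>"
    using \<gamma> continuous_map_from_subtopology_mono[OF _ I(1)] unfolding pathin_def by blast
  then have "continuous_map (top_of_set I) (subtopology (mtop M) (cdom c)) \<gamma>"
    using I(2) by (intro continuous_map_into_subtopology) auto
  from continuous_map_compose[OF continuous_map_compose[OF this continuous_coord[OF c]] g]
  show ?thesis by (simp add: comp_def)
qed

lemma continuous_on_coord_curve:
  assumes "pathin (mtop M) \<gamma>" "c \<in> atlas M" "I \<subseteq> {0..1}" "\<gamma> ` I \<subseteq> cdom c" "i < n"
  shows "continuous_on I (\<lambda>\<tau>. coord c (\<gamma> \<tau>) i)"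
  by (rule continuous_on_curve[OF assms(1-4)])
    (rule continuous_map_from_subtopology[OF continuous_map_coordinate[OF assms(5)]])

lemma coord_curve_transition:
  assumes \<gamma>: "pathin (mtop M) \<gamma>" and t: "t \<in> {0<..<1}" and c: "c \<in> atlas M" "c' \<in> atlas M"
    and p: "\<gamma> t \<in> cdom c" "\<gamma> t \<in> cdom c'" and k: "k < n"
    and v: "\<And>i. i < n \<Longrightarrow> ((\<lambda>\<tau>. coord c (\<gamma> \<tau>) i) has_real_derivative v i) (at t)"
  shows "((\<lambda>\<tau>. coord c' (\<gamma> \<tau>) k) has_real_derivative
    (\<Sum>i<n. partial_deriv i (\<lambda>u. transition c c' u k) (coord c (\<gamma> t)) * v i)) (at t)"
proof -
  have "openin (mtop M) (cdom c \<inter> cdom c')" using cdom_open c by blast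
  from path_nbhd[OF \<gamma> _ this, of t] obtain e where
    e: "e > 0" "\<And>\<tau>. \<tau> \<in> {0..1} \<Longrightarrow> \<bar>\<tau> - t\<bar> < e \<Longrightarrow> \<gamma> \<tau> \<in> cdom c \<inter> cdom c'"
    using t p by auto
  \<comment> \<open>An open set of times spent in both charts; on it, derivatives within T are full
    derivatives.\<close>
  define T where "T = {0<..<1} \<inter> ball t e"
  have T: "open T" "t \<in> T" using t e by (auto simp: T_def)
  have \<gamma>T: "\<gamma> \<tau> \<in> cdom c \<inter> cdom c'" if "\<tau> \<in> T" for \<tau>
    using e(2)[of \<tau>] that by (auto simp: T_def dist_real_def abs_minus_commute)
  have "((\<lambda>\<tau>. transition c c' (coord c (\<gamma> \<tau>)) k) has_real_derivative
    (\<Sum>i<n. partial_deriv i (\<lambda>u. transition c c' u k) (coord c (\<gamma> t)) * v i)) (at t within T)"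
  proof (rule chain_rule[OF openin_overlap[OF c(1) cdom_open[OF c(2)]] smooth_transition[OF c k] T(2)])
    show "coord c (\<gamma> \<tau>) \<in> coord c ` (cdom c \<inter> cdom c')" if "\<tau> \<in> T" for \<tau>
      using \<gamma>T[OF that] by blast
    show "((\<lambda>\<tau>. coord c (\<gamma> \<tau>) i) has_real_derivative v i) (at t within T)" if "i < n" for i
      using v[OF that] by (rule DERIV_subset) simp
  qed
  then have "((\<lambda>\<tau>. transition c c' (coord c (\<gamma> \<tau>)) k) has_real_derivative
    (\<Sum>i<n. partial_deriv i (\<lambda>u. transition c c' u k) (coord c (\<gamma> t)) * v i)) (at t)"
    by (simp only: at_within_open[OF T(2,1)])
  then show ?thesis
    by (rule has_field_derivative_transform_within_open[OF _ T]) (use \<gamma>T c in \<open>simp add: transition_def\<close>)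
qed

text \<open>Justifies the definite description in \<open>curve_speed\<close>: velocities in two
  charts are related by the Jacobian of the transition map, and the quadratic form transforms
  accordingly.\<close>

lemma curve_speed_eq:
  assumes \<gamma>: "pathin (mtop M) \<gamma>" and t: "t \<in> {0<..<1}" and c: "c \<in> atlas M" "\<gamma> t \<in> cdom c"
    and v: "\<And>i. i < n \<Longrightarrow> ((\<lambda>\<tau>. coord c (\<gamma> \<tau>) i) has_real_derivative v i) (at t)"
  shows "curve_speed M \<gamma> t = sqrt (quadratic_form M c (\<gamma> t) v)"
  unfolding curve_speed_def
proof (rule the_equality)
  show "\<exists>c'\<in>atlas M. \<exists>v'. \<gamma> t \<in> cdom c' \<and>
       (\<forall>i<n. ((\<lambda>\<tau>. coord c' (\<gamma> \<tau>) i) has_real_derivative v' i) (at t)) \<and>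
       sqrt (quadratic_form M c (\<gamma> t) v) = sqrt (quadratic_form M c' (\<gamma> t) v')"
    using c v by blast
  fix s
  assume "\<exists>c'\<in>atlas M. \<exists>v'. \<gamma> t \<in> cdom c' \<and>
       (\<forall>i<n. ((\<lambda>\<tau>. coord c' (\<gamma> \<tau>) i) has_real_derivative v' i) (at t)) \<and>
       s = sqrt (quadratic_form M c' (\<gamma> t) v')"
  then obtain c' v' where c': "c' \<in> atlas M" "\<gamma> t \<in> cdom c'"
    and v': "\<forall>i<n. ((\<lambda>\<tau>. coord c' (\<gamma> \<tau>) i) has_real_derivative v' i) (at t)"
    and s: "s = sqrt (quadratic_form M c' (\<gamma> t) v')" by blast
  have "v' k = (\<Sum>i<n. partial_deriv i (\<lambda>u. transition c c' u k) (coord c (\<gamma> t)) * v i)" if k: "k < n" for k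
  proof (rule DERIV_unique)
    show "((\<lambda>\<tau>. coord c' (\<gamma> \<tau>) k) has_real_derivative v' k) (at t)" using v' k by simp
    show "((\<lambda>\<tau>. coord c' (\<gamma> \<tau>) k) has_real_derivative
        (\<Sum>i<n. partial_deriv i (\<lambda>u. transition c c' u k) (coord c (\<gamma> t)) * v i)) (at t)"
      by (rule coord_curve_transition[OF \<gamma> t c(1) c'(1) c(2) c'(2) k v])
  qed
  then show "s = sqrt (quadratic_form M c (\<gamma> t) v)"
    unfolding s quadratic_form_transition[OF c(1) c'(1) c(2) c'(2)]
    by (intro arg_cong[of _ _ sqrt] quadratic_form_cong)
qed

lemma continuous_quadratic_form:
  assumes c: "c \<in> atlas M"
  shows "continuous_map (prod_topology (img_top c) (real_space n)) euclideanreal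
    (\<lambda>x. quadratic_form M c (coord_inv c (fst x)) (snd x))"
  unfolding quadratic_form_def
proof (intro continuous_map_sum continuous_map_real_mult)
  fix i j assume ij: "i \<in> {..<n}" "j \<in> {..<n}"
  show "continuous_map (prod_topology (img_top c) (real_space n)) euclideanreal
      (\<lambda>x. metric_tensor M c (coord_inv c (fst x)) i j)"
    using continuous_map_compose[OF continuous_map_fst continuous_metric_tensor[OF c, of i j]] ij
    by (simp add: comp_def)
  have co: "continuous_map (prod_topology (img_top c) (real_space n)) euclideanreal (\<lambda>x. snd x i)"
    if "i < n" for i
    using continuous_map_compose[OF continuous_map_snd continuous_map_coordinate[OF that]]
    by (simp add: comp_def)
  show "continuous_map (prod_topology (img_top c) (real_space n)) euclideanreal (\<lambda>x. snd x i)"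
    "continuous_map (prod_topology (img_top c) (real_space n)) euclideanreal (\<lambda>x. snd x j)"
    using co ij by auto
qed auto

text \<open>By homogeneity in v it suffices to take the extreme values of the form on the compact
  product of Q with the l1 unit sphere.\<close>

lemma quadratic_form_bounds:
  assumes c: "c \<in> atlas M" and Q: "Q \<subseteq> img c" "compactin (real_space n) Q"
  shows "\<exists>a b. 0 < a \<and> 0 < b \<and> (\<forall>u\<in>Q. \<forall>v. a * l1_dist n (\<lambda>_. 0) v \<le> sqrt (quadratic_form M c (coord_inv c u) v) \<and>
      sqrt (quadratic_form M c (coord_inv c u) v) \<le> b * l1_dist n (\<lambda>_. 0) v)"
proof -
  define Z where "Z = {w \<in> extensional {..<n}. l1_dist n (\<lambda>_. 0) w = 1}"
  have "closedin (real_space n) Z"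
    using closedin_continuous_map_preimage[OF continuous_map_l1_dist[of n "\<lambda>_. 0"], of "{1}"]
    by (simp add: Z_def)
  moreover have "Z \<subseteq> l1_ball n (\<lambda>_. 0) 1" by (auto simp: Z_def mem_l1_ball)
  ultimately have Zc: "compactin (real_space n) Z" by (meson closed_compactin compactin_l1_ball)
  define f where "f = (\<lambda>x. quadratic_form M c (coord_inv c (fst x)) (snd x))"
  have "compactin (prod_topology (img_top c) (real_space n)) (Q \<times> Z)"
    using Q Zc by (simp add: compactin_Times compactin_subtopology)
  then have "compactin euclideanreal (f ` (Q \<times> Z))"
    using continuous_quadratic_form[OF c] unfolding f_def by (rule image_compactin)
  then have comp: "compact (f ` (Q \<times> Z))" by simp
  have pos: "0 < f x" if xQ: "x \<in> Q \<times> Z" for x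
  proof -
    obtain u w where x: "x = (u, w)" "u \<in> Q" "w \<in> Z" using xQ by auto
    have "\<exists>i<n. w i \<noteq> 0"
      using x(3) by (auto simp: Z_def l1_dist_def intro: ccontr)
    then show ?thesis
      using quadratic_form_pos[OF c coord_inv_in] x Q(1) by (auto simp: f_def)
  qed
  have "\<exists>m b. 0 < m \<and> 0 < b \<and> (\<forall>x\<in>Q \<times> Z. m \<le> f x \<and> f x \<le> b)"
  proof (cases "Q \<times> Z = {}")
    \<comment> \<open>Besides an empty Q this covers dimension 0, where the unit sphere is
      empty.\<close>
    case True
    then show ?thesis by (intro exI[of _ 1]) auto
  next
    case False
    then have ne: "f ` (Q \<times> Z) \<noteq> {}" by blast
    obtain x where x: "x \<in> Q \<times> Z" "\<forall>y\<in>f ` (Q \<times> Z). f x \<le> y" using compact_attains_inf[OF comp ne] by blast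
    obtain z where z: "z \<in> Q \<times> Z" "\<forall>y\<in>f ` (Q \<times> Z). y \<le> f z" using compact_attains_sup[OF comp ne] by blast
    show ?thesis by (rule exI[of _ "f x"], rule exI[of _ "f z"]) (use x z pos in auto)
  qed
  then obtain m b where mb: "0 < m" "0 < b" "\<And>x. x \<in> Q \<times> Z \<Longrightarrow> m \<le> f x \<and> f x \<le> b" by blast
  show ?thesis
  proof (rule exI[of _ "sqrt m"], rule exI[of _ "sqrt b"], intro conjI ballI allI)
    fix u v assume u: "u \<in> Q"
    define N where "N = l1_dist n (\<lambda>_. 0) v"
    have "sqrt m * N \<le> sqrt (quadratic_form M c (coord_inv c u) v) \<and>
      sqrt (quadratic_form M c (coord_inv c u) v) \<le> sqrt b * N"
    proof (cases "N = 0")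
      case True
      then have "v i = 0" if "i < n" for i
        using abs_diff_le_l1_dist[OF that, of "\<lambda>_. 0" v] by (simp add: N_def)
      then have "quadratic_form M c (coord_inv c u) v = 0" by (simp add: quadratic_form_def)
      then show ?thesis using True by simp
    next
      case False
      then have N: "N > 0" using l1_dist_nonneg[of n "\<lambda>_. 0" v] unfolding N_def by linarith
      define w where "w = (\<lambda>i\<in>{..<n}. v i / N)"
      have "l1_dist n (\<lambda>_. 0) w = (\<Sum>i<n. \<bar>v i\<bar> / N)"
        unfolding l1_dist_def using N by (intro sum.cong) (auto simp: w_def)
      also have "\<dots> = N / N" unfolding sum_divide_distrib[symmetric] by (simp add: N_def l1_dist_def)
      finally have "w \<in> Z" using N by (simp add: Z_def w_def)
      then have f: "m \<le> f (u, w)" "f (u, w) \<le> b" using mb(3)[of "(u, w)"] u by auto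
      have "quadratic_form M c (coord_inv c u) v = quadratic_form M c (coord_inv c u) (\<lambda>i. N * w i)"
        using N by (intro quadratic_form_cong) (simp add: w_def)
      also have "\<dots> = N\<^sup>2 * f (u, w)" by (simp add: quadratic_form_scale f_def)
      finally have "sqrt (quadratic_form M c (coord_inv c u) v) = N * sqrt (f (u, w))"
        using N by (simp add: real_sqrt_mult)
      then show ?thesis using f N by (simp add: mult.commute[of _ N])
    qed
    then show "sqrt m * l1_dist n (\<lambda>_. 0) v \<le> sqrt (quadratic_form M c (coord_inv c u) v)"
      "sqrt (quadratic_form M c (coord_inv c u) v) \<le> sqrt b * l1_dist n (\<lambda>_. 0) v"
      by (auto simp: N_def)
  qed (use mb in auto)
qed

end

section \<open>Lengths of curves\<close>

context compact_riemannian
begin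

lemma pathin_points: "pathin (mtop M) \<gamma> \<Longrightarrow> t \<in> {0..1} \<Longrightarrow> \<gamma> t \<in> points M"
  using continuous_map_image_subset_topspace[of "top_of_set {0..1}" "mtop M" \<gamma>]
  by (auto simp: pathin_def)

lemma C1_derivatives:
  assumes C1: "C1_on_interval M \<gamma> a b" and c: "c \<in> atlas M"
    and uv: "a \<le> u" "u \<le> v" "v \<le> b" "\<gamma> ` {u..v} \<subseteq> cdom c"
  shows "\<exists>D. \<forall>i\<in>{..<n}. continuous_on {u..v} (D i) \<and>
     (\<forall>t\<in>{u..v}. ((\<lambda>\<tau>. coord c (\<gamma> \<tau>) i) has_real_derivative D i t) (at t within {u..v}))"
proof (rule bchoice)
  have "\<forall>u v. a \<le> u \<and> u \<le> v \<and> v \<le> b \<and> \<gamma> ` {u..v} \<subseteq> cdom c \<longrightarrow>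
       (\<forall>i<n. \<exists>D. continuous_on {u..v} D \<and>
          (\<forall>t\<in>{u..v}. ((\<lambda>\<tau>. coord c (\<gamma> \<tau>) i) has_real_derivative D t) (at t within {u..v})))"
    using C1 c unfolding C1_on_interval_def by (rule bspec)
  then show "\<forall>i\<in>{..<n}. \<exists>D. continuous_on {u..v} D \<and>
     (\<forall>t\<in>{u..v}. ((\<lambda>\<tau>. coord c (\<gamma> \<tau>) i) has_real_derivative D t) (at t within {u..v}))"
    using uv by simp
qed

text \<open>\<open>C1_on_interval\<close> speaks of time intervals mapped into a single chart, so
  the interval is first shrunk around t; at its interior point t the derivative within it is the
  full derivative.\<close>

lemma C1_differentiable:
  assumes \<gamma>: "pathin (mtop M) \<gamma>" and C1: "C1_on_interval M \<gamma> a b" and ab: "0 \<le> a" "b \<le> 1"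
    and t: "a < t" "t < b" and c: "c \<in> atlas M" "\<gamma> t \<in> cdom c" and i: "i < n"
  shows "((\<lambda>\<tau>. coord c (\<gamma> \<tau>) i) has_real_derivative deriv (\<lambda>\<tau>. coord c (\<gamma> \<tau>) i) t) (at t)"
proof -
  obtain e where e: "e > 0" "\<forall>\<tau>\<in>{0..1}. \<bar>\<tau> - t\<bar> < e \<longrightarrow> \<gamma> \<tau> \<in> cdom c"
    using path_nbhd[OF \<gamma> _ cdom_open[OF c(1)] c(2)] t ab by auto
  define u where "u = max a (t - e / 2)"
  define v where "v = min b (t + e / 2)"
  have uv: "a \<le> u" "u < t" "t < v" "v \<le> b" using t e by (auto simp: u_def v_def)
  have "\<gamma> \<tau> \<in> cdom c" if "\<tau> \<in> {u..v}" for \<tau>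
  proof -
    have "\<bar>\<tau> - t\<bar> < e" using that e(1) by (auto simp: u_def v_def)
    moreover have "\<tau> \<in> {0..1}" using that uv ab by auto
    ultimately show ?thesis using e(2) by blast
  qed
  then have "\<gamma> ` {u..v} \<subseteq> cdom c" by blast
  with uv obtain D where D: "\<forall>i\<in>{..<n}. continuous_on {u..v} (D i) \<and>
     (\<forall>t\<in>{u..v}. ((\<lambda>\<tau>. coord c (\<gamma> \<tau>) i) has_real_derivative D i t) (at t within {u..v}))"
    using C1_derivatives[OF C1 c(1), of u v] by auto
  have "((\<lambda>\<tau>. coord c (\<gamma> \<tau>) i) has_real_derivative D i t) (at t within {u..v})"
    using D i uv by simp
  then have "((\<lambda>\<tau>. coord c (\<gamma> \<tau>) i) has_real_derivative D i t) (at t)"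
    by (simp only: at_within_Icc_at[OF uv(2,3)])
  then show ?thesis by (simp add: DERIV_imp_deriv)
qed

text \<open>Inside one chart the speed agrees with a continuous function, except perhaps at the two
  ends, where a full derivative may fail to exist.\<close>

lemma speed_integrable_chart:
  assumes \<gamma>: "pathin (mtop M) \<gamma>" and C1: "C1_on_interval M \<gamma> a b" and ab: "0 \<le> a" "b \<le> 1"
    and c: "c \<in> atlas M" and uv: "a \<le> u" "u \<le> v" "v \<le> b" "\<gamma> ` {u..v} \<subseteq> cdom c"
  shows "curve_speed M \<gamma> integrable_on {u..v}"
proof -
  obtain D where D: "\<forall>i\<in>{..<n}. continuous_on {u..v} (D i) \<and>
     (\<forall>t\<in>{u..v}. ((\<lambda>\<tau>. coord c (\<gamma> \<tau>) i) has_real_derivative D i t) (at t within {u..v}))"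
    using C1_derivatives[OF C1 c uv] by blast
  define h where "h t = sqrt (quadratic_form M c (\<gamma> t) (\<lambda>i. D i t))" for t
  have g: "continuous_on {u..v} (\<lambda>t. metric_tensor M c (\<gamma> t) i j)" if "i < n" "j < n" for i j
  proof -
    have "continuous_on {u..v} (\<lambda>t. metric_tensor M c (coord_inv c (coord c (\<gamma> t))) i j)"
      using uv ab by (intro continuous_on_curve[OF \<gamma> c _ _ continuous_metric_tensor[OF c that]]) auto
    then show ?thesis
    proof (rule continuous_on_eq)
      fix x assume "x \<in> {u..v}"
      then have "\<gamma> x \<in> cdom c" using uv by blast
      then show "metric_tensor M c (coord_inv c (coord c (\<gamma> x))) i j = metric_tensor M c (\<gamma> x) i j"
        using c by simp
    qed
  qed
  have "continuous_on {u..v} h"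
    unfolding h_def quadratic_form_def using D g
    by (intro continuous_on_real_sqrt continuous_on_sum continuous_on_mult) auto
  then have "h integrable_on {u..v}" by (rule integrable_continuous_interval)
  then show ?thesis
  proof (rule integrable_spike_finite[of "{u, v}", rotated 2])
    fix t assume t: "t \<in> {u..v} - {u, v}"
    then have t': "u < t" "t < v" by auto
    have "((\<lambda>\<tau>. coord c (\<gamma> \<tau>) i) has_real_derivative D i t) (at t)" if "i < n" for i
    proof -
      have "((\<lambda>\<tau>. coord c (\<gamma> \<tau>) i) has_real_derivative D i t) (at t within {u..v})"
        using D that t by simp
      then show ?thesis by (simp only: at_within_Icc_at[OF t'])
    qed
    then show "curve_speed M \<gamma> t = h t"
      unfolding h_def using t t' uv ab by (intro curve_speed_eq[OF \<gamma> _ c]) auto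
  qed auto
qed

text \<open>Integrability on a compact interval is a local matter, and near each time the curve
  stays in one chart.\<close>

lemma speed_integrable_piece:
  assumes \<gamma>: "pathin (mtop M) \<gamma>" and C1: "C1_on_interval M \<gamma> a b" and ab: "0 \<le> a" "b \<le> 1"
  shows "curve_speed M \<gamma> integrable_on {a..b}"
proof -
  have "curve_speed M \<gamma> integrable_on cbox a b"
  proof (rule integrable_on_little_subintervals, rule ballI)
    fix x assume x: "x \<in> cbox a b"
    then have x1: "x \<in> {0..1}" using ab by auto
    then obtain c where c: "c \<in> atlas M" "\<gamma> x \<in> cdom c" using ex_chart[OF pathin_points[OF \<gamma> x1]] by blast
    obtain e where e: "e > 0" "\<forall>\<tau>\<in>{0..1}. \<bar>\<tau> - x\<bar> < e \<longrightarrow> \<gamma> \<tau> \<in> cdom c"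
      using path_nbhd[OF \<gamma> x1 cdom_open[OF c(1)] c(2)] by blast
    show "\<exists>d>0. \<forall>u v. x \<in> cbox u v \<and> cbox u v \<subseteq> ball x d \<and> cbox u v \<subseteq> cbox a b \<longrightarrow>
        curve_speed M \<gamma> integrable_on cbox u v"
    proof (intro exI[of _ e] conjI allI impI)
      fix u v assume uv: "x \<in> cbox u v \<and> cbox u v \<subseteq> ball x e \<and> cbox u v \<subseteq> cbox a b"
      then have le: "u \<le> v" by auto
      then have "u \<in> cbox u v" "v \<in> cbox u v" by auto
      then have "u \<in> cbox a b" "v \<in> cbox a b" using uv by blast+
      then have b: "a \<le> u" "v \<le> b" by auto
      have "\<gamma> \<tau> \<in> cdom c" if "\<tau> \<in> {u..v}" for \<tau>
      proof -
        have "\<tau> \<in> cbox u v" using that by simp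
        then have "\<tau> \<in> ball x e" using uv by blast
        then have "\<bar>\<tau> - x\<bar> < e" by (simp add: dist_real_def abs_minus_commute)
        moreover have "\<tau> \<in> {0..1}" using that b ab by auto
        ultimately show ?thesis using e(2) by blast
      qed
      then have "\<gamma> ` {u..v} \<subseteq> cdom c" by blast
      then show "curve_speed M \<gamma> integrable_on cbox u v"
        using speed_integrable_chart[OF \<gamma> C1 ab c(1) b(1) le b(2)] by simp
    qed (rule e)
  qed
  then show ?thesis by simp
qed

lemma piecewise_C1_pathin: "piecewise_C1_curve M \<gamma> \<Longrightarrow> pathin (mtop M) \<gamma>"
  by (simp add: piecewise_C1_curve_def)

lemma piecewise_C1_regular:
  assumes "piecewise_C1_curve M \<gamma>"
  shows "curve_speed M \<gamma> integrable_on {0..1}"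
    and "\<exists>F. finite F \<and> (\<forall>t\<in>{0<..<1} - F. \<forall>c\<in>atlas M. \<gamma> t \<in> cdom c \<longrightarrow> (\<forall>i<n.
      ((\<lambda>\<tau>. coord c (\<gamma> \<tau>) i) has_real_derivative deriv (\<lambda>\<tau>. coord c (\<gamma> \<tau>) i) t) (at t)))"
proof -
  have \<gamma>: "pathin (mtop M) \<gamma>" by (rule piecewise_C1_pathin[OF assms])
  obtain K and \<tau> :: "nat \<Rightarrow> real" where \<tau>: "\<tau> 0 = 0" "\<tau> K = 1"
    "\<forall>k<K. \<tau> k < \<tau> (Suc k) \<and> C1_on_interval M \<gamma> (\<tau> k) (\<tau> (Suc k))"
    using assms unfolding piecewise_C1_curve_def by blast
  have mono: "\<tau> j \<le> \<tau> k" if "j \<le> k" "k \<le> K" for j k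
    using that
  proof (induction k)
    case (Suc k)
    then show ?case using \<tau>(3) by (cases "j = Suc k") (auto simp: less_eq_Suc_le intro: order_trans[of _ "\<tau> k"] less_imp_le)
  qed simp
  have bnd: "0 \<le> \<tau> k" "\<tau> k \<le> 1" if "k \<le> K" for k
    using mono[of 0 k] mono[of k K] that \<tau> by auto
  have "curve_speed M \<gamma> integrable_on {0..\<tau> k}" if "k \<le> K" for k
    using that
  proof (induction k)
    case 0
    then show ?case using \<tau>(1) integrable_on_refl[of "curve_speed M \<gamma>" 0] by simp
  next
    case (Suc k)
    have "curve_speed M \<gamma> integrable_on {\<tau> k..\<tau> (Suc k)}"
      using \<tau>(3) Suc.prems bnd by (intro speed_integrable_piece[OF \<gamma>]) auto
    then show ?case
      using Suc bnd[of k] mono[of k "Suc k"]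
      by (intro Henstock_Kurzweil_Integration.integrable_combine[of 0 "\<tau> k" "\<tau> (Suc k)"]) auto
  qed
  from this[of K] show "curve_speed M \<gamma> integrable_on {0..1}" using \<tau> by simp
  \<comment> \<open>Every positive time lies in some closed piece; away from the partition points it
    is then interior to that piece.\<close>
  have piece: "\<exists>j<k. \<tau> j \<le> t \<and> t \<le> \<tau> (Suc j)" if "0 < t" "t \<le> \<tau> k" "k \<le> K" for t k
    using that
  proof (induction k)
    case 0
    then show ?case using \<tau>(1) by simp
  next
    case (Suc k)
    show ?case
    proof (cases "t \<le> \<tau> k")
      case True
      then show ?thesis using Suc by (auto simp: less_Suc_eq)
    next
      case False
      then show ?thesis using Suc.prems by (intro exI[of _ k]) auto
    qed
  qed
  show "\<exists>F. finite F \<and> (\<forall>t\<in>{0<..<1} - F. \<forall>c\<in>atlas M. \<gamma> t \<in> cdom c \<longrightarrow> (\<forall>i<n.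
      ((\<lambda>\<tau>. coord c (\<gamma> \<tau>) i) has_real_derivative deriv (\<lambda>\<tau>. coord c (\<gamma> \<tau>) i) t) (at t)))"
  proof (intro exI[of _ "\<tau> ` {..K}"] conjI ballI impI allI)
    fix t c i assume t: "t \<in> {0<..<1} - \<tau> ` {..K}" and c: "c \<in> atlas M" "\<gamma> t \<in> cdom c" and i: "i < n"
    obtain j where j: "j < K" "\<tau> j \<le> t" "t \<le> \<tau> (Suc j)" using piece[of t K] t \<tau> by auto
    have "t \<noteq> \<tau> j" "t \<noteq> \<tau> (Suc j)" using t j(1) by auto
    then have "\<tau> j < t" "t < \<tau> (Suc j)" using j by auto
    then show "((\<lambda>\<tau>. coord c (\<gamma> \<tau>) i) has_real_derivative deriv (\<lambda>\<tau>. coord c (\<gamma> \<tau>) i) t) (at t)"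
      using \<tau>(3) j(1) bnd c i by (intro C1_differentiable[OF \<gamma>]) auto
  qed simp
qed

text \<open>At finitely many times the speed is unspecified and might be negative, so monotonicity
  of the integral is applied to the speed reset to 0 on a finite set E.\<close>

lemma has_integral_le_curve_length:
  assumes pw: "piecewise_C1_curve M \<gamma>" and S: "finite S" and T: "0 \<le> T1" "T1 \<le> T2" "T2 \<le> 1"
    and f: "(f has_integral I) {T1..T2}"
    and le: "\<And>t. t \<in> {T1..T2} - S \<Longrightarrow> f t \<le> curve_speed M \<gamma> t"
  shows "I \<le> curve_length M \<gamma>"
proof -
  have \<gamma>: "pathin (mtop M) \<gamma>" by (rule piecewise_C1_pathin[OF pw])
  from piecewise_C1_regular(2)[OF pw] obtain F where F: "finite F"
    "\<forall>t\<in>{0<..<1} - F. \<forall>c\<in>atlas M. \<gamma> t \<in> cdom c \<longrightarrow> (\<forall>i<n.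
      ((\<lambda>\<tau>. coord c (\<gamma> \<tau>) i) has_real_derivative deriv (\<lambda>\<tau>. coord c (\<gamma> \<tau>) i) t) (at t))"
    by (elim exE conjE)
  define E where "E = S \<union> F \<union> {0, 1}"
  have E: "finite E" using S F(1) by (simp add: E_def)
  define g where "g t = (if t \<in> E then 0 else curve_speed M \<gamma> t)" for t
  have g_nonneg: "0 \<le> g t" if t: "t \<in> {0..1}" for t
  proof (cases "t \<in> E")
    case False
    then have t': "t \<in> {0<..<1} - F" "t \<in> {0<..<1}" using t by (auto simp: E_def)
    obtain c where c: "c \<in> atlas M" "\<gamma> t \<in> cdom c" using ex_chart[OF pathin_points[OF \<gamma> t]] by blast
    have "curve_speed M \<gamma> t = sqrt (quadratic_form M c (\<gamma> t) (\<lambda>i. deriv (\<lambda>\<tau>. coord c (\<gamma> \<tau>) i) t))"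
      using F(2) t'(1) c by (intro curve_speed_eq[OF \<gamma> t'(2) c]) simp
    then show ?thesis using quadratic_form_nonneg[OF c] by (simp add: g_def)
  qed (simp add: g_def)
  have neg: "negligible E" by (rule negligible_finite[OF E])
  have len: "curve_length M \<gamma> = integral {0..1} g"
    unfolding curve_length_def by (rule integral_spike[OF neg]) (simp add: g_def)
  have gi: "g integrable_on {0..1}"
    by (rule integrable_spike[OF piecewise_C1_regular(1)[OF pw] neg]) (simp add: g_def)
  have gi': "g integrable_on {T1..T2}"
    by (rule integrable_subinterval_real[OF gi]) (use T in auto)
  have f': "((\<lambda>t. if t \<in> E then 0 else f t) has_integral I) {T1..T2}"
    by (rule has_integral_spike[OF neg _ f]) simp
  have "I \<le> integral {T1..T2} g"
    by (rule has_integral_le[OF f' integrable_integral[OF gi']]) (auto simp: g_def E_def intro: le)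
  also have "\<dots> \<le> integral {0..1} g"
    using T g_nonneg by (intro integral_subset_le gi gi') auto
  finally show ?thesis by (simp add: len)
qed

lemma curve_length_nonneg: "piecewise_C1_curve M \<gamma> \<Longrightarrow> 0 \<le> curve_length M \<gamma>"
  by (rule has_integral_le_curve_length[of \<gamma> "{0}" 0 0 "\<lambda>_. 0"]) auto

text \<open>Pairing the velocity with the sign vector \<sigma> of the total displacement makes the
  l1 distance the increment of one real function h, to which the fundamental theorem of calculus
  applies; at each time the pairing is at most the l1 norm of the velocity.\<close>

lemma curve_length_lower:
  assumes pw: "piecewise_C1_curve M \<gamma>" and c: "c \<in> atlas M" and T: "0 \<le> T1" "T1 \<le> T2" "T2 \<le> 1"
    and \<gamma>c: "\<And>t. t \<in> {T1..T2} \<Longrightarrow> \<gamma> t \<in> cdom c"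
    and a: "0 < a" "\<And>t v. t \<in> {T1..T2} \<Longrightarrow> a * l1_dist n (\<lambda>_. 0) v \<le> sqrt (quadratic_form M c (\<gamma> t) v)"
  shows "a * l1_dist n (coord c (\<gamma> T1)) (coord c (\<gamma> T2)) \<le> curve_length M \<gamma>"
proof -
  have \<gamma>: "pathin (mtop M) \<gamma>" by (rule piecewise_C1_pathin[OF pw])
  from piecewise_C1_regular(2)[OF pw] obtain F where F: "finite F"
    "\<forall>t\<in>{0<..<1} - F. \<forall>c\<in>atlas M. \<gamma> t \<in> cdom c \<longrightarrow> (\<forall>i<n.
      ((\<lambda>\<tau>. coord c (\<gamma> \<tau>) i) has_real_derivative deriv (\<lambda>\<tau>. coord c (\<gamma> \<tau>) i) t) (at t))"
    by (elim exE conjE)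
  define v where "v t i = deriv (\<lambda>\<tau>. coord c (\<gamma> \<tau>) i) t" for t i
  define \<sigma> where "\<sigma> i = sgn (coord c (\<gamma> T2) i - coord c (\<gamma> T1) i)" for i
  define h where "h t = (\<Sum>i<n. \<sigma> i * coord c (\<gamma> t) i)" for t
  have v: "((\<lambda>\<tau>. coord c (\<gamma> \<tau>) i) has_real_derivative v t i) (at t)"
    if "t \<in> {T1<..<T2} - F" "i < n" for t i
    unfolding v_def using F(2) that T c \<gamma>c[of t] by simp
  have "((\<lambda>t. \<Sum>i<n. \<sigma> i * v t i) has_integral (h T2 - h T1)) {T1..T2}"
  proof (rule fundamental_theorem_of_calculus_interior_strong[OF F(1) T(2)])
    show "continuous_on {T1..T2} h"
      unfolding h_def using T \<gamma>c
      by (intro continuous_on_sum continuous_on_mult continuous_on_const continuous_on_coord_curve[OF \<gamma> c]) auto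
    show "(h has_vector_derivative (\<Sum>i<n. \<sigma> i * v t i)) (at t)" if t: "t \<in> {T1<..<T2} - F" for t
      unfolding h_def has_real_derivative_iff_has_vector_derivative[symmetric]
      by (intro DERIV_sum DERIV_cmult v[OF t]) simp
  qed
  then have hi: "((\<lambda>t. a * (\<Sum>i<n. \<sigma> i * v t i)) has_integral (a * (h T2 - h T1))) {T1..T2}"
    by (rule has_integral_mult_right)
  have "a * (h T2 - h T1) \<le> curve_length M \<gamma>"
  proof (rule has_integral_le_curve_length[OF pw _ T hi])
    show "finite (F \<union> {T1, T2})" using F by simp
    fix t assume t: "t \<in> {T1..T2} - (F \<union> {T1, T2})"
    then have t': "t \<in> {T1<..<T2} - F" by auto
    have "(\<Sum>i<n. \<sigma> i * v t i) \<le> l1_dist n (\<lambda>_. 0) (v t)"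
      unfolding l1_dist_def
    proof (rule sum_mono)
      fix i
      have "\<sigma> i * v t i \<le> \<bar>\<sigma> i\<bar> * \<bar>v t i\<bar>" by (simp add: abs_mult[symmetric])
      also have "\<dots> \<le> 1 * \<bar>v t i\<bar>" by (intro mult_right_mono) (auto simp: \<sigma>_def sgn_if)
      finally show "\<sigma> i * v t i \<le> \<bar>0 - v t i\<bar>" by simp
    qed
    then have "a * (\<Sum>i<n. \<sigma> i * v t i) \<le> a * l1_dist n (\<lambda>_. 0) (v t)" using a(1) by simp
    also have "\<dots> \<le> sqrt (quadratic_form M c (\<gamma> t) (v t))" using a(2) t by simp
    also have "\<dots> = curve_speed M \<gamma> t"
      using t' T \<gamma>c by (intro curve_speed_eq[OF \<gamma> _ c, symmetric] v) auto
    finally show "a * (\<Sum>i<n. \<sigma> i * v t i) \<le> curve_speed M \<gamma> t" .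
  qed
  moreover have "h T2 - h T1 = l1_dist n (coord c (\<gamma> T1)) (coord c (\<gamma> T2))"
    unfolding h_def l1_dist_def sum_subtractf[symmetric]
    by (intro sum.cong) (auto simp: \<sigma>_def sgn_if)
  ultimately show ?thesis by simp
qed

definition segment :: "(nat \<Rightarrow> real) \<Rightarrow> (nat \<Rightarrow> real) \<Rightarrow> real \<Rightarrow> nat \<Rightarrow> real"
  where "segment u v t = (\<lambda>i\<in>{..<n}. u i + t * (v i - u i))"

lemma segment_ends: "u \<in> extensional {..<n} \<Longrightarrow> v \<in> extensional {..<n} \<Longrightarrow> segment u v 0 = u \<and> segment u v 1 = v"
  by (auto simp: segment_def extensional_def fun_eq_iff)

lemma segment_in_l1_ball:
  assumes "u \<in> l1_ball n p r" "v \<in> l1_ball n p r" "t \<in> {0..1}"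
  shows "segment u v t \<in> l1_ball n p r"
proof -
  have t: "0 \<le> t" "0 \<le> 1 - t" using assms by auto
  have "l1_dist n p (segment u v t) \<le> (\<Sum>i<n. (1 - t) * \<bar>p i - u i\<bar> + t * \<bar>p i - v i\<bar>)"
    unfolding l1_dist_def
  proof (rule sum_mono)
    fix i assume "i \<in> {..<n}"
    then have "p i - segment u v t i = (1 - t) * (p i - u i) + t * (p i - v i)"
      by (simp add: segment_def algebra_simps)
    also have "\<bar>\<dots>\<bar> \<le> \<bar>(1 - t) * (p i - u i)\<bar> + \<bar>t * (p i - v i)\<bar>" by (rule abs_triangle_ineq)
    finally show "\<bar>p i - segment u v t i\<bar> \<le> (1 - t) * \<bar>p i - u i\<bar> + t * \<bar>p i - v i\<bar>"
      using t by (simp add: abs_mult)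
  qed
  also have "\<dots> = (1 - t) * l1_dist n p u + t * l1_dist n p v"
    by (simp add: l1_dist_def sum.distrib sum_distrib_left)
  also have "\<dots> \<le> (1 - t) * r + t * r"
    using assms t by (intro add_mono mult_left_mono) (auto simp: mem_l1_ball)
  finally show ?thesis by (simp add: mem_l1_ball segment_def algebra_simps)
qed

text \<open>A coordinate segment has to be C1 in every chart that it meets, not just in c; the chain
  rule through the transition maps supplies this.\<close>

lemma segment_curve:
  assumes c: "c \<in> atlas M" and u: "u \<in> extensional {..<n}" and v: "v \<in> extensional {..<n}"
    and seg: "\<And>t. t \<in> {0..1} \<Longrightarrow> segment u v t \<in> img c"
    and b: "\<And>t w. t \<in> {0..1} \<Longrightarrow>
      sqrt (quadratic_form M c (coord_inv c (segment u v t)) w) \<le> b * l1_dist n (\<lambda>_. 0) w"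
  shows "piecewise_C1_curve M (\<lambda>t. coord_inv c (segment u v t))"
    and "curve_length M (\<lambda>t. coord_inv c (segment u v t)) \<le> b * l1_dist n u v"
proof -
  define \<gamma> where "\<gamma> = (\<lambda>t. coord_inv c (segment u v t))"
  have seg_cont: "continuous_map (top_of_set I) (real_space n) (segment u v)" for I
    unfolding real_space_def continuous_map_componentwise
    by (auto simp: segment_def intro!: continuous_intros)
  have "continuous_map (top_of_set {0..1}) (img_top c) (segment u v)"
    using seg by (intro continuous_map_into_subtopology seg_cont) auto
  from continuous_map_compose[OF this continuous_coord_inv[OF c]]
  have "continuous_map (top_of_set {0..1}) (subtopology (mtop M) (cdom c)) \<gamma>"
    by (simp add: comp_def \<gamma>_def)
  then have path: "pathin (mtop M) \<gamma>"
    unfolding pathin_def by (simp add: continuous_map_in_subtopology)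
  have \<gamma>c: "\<gamma> t \<in> cdom c" "coord c (\<gamma> t) = segment u v t" if "t \<in> {0..1}" for t
    using seg[OF that] by (auto simp: \<gamma>_def intro: coord_inv_in)
  have seg_deriv: "((\<lambda>\<tau>. segment u v \<tau> i) has_real_derivative (v i - u i)) (at t within I)" if "i < n" for i t I
    using that by (auto simp: segment_def intro!: derivative_eq_intros)
  have "C1_on_interval M \<gamma> 0 1"
    unfolding C1_on_interval_def
  proof (intro ballI allI impI)
    fix c' a z i
    assume c': "c' \<in> atlas M" and az: "0 \<le> a \<and> a \<le> z \<and> z \<le> 1 \<and> \<gamma> ` {a..z} \<subseteq> cdom c'" and i: "i < n"
    let ?V = "coord c ` (cdom c \<inter> cdom c')" and ?f = "\<lambda>u. transition c c' u i"
    let ?D = "\<lambda>t. \<Sum>j<n. partial_deriv j ?f (segment u v t) * (v j - u j)"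
    have inV: "segment u v t \<in> ?V" if "t \<in> {a..z}" for t
    proof -
      have "t \<in> {0..1}" using that az by auto
      then show ?thesis using \<gamma>c[of t] az that by (intro image_eqI[of _ _ "\<gamma> t"]) auto
    qed
    show "\<exists>D. continuous_on {a..z} D \<and>
          (\<forall>t\<in>{a..z}. ((\<lambda>\<tau>. coord c' (\<gamma> \<tau>) i) has_real_derivative D t) (at t within {a..z}))"
    proof (intro exI[of _ ?D] conjI ballI)
      show "continuous_on {a..z} ?D"
      proof (intro continuous_on_sum continuous_on_mult continuous_on_const)
        fix j assume "j \<in> {..<n}"
        then have p: "continuous_map (subtopology (real_space n) ?V) euclideanreal (partial_deriv j ?f)"
          using smooth_transition[OF c c' i] by simp
        have "continuous_map (top_of_set {a..z}) (subtopology (real_space n) ?V) (segment u v)"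
          using inV by (intro continuous_map_into_subtopology seg_cont) auto
        from continuous_map_compose[OF this p]
        show "continuous_on {a..z} (\<lambda>t. partial_deriv j ?f (segment u v t))"
          by (simp add: comp_def)
      qed
      fix t assume t: "t \<in> {a..z}"
      have "((\<lambda>\<tau>. ?f (segment u v \<tau>)) has_real_derivative ?D t) (at t within {a..z})"
        by (rule chain_rule[OF openin_overlap[OF c cdom_open[OF c']] smooth_transition[OF c c' i] t inV seg_deriv])
      then show "((\<lambda>\<tau>. coord c' (\<gamma> \<tau>) i) has_real_derivative ?D t) (at t within {a..z})"
        by (simp add: transition_def \<gamma>_def)
    qed
  qed
  \<comment> \<open>A single piece: the partition \<open>real\<close> sends 0 to 0 and 1 to
    1.\<close>
  then have pw: "piecewise_C1_curve M \<gamma>"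
    unfolding piecewise_C1_curve_def using path
    by (intro conjI exI[of _ 1] exI[of _ real]) auto
  then show "piecewise_C1_curve M (\<lambda>t. coord_inv c (segment u v t))" by (simp only: \<gamma>_def)
  define B where "B = b * l1_dist n u v"
  have speed: "curve_speed M \<gamma> t \<le> B" if t: "t \<in> {0<..<1}" for t
  proof -
    have t1: "t \<in> {0..1}" using t by auto
    have "((\<lambda>\<tau>. coord c (\<gamma> \<tau>) i) has_real_derivative (v i - u i)) (at t)" if "i < n" for i
      by (rule has_field_derivative_transform_within_open[OF seg_deriv[OF that] _ t])
        (use \<gamma>c in auto)
    then have "curve_speed M \<gamma> t = sqrt (quadratic_form M c (\<gamma> t) (\<lambda>i. v i - u i))"
      using \<gamma>c[OF t1] by (intro curve_speed_eq[OF path t c]) auto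
    also have "\<dots> \<le> b * l1_dist n (\<lambda>_. 0) (\<lambda>i. v i - u i)" using b[OF t1] by (simp add: \<gamma>_def)
    also have "l1_dist n (\<lambda>_. 0) (\<lambda>i. v i - u i) = l1_dist n u v" by (simp add: l1_dist_def)
    finally show ?thesis by (simp add: B_def)
  qed
  have neg: "negligible {0, 1 :: real}" by (simp add: negligible_finite)
  have "integral {0..1} (curve_speed M \<gamma>) = integral {0..1} (\<lambda>t. if t \<in> {0, 1} then B else curve_speed M \<gamma> t)"
    by (rule integral_spike[OF neg]) simp
  also have "\<dots> \<le> integral {0..1} (\<lambda>t :: real. B)"
  proof (rule Henstock_Kurzweil_Integration.integral_le)
    show "(\<lambda>t. if t \<in> {0, 1} then B else curve_speed M \<gamma> t) integrable_on {0..1}"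
      by (rule integrable_spike[OF piecewise_C1_regular(1)[OF pw] neg]) simp
    show "(if t \<in> {0, 1} then B else curve_speed M \<gamma> t) \<le> B"
      if "t \<in> {0..1}" for t using speed[of t] that by auto
  qed (rule integrable_const_ivl)
  finally show "curve_length M (\<lambda>t. coord_inv c (segment u v t)) \<le> b * l1_dist n u v"
    unfolding curve_length_def \<gamma>_def B_def[symmetric] by simp
qed

end

section \<open>A bounded invariant metric below the Riemannian distance\<close>

section \<open>A bounded metric locally equivalent to the Riemannian distance\<close>

context compact_riemannian
begin

lemma riemannian_dist_ge:
  assumes "\<And>\<gamma>. piecewise_C1_curve M \<gamma> \<Longrightarrow> \<gamma> 0 = x \<Longrightarrow> \<gamma> 1 = y \<Longrightarrow> r \<le> curve_length M \<gamma>"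
  shows "ennreal r \<le> riemannian_dist M x y"
  unfolding riemannian_dist_def using assms by (intro INF_greatest ennreal_leI) auto

lemma riemannian_dist_le:
  assumes "piecewise_C1_curve M \<gamma>"
  shows "riemannian_dist M (\<gamma> 0) (\<gamma> 1) \<le> ennreal (curve_length M \<gamma>)"
  unfolding riemannian_dist_def using assms by (intro INF_lower) auto

text \<open>The bound 1 keeps the supremum of these pseudometrics finite even between components,
  where the Riemannian distance is infinite.\<close>

definition sub_dists :: "('a \<Rightarrow> 'a \<Rightarrow> real) set"
  where "sub_dists = {\<rho>. (\<forall>x\<in>points M. \<forall>y\<in>points M.
     0 \<le> \<rho> x y \<and> \<rho> x y \<le> 1 \<and> \<rho> x y = \<rho> y x \<and> ennreal (\<rho> x y) \<le> riemannian_dist M x y) \<and>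
     (\<forall>x\<in>points M. \<rho> x x = 0) \<and>
     (\<forall>x\<in>points M. \<forall>y\<in>points M. \<forall>z\<in>points M. \<rho> x z \<le> \<rho> x y + \<rho> y z)}"

text \<open>Being a supremum of pseudometrics, this is a pseudometric without any appeal to the
  concatenation or reversal of curves.\<close>

definition rdist :: "'a \<Rightarrow> 'a \<Rightarrow> real"
  where "rdist x y = (if x \<in> points M \<and> y \<in> points M then SUP \<rho>\<in>sub_dists. \<rho> x y else 0)"

lemma sub_distsD:
  assumes "\<rho> \<in> sub_dists" "x \<in> points M" "y \<in> points M"
  shows "0 \<le> \<rho> x y" "\<rho> x y \<le> 1" "\<rho> x y = \<rho> y x" "ennreal (\<rho> x y) \<le> riemannian_dist M x y"
    "\<rho> x x = 0" "z \<in> points M \<Longrightarrow> \<rho> x z \<le> \<rho> x y + \<rho> y z"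
  using assms unfolding sub_dists_def by blast+

lemma zero_sub_dist: "(\<lambda>x y. 0) \<in> sub_dists"
  by (simp add: sub_dists_def)

lemma rdist_ge:
  assumes "\<rho> \<in> sub_dists" "x \<in> points M" "y \<in> points M"
  shows "\<rho> x y \<le> rdist x y"
proof -
  have "bdd_above ((\<lambda>\<rho>. \<rho> x y) ` sub_dists)"
    by (rule bdd_aboveI[of _ 1]) (use sub_distsD(2) assms(2,3) in blast)
  then have "\<rho> x y \<le> (SUP \<rho>\<in>sub_dists. \<rho> x y)" by (rule cSUP_upper[OF assms(1)])
  then show ?thesis using assms by (simp add: rdist_def)
qed

lemma rdist_le:
  assumes "\<And>\<rho>. \<rho> \<in> sub_dists \<Longrightarrow> \<rho> x y \<le> r"
  shows "rdist x y \<le> r"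
proof -
  have "(SUP \<rho>\<in>sub_dists. \<rho> x y) \<le> r" using zero_sub_dist assms by (intro cSUP_least) auto
  moreover have "0 \<le> r" using assms[OF zero_sub_dist] .
  ultimately show ?thesis by (simp add: rdist_def)
qed

lemma rdist_nonneg: "0 \<le> rdist x y"
  using rdist_ge[OF zero_sub_dist, of x y] by (simp add: rdist_def)

lemma rdist_self: "rdist x x = 0"
proof (cases "x \<in> points M")
  case True
  have "rdist x x \<le> 0" by (rule rdist_le) (simp add: sub_distsD(5)[OF _ True True])
  then show ?thesis using rdist_nonneg[of x x] by simp
qed (simp add: rdist_def)

lemma rdist_commute: "rdist x y = rdist y x"
proof (cases "x \<in> points M \<and> y \<in> points M")
  case False
  then show ?thesis by (auto simp: rdist_def)
next
  case True
  then have assms: "x \<in> points M" "y \<in> points M" by auto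
  have "rdist x y \<le> rdist y x" if "x \<in> points M" "y \<in> points M" for x y
  proof (rule rdist_le)
    fix \<rho> assume \<rho>: "\<rho> \<in> sub_dists"
    show "\<rho> x y \<le> rdist y x" using rdist_ge[OF \<rho> that(2,1)] sub_distsD(3)[OF \<rho> that] by simp
  qed
  then show ?thesis using assms by (intro antisym) auto
qed

lemma rdist_triangle:
  assumes "x \<in> points M" "y \<in> points M" "z \<in> points M"
  shows "rdist x z \<le> rdist x y + rdist y z"
proof (rule rdist_le)
  fix \<rho> assume \<rho>: "\<rho> \<in> sub_dists"
  show "\<rho> x z \<le> rdist x y + rdist y z"
    using sub_distsD(6)[OF \<rho> assms(1,2,3)] rdist_ge[OF \<rho> assms(1,2)] rdist_ge[OF \<rho> assms(2,3)] by simp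
qed

lemma rdist_le_riemannian_dist:
  assumes "x \<in> points M" "y \<in> points M"
  shows "ennreal (rdist x y) \<le> riemannian_dist M x y"
proof (cases "riemannian_dist M x y")
  case (real r)
  have "rdist x y \<le> r"
  proof (rule rdist_le)
    fix \<rho> assume "\<rho> \<in> sub_dists"
    then have "ennreal (\<rho> x y) \<le> ennreal r" using sub_distsD(4) assms real by metis
    then show "\<rho> x y \<le> r" using real by (simp add: ennreal_le_iff)
  qed
  then show ?thesis using real by (simp add: ennreal_leI)
qed simp

lemma chart_ball_open:
  assumes c: "c \<in> atlas M"
  shows "openin (mtop M) {x \<in> cdom c. l1_dist n u (coord c x) < r}"
proof -
  have "openin (img_top c) (img c \<inter> {v \<in> extensional {..<n}. l1_dist n u v < r})"
    using openin_l1_dist_less[of n u r] by (auto simp: openin_subtopology)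
  from openin_continuous_map_preimage[OF continuous_coord[OF c] this]
  have "openin (subtopology (mtop M) (cdom c)) {x \<in> cdom c. l1_dist n u (coord c x) < r}"
    by (rule back_subst[of "openin _"]) (use cdom_subset[OF c] coord_extensional[OF c] in auto)
  then show ?thesis using openin_open_subtopology[OF cdom_open[OF c]] by blast
qed

text \<open>By compactness and the Hausdorff property the image is closed in the whole manifold and
  not merely in the chart domain.\<close>

lemma coord_inv_image_closed:
  assumes c: "c \<in> atlas M" and Q: "Q \<subseteq> img c" "compactin (real_space n) Q"
  shows "closedin (mtop M) (coord_inv c ` Q)"
proof -
  have "compactin (img_top c) Q" using Q by (simp add: compactin_subtopology)
  then have "compactin (subtopology (mtop M) (cdom c)) (coord_inv c ` Q)"
    by (rule image_compactin[OF _ continuous_coord_inv[OF c]])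
  then have "compactin (mtop M) (coord_inv c ` Q)" by (simp add: compactin_subtopology)
  then show ?thesis by (rule compactin_imp_closedin[OF Hausdorff])
qed

text \<open>T is the least time at which the curve is outside B, which exists because the set of
  such times is closed. Before T the curve is in B, and at T it is still in Q because Q is
  closed.\<close>

lemma first_exit:
  assumes \<gamma>: "pathin (mtop M) \<gamma>" and B: "openin (mtop M) B" and Q: "closedin (mtop M) Q" "B \<subseteq> Q"
    and start: "\<gamma> 0 \<in> B" and t0: "t0 \<in> {0..1}" "\<gamma> t0 \<notin> B"
  shows "\<exists>T\<in>{0..1}. \<gamma> T \<notin> B \<and> \<gamma> ` {0..T} \<subseteq> Q"
proof -
  let ?S = "{t \<in> {0..1}. \<gamma> t \<in> points M - B}"
  have "closedin (top_of_set {0..1}) {t \<in> topspace (top_of_set {0..1}). \<gamma> t \<in> points M - B}"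
    using \<gamma> B unfolding pathin_def by (intro closedin_continuous_map_preimage) auto
  then have "closedin (top_of_set {0..1}) ?S" by simp
  then have cl: "closed ?S" by (rule closedin_closed_trans) simp
  have ne: "?S \<noteq> {}" using t0 pathin_points[OF \<gamma>] by blast
  have bd: "bdd_below ?S" by (rule bdd_belowI[of _ 0]) auto
  define T where "T = Inf ?S"
  have T: "T \<in> ?S" unfolding T_def by (rule closed_contains_Inf[OF ne bd cl])
  have before: "\<gamma> t \<in> B" if "t \<in> {0..1}" "t < T" for t
  proof (rule ccontr)
    assume "\<gamma> t \<notin> B"
    then have "T \<le> t" unfolding T_def using that pathin_points[OF \<gamma>] by (intro cInf_lower[OF _ bd]) auto
    then show False using that by simp
  qed
  have "T \<noteq> 0" using T start by auto
  then have T0: "0 < T" "T \<le> 1" using T by auto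
  have "\<gamma> T \<in> Q"
  proof (rule ccontr)
    assume "\<gamma> T \<notin> Q"
    then have "openin (mtop M) (points M - Q)" "\<gamma> T \<in> points M - Q" using Q T by auto
    from path_nbhd[OF \<gamma> _ this] T obtain e where
      e: "e > 0" "\<forall>\<tau>\<in>{0..1}. \<bar>\<tau> - T\<bar> < e \<longrightarrow> \<gamma> \<tau> \<in> points M - Q" by auto
    define s where "s = max 0 (T - e / 2)"
    have s: "s \<in> {0..1}" "s < T" "\<bar>s - T\<bar> < e" using T0 e(1) by (auto simp: s_def)
    then have "\<gamma> s \<in> B" using before by blast
    then show False using e(2) s Q(2) by blast
  qed
  moreover have "\<gamma> t \<in> Q" if "t \<in> {0..T}" "t \<noteq> T" for t
    using before[of t] that T0 Q(2) by auto
  ultimately have "\<gamma> ` {0..T} \<subseteq> Q" by blast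
  then show ?thesis using T by blast
qed

text \<open>The reversed curve is used as a continuous path, so its regularity never comes
  up.\<close>

lemma last_entry:
  assumes \<gamma>: "pathin (mtop M) \<gamma>" and B: "openin (mtop M) B" and Q: "closedin (mtop M) Q" "B \<subseteq> Q"
    and stop: "\<gamma> 1 \<in> B" and t0: "t0 \<in> {0..1}" "\<gamma> t0 \<notin> B"
  shows "\<exists>T\<in>{0..1}. \<gamma> T \<notin> B \<and> \<gamma> ` {T..1} \<subseteq> Q"
proof -
  have "continuous_map (top_of_set {0..1}) (top_of_set {0..1}) (\<lambda>t::real. 1 - t)"
    by (auto simp: continuous_map_in_subtopology intro!: continuous_intros)
  from continuous_map_compose[OF this \<gamma>[unfolded pathin_def]]
  have "pathin (mtop M) (\<lambda>t. \<gamma> (1 - t))" by (simp add: pathin_def comp_def)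
  from first_exit[OF this B Q, of "1 - t0"] stop t0 obtain T where
    T: "T \<in> {0..1}" "\<gamma> (1 - T) \<notin> B" "(\<lambda>t. \<gamma> (1 - t)) ` {0..T} \<subseteq> Q" by auto
  have "\<gamma> t \<in> Q" if "t \<in> {1 - T..1}" for t
  proof -
    have "(\<lambda>t. \<gamma> (1 - t)) (1 - t) \<in> (\<lambda>t. \<gamma> (1 - t)) ` {0..T}"
      using that by (intro imageI) auto
    then show ?thesis using T(3) by auto
  qed
  then show ?thesis using T by (intro bexI[of _ "1 - T"]) auto
qed

text \<open>The truncated cone function h varies by at most the length of a curve: inside the ball
  by \<open>curve_length_lower\<close>, while a curve that leaves it must climb from any end inside
  to the full height a * r. Such functions are competitors in the supremum and so bound
  \<open>rdist\<close> from below.\<close>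

lemma cone_sub_dist:
  assumes c: "c \<in> atlas M" and r: "0 < r" "l1_ball n u r \<subseteq> img c" and a: "0 < a" "a * r \<le> 1"
    and q: "\<And>w v. w \<in> l1_ball n u r \<Longrightarrow> a * l1_dist n (\<lambda>_. 0) v \<le> sqrt (quadratic_form M c (coord_inv c w) v)"
  defines "h \<equiv> \<lambda>x. if x \<in> cdom c \<and> l1_dist n u (coord c x) \<le> r then a * l1_dist n u (coord c x) else a * r"
  shows "(\<lambda>x y. \<bar>h x - h y\<bar>) \<in> sub_dists"
proof -
  have h: "0 \<le> h x" "h x \<le> a * r" for x using a r by (auto simp: h_def)
  define B where "B = {x \<in> cdom c. l1_dist n u (coord c x) < r}"
  define Q where "Q = coord_inv c ` l1_ball n u r"
  have Bo: "openin (mtop M) B" unfolding B_def by (rule chart_ball_open[OF c])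
  have Qc: "closedin (mtop M) Q"
    unfolding Q_def by (rule coord_inv_image_closed[OF c r(2) compactin_l1_ball])
  have Q: "x \<in> Q \<longleftrightarrow> x \<in> cdom c \<and> coord c x \<in> l1_ball n u r" for x
  proof
    assume "x \<in> Q"
    then obtain w where "w \<in> l1_ball n u r" "x = coord_inv c w" by (auto simp: Q_def)
    moreover have "w \<in> img c" using r(2) calculation by blast
    ultimately show "x \<in> cdom c \<and> coord c x \<in> l1_ball n u r" by (simp add: coord_inv_in)
  next
    assume "x \<in> cdom c \<and> coord c x \<in> l1_ball n u r"
    then show "x \<in> Q" unfolding Q_def using c by (intro image_eqI[of _ _ "coord c x"]) auto
  qed
  have BQ: "B \<subseteq> Q" using Q coord_extensional[OF c] by (auto simp: B_def mem_l1_ball)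
  have hQ: "h x = a * l1_dist n u (coord c x)" if "x \<in> Q" for x
    using that unfolding Q by (simp add: h_def mem_l1_ball)
  have hB: "h x = a * r" if "x \<notin> B" for x using that by (auto simp: h_def B_def)
  have "\<bar>h x - h y\<bar> \<le> curve_length M \<gamma>" if pw: "piecewise_C1_curve M \<gamma>" and xy: "\<gamma> 0 = x" "\<gamma> 1 = y" for \<gamma> x y
  proof -
    have \<gamma>: "pathin (mtop M) \<gamma>" by (rule piecewise_C1_pathin[OF pw])
    have inQ: "\<bar>h (\<gamma> T1) - h (\<gamma> T2)\<bar> \<le> curve_length M \<gamma>"
      if T: "0 \<le> T1" "T1 \<le> T2" "T2 \<le> 1" "\<gamma> ` {T1..T2} \<subseteq> Q" for T1 T2
    proof -
      have \<gamma>Q: "\<gamma> t \<in> Q" if "t \<in> {T1..T2}" for t using T that by blast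
      have "a * l1_dist n (coord c (\<gamma> T1)) (coord c (\<gamma> T2)) \<le> curve_length M \<gamma>"
      proof (rule curve_length_lower[OF pw c T(1-3) _ a(1)])
        fix t v assume "t \<in> {T1..T2}"
        then have t: "\<gamma> t \<in> cdom c" "coord c (\<gamma> t) \<in> l1_ball n u r" using \<gamma>Q unfolding Q by auto
        then show "\<gamma> t \<in> cdom c" by simp
        show "a * l1_dist n (\<lambda>_. 0) v \<le> sqrt (quadratic_form M c (\<gamma> t) v)"
          using q[OF t(2)] t(1) c by simp
      qed
      moreover have "\<bar>l1_dist n u (coord c (\<gamma> T1)) - l1_dist n u (coord c (\<gamma> T2))\<bar>
          \<le> l1_dist n (coord c (\<gamma> T1)) (coord c (\<gamma> T2))"
        using l1_dist_triangle[of n u "coord c (\<gamma> T1)" "coord c (\<gamma> T2)"]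
          l1_dist_triangle[of n u "coord c (\<gamma> T2)" "coord c (\<gamma> T1)"]
          l1_dist_commute[of n "coord c (\<gamma> T1)" "coord c (\<gamma> T2)"] by linarith
      then have "a * \<bar>l1_dist n u (coord c (\<gamma> T1)) - l1_dist n u (coord c (\<gamma> T2))\<bar>
          \<le> a * l1_dist n (coord c (\<gamma> T1)) (coord c (\<gamma> T2))" using a by simp
      moreover have "\<bar>h (\<gamma> T1) - h (\<gamma> T2)\<bar>
          = a * \<bar>l1_dist n u (coord c (\<gamma> T1)) - l1_dist n u (coord c (\<gamma> T2))\<bar>"
        using \<gamma>Q T a by (simp add: hQ right_diff_distrib[symmetric] abs_mult)
      ultimately show ?thesis by linarith
    qed
    show ?thesis
    proof (cases "\<gamma> ` {0..1} \<subseteq> B")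
      case True
      then show ?thesis using inQ[of 0 1] BQ xy by auto
    next
      case False
      then obtain t0 where t0: "t0 \<in> {0..1}" "\<gamma> t0 \<notin> B" by blast
      have "a * r - h x \<le> curve_length M \<gamma>"
      proof (cases "x \<in> B")
        case True
        then obtain T where T: "T \<in> {0..1}" "\<gamma> T \<notin> B" "\<gamma> ` {0..T} \<subseteq> Q"
          using first_exit[OF \<gamma> Bo Qc BQ _ t0] xy by blast
        then show ?thesis using inQ[of 0 T] hB[OF T(2)] xy by auto
      qed (use hB curve_length_nonneg[OF pw] in simp)
      moreover have "a * r - h y \<le> curve_length M \<gamma>"
      proof (cases "y \<in> B")
        case True
        then obtain T where T: "T \<in> {0..1}" "\<gamma> T \<notin> B" "\<gamma> ` {T..1} \<subseteq> Q"
          using last_entry[OF \<gamma> Bo Qc BQ _ t0] xy by blast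
        then show ?thesis using inQ[of T 1] hB[OF T(2)] xy by auto
      qed (use hB curve_length_nonneg[OF pw] in simp)
      \<comment> \<open>As h is at most a * r, the difference of its values is at most the larger of
        the two deficits.\<close>
      ultimately show ?thesis using h[of x] h[of y] by linarith
    qed
  qed
  then have "ennreal \<bar>h x - h y\<bar> \<le> riemannian_dist M x y" for x y
    by (intro riemannian_dist_ge)
  moreover have "\<bar>h x - h y\<bar> \<le> 1" for x y using h[of x] h[of y] a by linarith
  ultimately show ?thesis
    unfolding sub_dists_def by (auto simp: abs_minus_commute)
qed

text \<open>The coordinate segment stays in the convex l1 ball and serves as a test curve.\<close>

lemma rdist_chart_upper:
  assumes c: "c \<in> atlas M" and r: "l1_ball n p r \<subseteq> img c"
    and q: "\<And>w v. w \<in> l1_ball n p r \<Longrightarrow> sqrt (quadratic_form M c (coord_inv c w) v) \<le> b * l1_dist n (\<lambda>_. 0) v"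
    and u: "u \<in> l1_ball n p r" and v: "v \<in> l1_ball n p r"
  shows "rdist (coord_inv c u) (coord_inv c v) \<le> b * l1_dist n u v"
proof -
  have ext: "u \<in> extensional {..<n}" "v \<in> extensional {..<n}" using u v by (auto simp: mem_l1_ball)
  have seg: "segment u v t \<in> l1_ball n p r" if "t \<in> {0..1}" for t
    by (rule segment_in_l1_ball[OF u v that])
  let ?\<gamma> = "\<lambda>t. coord_inv c (segment u v t)"
  have pw: "piecewise_C1_curve M ?\<gamma>" and len: "curve_length M ?\<gamma> \<le> b * l1_dist n u v"
    by (rule segment_curve[OF c ext subsetD[OF r seg] q[OF seg]], assumption+)+
  have in_X: "coord_inv c u \<in> points M" "coord_inv c v \<in> points M"
    using coord_inv_point[OF c subsetD[OF r u]] coord_inv_point[OF c subsetD[OF r v]] .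
  have "ennreal (rdist (coord_inv c u) (coord_inv c v)) \<le> riemannian_dist M (?\<gamma> 0) (?\<gamma> 1)"
    using rdist_le_riemannian_dist[OF in_X] segment_ends[OF ext] by simp
  also have "\<dots> \<le> ennreal (curve_length M ?\<gamma>)" by (rule riemannian_dist_le[OF pw])
  finally have "rdist (coord_inv c u) (coord_inv c v) \<le> curve_length M ?\<gamma>"
    using curve_length_nonneg[OF pw] by (simp add: ennreal_le_iff)
  then show ?thesis using len by linarith
qed

end

section \<open>Positivity of the Riemannian volume density\<close>

section \<open>Determinants of positive definite matrices\<close>

lemma det_upto_eq_det: "det_upto n a = det (Matrix.mat n n (\<lambda>(i, j). a i j))"
  by (simp add: det_upto_def Determinant.det_def atLeast0LessThan)

text \<open>A nonzero kernel vector would make the quadratic form vanish.\<close>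

lemma det_upto_nonzero:
  assumes "\<And>v. \<exists>i<n. v i \<noteq> 0 \<Longrightarrow> 0 < (\<Sum>i<n. \<Sum>j<n. a i j * v i * v j)"
  shows "det_upto n a \<noteq> 0"
proof
  let ?A = "Matrix.mat n n (\<lambda>(i, j). a i j)"
  assume "det_upto n a = 0"
  then have "Determinant.det ?A = 0" by (simp add: det_upto_eq_det)
  then obtain v where v: "v \<in> carrier_vec n" "v \<noteq> 0\<^sub>v n" "?A *\<^sub>v v = 0\<^sub>v n"
    using det_0_iff_vec_prod_zero_field[of ?A n] by auto
  have Av: "(\<Sum>j<n. a i j * Matrix.vec_index v j) = 0" if "i < n" for i
  proof -
    have "Matrix.vec_index (?A *\<^sub>v v) i = 0" using v(3) that by simp
    then show ?thesis using that v(1) by (simp add: scalar_prod_def atLeast0LessThan)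
  qed
  have "\<exists>i<n. Matrix.vec_index v i \<noteq> 0"
  proof (rule ccontr)
    assume "\<not> ?thesis"
    then have "v = 0\<^sub>v n" using v(1) by (intro eq_vecI) auto
    then show False using v(2) by simp
  qed
  from assms[OF this] have "0 < (\<Sum>i<n. Matrix.vec_index v i * (\<Sum>j<n. a i j * Matrix.vec_index v j))"
    by (simp add: sum_distrib_left mult_ac)
  also have "\<dots> = 0" using Av by simp
  finally show False by simp
qed

text \<open>The determinant does not vanish along the segment of positive definite matrices from the identity.\<close>

lemma det_upto_pos:
  assumes pos: "\<And>v. \<exists>i<n. v i \<noteq> 0 \<Longrightarrow> 0 < (\<Sum>i<n. \<Sum>j<n. a i j * v i * v j)"
  shows "0 < det_upto n a"
proof (rule ccontr)
  define b where "b t i j = (1 - t) * (if i = j then 1 else 0) + t * a i j" for t :: real and i j :: nat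
  assume "\<not> 0 < det_upto n a"
  moreover have "b 1 = a" by (simp add: b_def fun_eq_iff)
  moreover have "det_upto n (b 0) = 1"
  proof -
    have "Matrix.mat n n (\<lambda>(i, j). b 0 i j) = 1\<^sub>m n" by (intro eq_matI) (auto simp: b_def)
    then show ?thesis by (simp add: det_upto_eq_det)
  qed
  moreover have "continuous_on {0..1} (\<lambda>t. det_upto n (b t))"
    unfolding det_upto_def b_def by (intro continuous_intros)
  ultimately have "\<exists>t. 0 \<le> t \<and> t \<le> 1 \<and> det_upto n (b t) = 0"
    by (intro IVT2') auto
  then obtain t where t: "0 \<le> t" "t \<le> 1" "det_upto n (b t) = 0" by blast
  have "0 < (\<Sum>i<n. \<Sum>j<n. b t i j * v i * v j)" if v: "\<exists>i<n. v i \<noteq> 0" for v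
  proof -
    have "(\<Sum>i<n. \<Sum>j<n. (if i = j then 1 else 0) * v i * v j) = (\<Sum>i<n. (v i)\<^sup>2)"
    proof (rule sum.cong[OF refl])
      fix i assume i: "i \<in> {..<n}"
      have "(\<Sum>j<n. (if i = j then 1 else 0) * v i * v j) = (\<Sum>j<n. if i = j then v i * v j else 0)"
        by (intro sum.cong) auto
      then show "(\<Sum>j<n. (if i = j then 1 else 0) * v i * v j) = (v i)\<^sup>2"
        using i by (simp add: power2_eq_square)
    qed
    moreover have "(\<Sum>i<n. \<Sum>j<n. b t i j * v i * v j)
        = (1 - t) * (\<Sum>i<n. \<Sum>j<n. (if i = j then 1 else 0) * v i * v j)
          + t * (\<Sum>i<n. \<Sum>j<n. a i j * v i * v j)"
      unfolding sum_distrib_left sum.distrib[symmetric] by (simp add: b_def algebra_simps)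
    ultimately have "(\<Sum>i<n. \<Sum>j<n. b t i j * v i * v j)
        = (1 - t) * (\<Sum>i<n. (v i)\<^sup>2) + t * (\<Sum>i<n. \<Sum>j<n. a i j * v i * v j)" by simp
    moreover obtain k where "k < n" "v k \<noteq> 0" using v by blast
    then have "0 < (\<Sum>i<n. (v i)\<^sup>2)" by (intro sum_pos2[of _ k]) auto
    then have "0 < (1 - t) * (\<Sum>i<n. (v i)\<^sup>2) + t * (\<Sum>i<n. \<Sum>j<n. a i j * v i * v j)"
      using pos[OF v] t(1,2)
      by (cases "t = 0") (auto intro: add_nonneg_pos)
    ultimately show ?thesis by simp
  qed
  then show False using det_upto_nonzero t(3) by blast
qed

section \<open>Charts with constants uniform over the manifold\<close>

section \<open>Uniform bi-Lipschitz charts\<close>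

context compact_riemannian
begin

abbreviation gdet :: "'a chart \<Rightarrow> (nat \<Rightarrow> real) \<Rightarrow> real"
  where "gdet c u \<equiv> det_upto n (metric_tensor M c (coord_inv c u))"

lemma gdet_pos: "c \<in> atlas M \<Longrightarrow> u \<in> img c \<Longrightarrow> 0 < gdet c u"
  using quadratic_form_pos[OF _ coord_inv_in] unfolding quadratic_form_def
  by (intro det_upto_pos) blast

lemma continuous_gdet:
  assumes "c \<in> atlas M"
  shows "continuous_map (img_top c) euclideanreal (gdet c)"
  unfolding det_upto_def
  by (intro continuous_map_sum continuous_map_real_mult continuous_map_prod continuous_metric_tensor assms)
    (auto simp: permutes_in_image finite_permutations dest: permutes_in_image)

lemma gdet_bounds:
  assumes c: "c \<in> atlas M" and Q: "Q \<subseteq> img c" "compactin (real_space n) Q" "Q \<noteq> {}"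
  shows "\<exists>a b. 0 < a \<and> 0 < b \<and> (\<forall>u\<in>Q. a \<le> sqrt (gdet c u) \<and> sqrt (gdet c u) \<le> b)"
proof -
  have "compactin (img_top c) Q" using Q by (simp add: compactin_subtopology)
  then have "compactin euclideanreal (gdet c ` Q)" by (rule image_compactin[OF _ continuous_gdet[OF c]])
  then have comp: "compact (gdet c ` Q)" by simp
  have ne: "gdet c ` Q \<noteq> {}" using Q(3) by blast
  obtain x where x: "x \<in> Q" "\<forall>y\<in>gdet c ` Q. gdet c x \<le> y" using compact_attains_inf[OF comp ne] by blast
  obtain z where z: "z \<in> Q" "\<forall>y\<in>gdet c ` Q. y \<le> gdet c z" using compact_attains_sup[OF comp ne] by blast
  have "0 < sqrt (gdet c x)" "0 < sqrt (gdet c z)"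
    using gdet_pos[OF c subsetD[OF Q(1) x(1)]] gdet_pos[OF c subsetD[OF Q(1) z(1)]] by simp_all
  moreover have "\<forall>u\<in>Q. sqrt (gdet c x) \<le> sqrt (gdet c u) \<and> sqrt (gdet c u) \<le> sqrt (gdet c z)"
    using x z by simp
  ultimately show ?thesis by blast
qed

text \<open>One constant controls the coordinate radius, the bi-Lipschitz bounds, the metric ball
  inside the chart and the volume density, so that finitely many local constants merge into their
  maximum.\<close>

definition tame_chart :: "real \<Rightarrow> 'a \<Rightarrow> 'a chart \<Rightarrow> bool"
  where "tame_chart K x c \<longleftrightarrow> c \<in> atlas M \<and> x \<in> cdom c \<and> l1_ball n (coord c x) (1 / K) \<subseteq> img c \<and>
    (\<forall>u\<in>l1_ball n (coord c x) (1 / K). \<forall>v\<in>l1_ball n (coord c x) (1 / K).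
       rdist (coord_inv c u) (coord_inv c v) \<le> K * l1_dist n u v \<and>
       l1_dist n u v \<le> K * rdist (coord_inv c u) (coord_inv c v)) \<and>
    (\<forall>y\<in>points M. rdist x y < 1 / K\<^sup>2 \<longrightarrow> y \<in> cdom c \<and> coord c y \<in> l1_ball n (coord c x) (1 / K)) \<and>
    (\<forall>u\<in>l1_ball n (coord c x) (1 / K). 1 / K \<le> sqrt (gdet c u) \<and> sqrt (gdet c u) \<le> K)"

lemma tame_chartD:
  assumes "tame_chart K x c"
  shows "c \<in> atlas M" "x \<in> cdom c" "l1_ball n (coord c x) (1 / K) \<subseteq> img c"
    "u \<in> l1_ball n (coord c x) (1 / K) \<Longrightarrow> v \<in> l1_ball n (coord c x) (1 / K) \<Longrightarrow>
       rdist (coord_inv c u) (coord_inv c v) \<le> K * l1_dist n u v"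
    "u \<in> l1_ball n (coord c x) (1 / K) \<Longrightarrow> v \<in> l1_ball n (coord c x) (1 / K) \<Longrightarrow>
       l1_dist n u v \<le> K * rdist (coord_inv c u) (coord_inv c v)"
    "y \<in> points M \<Longrightarrow> rdist x y < 1 / K\<^sup>2 \<Longrightarrow> y \<in> cdom c \<and> coord c y \<in> l1_ball n (coord c x) (1 / K)"
    "u \<in> l1_ball n (coord c x) (1 / K) \<Longrightarrow> 1 / K \<le> sqrt (gdet c u) \<and> sqrt (gdet c u) \<le> K"
  using assms unfolding tame_chart_def by blast+

lemma center_in_l1_ball: "c \<in> atlas M \<Longrightarrow> x \<in> cdom c \<Longrightarrow> 0 \<le> r \<Longrightarrow> coord c x \<in> l1_ball n (coord c x) r"
  using coord_extensional by (simp add: mem_l1_ball)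

text \<open>The delicate clause is the one on metric balls, where the metric radius and the
  coordinate radius shrink together: K / K'^2 is at most 1 / K'.\<close>

lemma tame_chart_mono:
  assumes tame: "tame_chart K x c" and K: "1 \<le> K" "K \<le> K'"
  shows "tame_chart K' x c"
proof -
  note D = tame_chartD[OF tame]
  have le: "1 / K' \<le> 1 / K" using K by (intro divide_left_mono) auto
  then have sub: "l1_ball n (coord c x) (1 / K') \<subseteq> l1_ball n (coord c x) (1 / K)" by (rule l1_ball_mono)
  have x: "x \<in> points M" using D(1,2) cdom_subset by blast
  show ?thesis
    unfolding tame_chart_def
  proof (intro conjI ballI impI)
    fix u v assume uv: "u \<in> l1_ball n (coord c x) (1 / K')" "v \<in> l1_ball n (coord c x) (1 / K')"
    then have uv': "u \<in> l1_ball n (coord c x) (1 / K)" "v \<in> l1_ball n (coord c x) (1 / K)" using sub by auto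
    have in_X: "coord_inv c u \<in> points M" "coord_inv c v \<in> points M"
      using coord_inv_point[OF D(1) subsetD[OF D(3) uv'(1)]] coord_inv_point[OF D(1) subsetD[OF D(3) uv'(2)]] .
    have "K * l1_dist n u v \<le> K' * l1_dist n u v" using K by (intro mult_right_mono) auto
    then show "rdist (coord_inv c u) (coord_inv c v) \<le> K' * l1_dist n u v" using D(4)[OF uv'] by linarith
    have "K * rdist (coord_inv c u) (coord_inv c v) \<le> K' * rdist (coord_inv c u) (coord_inv c v)"
      using K rdist_nonneg by (intro mult_right_mono) auto
    then show "l1_dist n u v \<le> K' * rdist (coord_inv c u) (coord_inv c v)" using D(5)[OF uv'] by linarith
  next
    fix y assume y: "y \<in> points M" "rdist x y < 1 / K'\<^sup>2"
    have "1 / K'\<^sup>2 \<le> 1 / K\<^sup>2" using K by (intro divide_left_mono power_mono) auto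
    then have y': "y \<in> cdom c" "coord c y \<in> l1_ball n (coord c x) (1 / K)" using D(6)[OF y(1)] y(2) by auto
    then show "y \<in> cdom c" by simp
    have "l1_dist n (coord c x) (coord c y) \<le> K * rdist x y"
      using D(5)[OF center_in_l1_ball[OF D(1,2)] y'(2)] D(1,2) y'(1) K by simp
    also have "\<dots> \<le> K' * (1 / K'\<^sup>2)"
      using K y(2) rdist_nonneg by (intro mult_mono) auto
    also have "\<dots> = 1 / K'" using K by (simp add: power2_eq_square)
    finally show "coord c y \<in> l1_ball n (coord c x) (1 / K')" using y'(2) by (simp add: mem_l1_ball)
  next
    fix u assume "u \<in> l1_ball n (coord c x) (1 / K')"
    then have "1 / K \<le> sqrt (gdet c u) \<and> sqrt (gdet c u) \<le> K" using D(7) sub by blast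
    then show "1 / K' \<le> sqrt (gdet c u)" "sqrt (gdet c u) \<le> K'" using le K by auto
  qed (use D sub in auto)
qed

text \<open>Lower bounds for \<open>rdist\<close> come from cones centred at every point of the
  coordinate ball about x. A cone takes its maximum outside the chart, so it also shows that points
  at small distance from x lie in the chart.\<close>

lemma locally_tame:
  assumes p: "p \<in> points M"
  shows "\<exists>U K. openin (mtop M) U \<and> p \<in> U \<and> 1 \<le> K \<and> (\<forall>x\<in>U. \<exists>c. tame_chart K x c)"
proof -
  obtain c where c: "c \<in> atlas M" "p \<in> cdom c" using ex_chart[OF p] by blast
  obtain R where R: "R > 0" "l1_ball n (coord c p) R \<subseteq> img c"
    using openin_contains_l1_ball[OF img_open[OF c(1)], of "coord c p"] c by blast
  \<comment> \<open>A quarter, because centres x lie within r of p, coordinates u within r of x, and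
    cones of radius 2 * r about u must stay in the ball of radius R.\<close>
  define r where "r = R / 4"
  have r: "0 < r" by (simp add: r_def R)
  obtain a b where ab: "0 < a" "0 < b"
    "\<forall>u\<in>l1_ball n (coord c p) R. \<forall>v. a * l1_dist n (\<lambda>_. 0) v \<le> sqrt (quadratic_form M c (coord_inv c u) v) \<and>
      sqrt (quadratic_form M c (coord_inv c u) v) \<le> b * l1_dist n (\<lambda>_. 0) v"
    using quadratic_form_bounds[OF c(1) R(2) compactin_l1_ball] by blast
  have "l1_ball n (coord c p) R \<noteq> {}" using center_in_l1_ball[OF c less_imp_le[OF R(1)]] by blast
  then obtain m m' where m: "0 < m" "0 < m'"
    "\<forall>u\<in>l1_ball n (coord c p) R. m \<le> sqrt (gdet c u) \<and> sqrt (gdet c u) \<le> m'"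
    using gdet_bounds[OF c(1) R(2) compactin_l1_ball] by blast
  \<comment> \<open>Capping the slope keeps a cone of radius 2 * r below the bound 1 of
    \<open>sub_dists\<close>.\<close>
  define a' where "a' = min a (1 / (2 * r))"
  have a': "0 < a'" "a' \<le> a" "a' * (2 * r) \<le> 1" using ab r by (auto simp: a'_def field_simps min_def)
  define K where "K = Max {1, 1 / r, b, 1 / a', 1 / m, m'}"
  have K: "1 \<le> K" "1 / r \<le> K" "b \<le> K" "1 / a' \<le> K" "1 / m \<le> K" "m' \<le> K"
    unfolding K_def by (auto intro!: Max_ge)
  have K': "1 / K \<le> r" "1 \<le> a' * K" "1 / K \<le> m" using K a' m r by (auto simp: field_simps)
  define U where "U = {x \<in> cdom c. l1_dist n (coord c p) (coord c x) < r}"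
  have "tame_chart K x c" if x: "x \<in> U" for x
  proof -
    have xc: "x \<in> cdom c" "l1_dist n (coord c p) (coord c x) < r" using x by (auto simp: U_def)
    have shift: "l1_ball n w s \<subseteq> l1_ball n (coord c p) R" if "l1_dist n (coord c p) w \<le> 2 * r" "s \<le> 2 * r" for w s
    proof
      fix z assume "z \<in> l1_ball n w s"
      then show "z \<in> l1_ball n (coord c p) R"
        using that l1_dist_triangle[of n "coord c p" z w] by (simp add: mem_l1_ball r_def)
    qed
    have ball_x: "l1_dist n (coord c p) u \<le> 2 * r" if "u \<in> l1_ball n (coord c x) (1 / K)" for u
      using that xc(2) K'(1) l1_dist_triangle[of n "coord c p" u "coord c x"] by (simp add: mem_l1_ball)
    have sub: "l1_ball n (coord c x) (1 / K) \<subseteq> l1_ball n (coord c p) R"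
      using shift[of "coord c x" "1 / K"] xc(2) K'(1) r by simp
    have cone: "min (a' * l1_dist n u (coord c y)) (a' * (2 * r)) \<le> rdist (coord_inv c u) y \<and>
        (y \<notin> cdom c \<longrightarrow> a' * (2 * r) \<le> rdist (coord_inv c u) y)"
      if u: "u \<in> img c" "l1_dist n (coord c p) u \<le> 2 * r" and y: "y \<in> points M" for u y
    proof -
      define h where "h = (\<lambda>x. if x \<in> cdom c \<and> l1_dist n u (coord c x) \<le> 2 * r
        then a' * l1_dist n u (coord c x) else a' * (2 * r))"
      have sh: "l1_ball n u (2 * r) \<subseteq> l1_ball n (coord c p) R" using shift[OF u(2)] by simp
      have "(\<lambda>x y. \<bar>h x - h y\<bar>) \<in> sub_dists"
        unfolding h_def
      proof (rule cone_sub_dist[OF c(1) _ _ a'(1,3)])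
        show "l1_ball n u (2 * r) \<subseteq> img c" using sh R by blast
        fix w v assume "w \<in> l1_ball n u (2 * r)"
        then have "w \<in> l1_ball n (coord c p) R" by (rule subsetD[OF sh])
        then have "a * l1_dist n (\<lambda>_. 0) v \<le> sqrt (quadratic_form M c (coord_inv c w) v)"
          using ab(3) by simp
        moreover have "a' * l1_dist n (\<lambda>_. 0) v \<le> a * l1_dist n (\<lambda>_. 0) v"
          using a' by (intro mult_right_mono) auto
        ultimately show "a' * l1_dist n (\<lambda>_. 0) v \<le> sqrt (quadratic_form M c (coord_inv c w) v)" by linarith
      qed (use r in simp)
      from rdist_ge[OF this _ y, of "coord_inv c u"]
      have "\<bar>h (coord_inv c u) - h y\<bar> \<le> rdist (coord_inv c u) y"
        using coord_inv_point[OF c(1) u(1)] by blast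
      moreover have "h (coord_inv c u) = 0" using coord_inv_in[OF u(1)] u(1) r by (simp add: h_def)
      moreover have "0 \<le> h y" using a' r by (simp add: h_def)
      ultimately have "h y \<le> rdist (coord_inv c u) y" by linarith
      then show ?thesis by (auto simp: h_def split: if_splits)
    qed
    show ?thesis
      unfolding tame_chart_def
    proof (intro conjI ballI impI)
      show "l1_ball n (coord c x) (1 / K) \<subseteq> img c" using sub R by blast
    next
      fix u v assume uv: "u \<in> l1_ball n (coord c x) (1 / K)" "v \<in> l1_ball n (coord c x) (1 / K)"
      then have img: "u \<in> img c" "v \<in> img c" using sub R by blast+
      have "rdist (coord_inv c u) (coord_inv c v) \<le> b * l1_dist n u v"
        using ab(3) uv sub by (intro rdist_chart_upper[OF c(1) R(2)]) auto
      also have "\<dots> \<le> K * l1_dist n u v" using K by (intro mult_right_mono) auto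
      finally show "rdist (coord_inv c u) (coord_inv c v) \<le> K * l1_dist n u v" .
      have "l1_dist n u v \<le> 2 * r"
        using uv K'(1) l1_dist_triangle[of n u v "coord c x"] l1_dist_commute[of n u "coord c x"]
        by (simp add: mem_l1_ball)
      then have "a' * l1_dist n u v \<le> a' * (2 * r)" using a' by (intro mult_left_mono) auto
      moreover have "coord_inv c v \<in> points M" by (rule coord_inv_point[OF c(1) img(2)])
      ultimately have low: "a' * l1_dist n u v \<le> rdist (coord_inv c u) (coord_inv c v)"
        using cone[OF img(1) ball_x[OF uv(1)], of "coord_inv c v"] img(2) by simp
      have "1 * l1_dist n u v \<le> (a' * K) * l1_dist n u v" by (intro mult_right_mono K') simp
      also have "\<dots> = K * (a' * l1_dist n u v)" by simp
      also have "\<dots> \<le> K * rdist (coord_inv c u) (coord_inv c v)"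
        using low K by (intro mult_left_mono) auto
      finally show "l1_dist n u v \<le> K * rdist (coord_inv c u) (coord_inv c v)" by simp
    next
      fix y assume y: "y \<in> points M" "rdist x y < 1 / K\<^sup>2"
      have "1 / K\<^sup>2 \<le> a' * (1 / K)" using K' K by (simp add: power2_eq_square field_simps)
      then have lt: "rdist x y < a' * (1 / K)" using y by linarith
      have "a' * (1 / K) \<le> a' * (2 * r)" using a' K' r by (intro mult_left_mono) auto
      then have lt2: "rdist x y < a' * (2 * r)" using lt by linarith
      have cx: "coord c x \<in> img c" "l1_dist n (coord c p) (coord c x) \<le> 2 * r" using xc r by auto
      have "coord_inv c (coord c x) = x" using c xc by simp
      note co = cone[OF cx y(1), unfolded this]
      then show "y \<in> cdom c" using lt2 not_le by blast
      have "a' * l1_dist n (coord c x) (coord c y) < a' * (1 / K)"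
        using co lt lt2 unfolding min_le_iff_disj by linarith
      from mult_left_less_imp_less[OF this less_imp_le[OF a'(1)]]
      have "l1_dist n (coord c x) (coord c y) \<le> 1 / K" by simp
      then show "coord c y \<in> l1_ball n (coord c x) (1 / K)"
        using coord_extensional[OF c(1) \<open>y \<in> cdom c\<close>] by (simp add: mem_l1_ball)
    next
      fix u assume "u \<in> l1_ball n (coord c x) (1 / K)"
      then have "u \<in> l1_ball n (coord c p) R" by (rule subsetD[OF sub])
      then have "m \<le> sqrt (gdet c u) \<and> sqrt (gdet c u) \<le> m'" by (rule bspec[OF m(3)])
      then show "1 / K \<le> sqrt (gdet c u)" "sqrt (gdet c u) \<le> K" using K K' by auto
    qed (use c xc in auto)
  qed
  moreover have "openin (mtop M) U" unfolding U_def by (rule chart_ball_open[OF c(1)])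
  moreover have "p \<in> U" using c r by (simp add: U_def)
  ultimately show ?thesis using K(1) by blast
qed

lemma finite_open_cover:
  assumes "\<And>p. p \<in> points M \<Longrightarrow> \<exists>U. openin (mtop M) U \<and> p \<in> U \<and> P U"
  shows "\<exists>F. finite F \<and> (\<forall>U\<in>F. openin (mtop M) U \<and> P U) \<and> points M \<subseteq> \<Union>F"
proof -
  have "points M \<subseteq> \<Union>{U. openin (mtop M) U \<and> P U}"
  proof
    fix p assume "p \<in> points M"
    from assms[OF this] show "p \<in> \<Union>{U. openin (mtop M) U \<and> P U}" by auto
  qed
  from compactinD[OF compact_points[unfolded compact_space_def] _ this] obtain F where
    F: "finite F" "F \<subseteq> {U. openin (mtop M) U \<and> P U}" "points M \<subseteq> \<Union>F" by auto
  then show ?thesis by (intro exI[of _ F]) auto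
qed

lemma uniformly_tame: "\<exists>K\<ge>1. \<forall>x\<in>points M. \<exists>c. tame_chart K x c"
proof -
  have "\<exists>F. finite F \<and> (\<forall>U\<in>F. openin (mtop M) U \<and> (\<exists>K\<ge>1. \<forall>x\<in>U. \<exists>c. tame_chart K x c)) \<and> points M \<subseteq> \<Union>F"
    by (rule finite_open_cover) (use locally_tame in blast)
  then obtain F where F: "finite F" "\<forall>U\<in>F. \<exists>K. 1 \<le> K \<and> (\<forall>x\<in>U. \<exists>c. tame_chart K x c)" "points M \<subseteq> \<Union>F"
    by blast
  from bchoice[OF F(2)] obtain k where k: "\<forall>U\<in>F. 1 \<le> k U \<and> (\<forall>x\<in>U. \<exists>c. tame_chart (k U) x c)" ..
  define K where "K = Max (insert 1 (k ` F))"
  have "1 \<le> K" unfolding K_def using F(1) by (intro Max_ge) auto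
  moreover have "\<exists>c. tame_chart K x c" if x: "x \<in> points M" for x
  proof -
    obtain U where U: "U \<in> F" "x \<in> U" using F(3) x by blast
    then obtain c where c: "tame_chart (k U) x c" using k by blast
    have "k U \<le> K" unfolding K_def using F(1) U by (intro Max_ge) auto
    then have "tame_chart K x c" using tame_chart_mono[OF c] k U(1) by blast
    then show ?thesis ..
  qed
  ultimately show ?thesis by blast
qed

end

section \<open>Definiteness of the metric, and regularity of the volume at small scales\<close>

section \<open>Volumes of balls\<close>

context compact_riemannian
begin

text \<open>A point at distance 0 from x falls into a tame chart about x, where \<open>rdist\<close>
  controls the coordinate distance.\<close>

lemma rdist_eq_0:
  assumes x: "x \<in> points M" and y: "y \<in> points M" and 0: "rdist x y = 0"
  shows "x = y"
proof -
  obtain K c where K: "1 \<le> K" and tame: "tame_chart K x c" using uniformly_tame x by blast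
  note D = tame_chartD[OF tame]
  have y': "y \<in> cdom c" "coord c y \<in> l1_ball n (coord c x) (1 / K)" using D(6)[OF y] 0 K by auto
  have "0 \<le> 1 / K" using K by simp
  then have "l1_dist n (coord c x) (coord c y) \<le> K * rdist x y"
    using D(5)[OF center_in_l1_ball[OF D(1,2)] y'(2)] D(1,2) y'(1) by simp
  then have "l1_dist n (coord c x) (coord c y) \<le> 0" by (simp add: 0)
  then have "coord c x = coord c y"
    by (rule l1_dist_eq_0[OF coord_extensional[OF D(1,2)] coord_extensional[OF D(1) y'(1)]])
  then show ?thesis by (rule inj_onD[OF coord_inj[OF D(1)] _ D(2) y'(1)])
qed

sublocale R: Metric_space "points M" rdist
proof
  show "0 \<le> rdist x y" for x y by (rule rdist_nonneg)
  show "rdist x y = rdist y x" for x y by (rule rdist_commute)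
  show "rdist x y = 0 \<longleftrightarrow> x = y" if "x \<in> points M" "y \<in> points M" for x y
    using rdist_eq_0[OF that] rdist_self by blast
  show "rdist x z \<le> rdist x y + rdist y z" if "x \<in> points M" "y \<in> points M" "z \<in> points M" for x y z
    by (rule rdist_triangle[OF that])
qed

text \<open>A tame chart places a coordinate ball, open in the manifold, inside each metric ball.
  This makes metric balls measurable for the volume.\<close>

lemma openin_mtopology:
  assumes U: "openin R.mtopology U" shows "openin (mtop M) U"
proof (subst openin_subopen, rule ballI)
  fix x assume xU: "x \<in> U"
  then have x: "x \<in> points M" using U openin_subset by fastforce
  obtain e where e: "e > 0" "R.mball x e \<subseteq> U" using U xU by (auto simp: R.openin_mtopology)
  obtain K c where K: "1 \<le> K" and tame: "tame_chart K x c" using uniformly_tame x by blast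
  note D = tame_chartD[OF tame]
  have K0: "0 \<le> 1 / K" "0 < K" using K by auto
  define r where "r = min (1 / K) (e / K)"
  have r: "0 < r" "r \<le> 1 / K" "K * r \<le> e" using K e(1) by (auto simp: r_def min_def field_simps)
  let ?T = "{y \<in> cdom c. l1_dist n (coord c x) (coord c y) < r}"
  have "y \<in> U" if "y \<in> ?T" for y
  proof -
    have y: "y \<in> cdom c" "l1_dist n (coord c x) (coord c y) < r" using that by auto
    have yb: "coord c y \<in> l1_ball n (coord c x) (1 / K)"
      using y r coord_extensional[OF D(1)] by (simp add: mem_l1_ball)
    have "rdist x y \<le> K * l1_dist n (coord c x) (coord c y)"
      using D(4)[OF center_in_l1_ball[OF D(1,2) K0(1)] yb] D(1,2) y(1) by simp
    also have "\<dots> < K * r" using y(2) K0(2) by simp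
    finally have "y \<in> R.mball x e" using r x y(1) cdom_subset[OF D(1)] by auto
    then show ?thesis using e by blast
  qed
  moreover have "x \<in> ?T" using D(2) r by simp
  moreover have "openin (mtop M) ?T" by (rule chart_ball_open[OF D(1)])
  ultimately show "\<exists>T. openin (mtop M) T \<and> x \<in> T \<and> T \<subseteq> U" by blast
qed

end

locale riemannian_with_volume = compact_riemannian M for M :: "'a riemannian_structure" +
  fixes vol :: "'a measure"
  assumes vol: "is_riemannian_volume M vol"
begin

lemma space_vol: "space vol = points M"
  using vol by (simp add: is_riemannian_volume_def)

lemma open_sets_vol:
  assumes "openin (mtop M) U" shows "U \<in> sets vol"
proof -
  have "sets vol = sigma_sets (points M) {U. openin (mtop M) U}"
    using vol by (simp add: is_riemannian_volume_def)
  then show ?thesis using assms by (auto intro: sigma_sets.Basic)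
qed

lemma closed_sets_vol:
  assumes "closedin (mtop M) C" shows "C \<in> sets vol"
proof -
  have "C = space vol - (points M - C)" using closedin_subset[OF assms] by (auto simp: space_vol)
  moreover have "points M - C \<in> sets vol" using assms by (intro open_sets_vol) auto
  ultimately show ?thesis by (metis sets.compl_sets)
qed

text \<open>Cubes are used for volumes because their product measure is a product of interval
  lengths.\<close>

definition box :: "(nat \<Rightarrow> real) \<Rightarrow> real \<Rightarrow> (nat \<Rightarrow> real) set"
  where "box u r = PiE {..<n} (\<lambda>i. {u i - r..u i + r})"

lemma mem_box: "v \<in> box u r \<longleftrightarrow> v \<in> extensional {..<n} \<and> (\<forall>i<n. \<bar>u i - v i\<bar> \<le> r)"
proof -
  have "v i \<in> {u i - r..u i + r} \<longleftrightarrow> \<bar>u i - v i\<bar> \<le> r" for i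
    unfolding abs_le_iff atLeastAtMost_iff by linarith
  then show ?thesis by (auto simp: box_def PiE_iff simp del: atLeastAtMost_iff)
qed

lemma l1_dist_box: "v \<in> box u r \<Longrightarrow> l1_dist n u v \<le> real n * r"
  unfolding l1_dist_def using sum_mono[of "{..<n}" "\<lambda>i. \<bar>u i - v i\<bar>" "\<lambda>_. r"] by (simp add: mem_box)

text \<open>The density lies between 1 / K and K on the cube, whose Lebesgue measure is (2 r)^n; its
  image is measurable because it is compact, hence closed.\<close>

lemma volume_box:
  assumes c: "c \<in> atlas M" and r: "0 \<le> r" "box u r \<subseteq> img c" and K: "1 \<le> K"
    and det: "\<forall>v\<in>box u r. 1 / K \<le> sqrt (gdet c v) \<and> sqrt (gdet c v) \<le> K"
  shows "coord_inv c ` box u r \<in> sets vol"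
    and "ennreal ((2 * r) ^ n / K) \<le> emeasure vol (coord_inv c ` box u r)"
    and "emeasure vol (coord_inv c ` box u r) \<le> ennreal (K * (2 * r) ^ n)"
proof -
  let ?L = "PiM {..<n} (\<lambda>_. lborel :: real measure)"
  interpret product_sigma_finite "\<lambda>_::nat. lborel :: real measure"
    by (simp add: product_sigma_finite_def lborel.sigma_finite_measure_axioms)
  have "compactin (real_space n) (box u r)"
    unfolding box_def real_space_def by (simp add: compactin_PiE)
  then have "closedin (mtop M) (coord_inv c ` box u r)" by (rule coord_inv_image_closed[OF c r(2)])
  then show B: "coord_inv c ` box u r \<in> sets vol" by (rule closed_sets_vol)
  have sub: "coord_inv c ` box u r \<subseteq> cdom c"
  proof
    fix x assume "x \<in> coord_inv c ` box u r"
    then obtain v where "v \<in> box u r" "x = coord_inv c v" by blast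
    then show "x \<in> cdom c" using coord_inv_in[OF subsetD[OF r(2)]] by simp
  qed
  have "coord c (coord_inv c v) = v" if "v \<in> box u r" for v
    by (rule coord_coord_inv[OF subsetD[OF r(2) that]])
  then have img: "coord c ` coord_inv c ` box u r = box u r" unfolding image_image by simp
  have em: "emeasure vol (coord_inv c ` box u r)
      = (\<integral>\<^sup>+v. ennreal (sqrt (gdet c v)) * indicator (box u r) v \<partial>?L)"
  proof -
    have "\<forall>c\<in>atlas M. \<forall>B\<in>sets vol. B \<subseteq> cdom c \<longrightarrow>
      emeasure vol B = (\<integral>\<^sup>+u\<in>coord c ` B. ennreal (sqrt (gdet c u)) \<partial>?L)"
      using vol unfolding is_riemannian_volume_def by blast
    from bspec[OF bspec[OF this c] B] sub show ?thesis unfolding img by simp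
  qed
  have "emeasure ?L (box u r) = (\<Prod>i<n. emeasure lborel {u i - r..u i + r})"
    unfolding box_def by (rule emeasure_PiM) auto
  also have "\<dots> = (\<Prod>i<n. ennreal (2 * r))" using r(1) by simp
  also have "\<dots> = ennreal ((2 * r) ^ n)" using r(1) by (simp add: ennreal_power)
  finally have L: "emeasure ?L (box u r) = ennreal ((2 * r) ^ n)" .
  have box_sets: "box u r \<in> sets ?L" unfolding box_def by (rule sets_PiM_I_finite) auto
  have "ennreal ((2 * r) ^ n / K) = ennreal (1 / K) * ennreal ((2 * r) ^ n)"
    using r K by (simp add: ennreal_mult[symmetric])
  also have "\<dots> = (\<integral>\<^sup>+v. ennreal (1 / K) * indicator (box u r) v \<partial>?L)"
    by (simp add: nn_integral_cmult_indicator[OF box_sets] L)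
  also have "\<dots> \<le> emeasure vol (coord_inv c ` box u r)"
    unfolding em using det by (intro nn_integral_mono) (auto simp: indicator_def intro!: ennreal_leI)
  finally show "ennreal ((2 * r) ^ n / K) \<le> emeasure vol (coord_inv c ` box u r)" .
  have "emeasure vol (coord_inv c ` box u r) \<le> (\<integral>\<^sup>+v. ennreal K * indicator (box u r) v \<partial>?L)"
    unfolding em using det by (intro nn_integral_mono) (auto simp: indicator_def intro!: ennreal_leI)
  also have "\<dots> = ennreal K * ennreal ((2 * r) ^ n)"
    by (simp add: nn_integral_cmult_indicator[OF box_sets] L)
  also have "\<dots> = ennreal (K * (2 * r) ^ n)" using r K by (simp add: ennreal_mult[symmetric])
  finally show "emeasure vol (coord_inv c ` box u r) \<le> ennreal (K * (2 * r) ^ n)" .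
qed

lemma finite_measure_vol: "finite_measure vol"
proof
  obtain K where K: "1 \<le> K" "\<forall>x\<in>points M. \<exists>c. tame_chart K x c" using uniformly_tame by blast
  \<comment> \<open>Small enough for the cube to fit into the l1 ball of radius 1 / K; n + 1 in
    place of n admits dimension 0.\<close>
  define \<rho> where "\<rho> = 1 / (K * (n + 1))"
  have \<rho>: "0 < \<rho>" "n * \<rho> \<le> 1 / K"
  proof -
    show "0 < \<rho>" using K(1) by (simp add: \<rho>_def)
    have "real n * \<rho> \<le> (real n + 1) * \<rho>" using \<open>0 < \<rho>\<close> by (intro mult_right_mono) auto
    also have "\<dots> = 1 / K" by (simp add: \<rho>_def add.commute)
    finally show "n * \<rho> \<le> 1 / K" .
  qed
  have "\<exists>F. finite F \<and> (\<forall>U\<in>F. openin (mtop M) U \<and> emeasure vol U < \<infinity>) \<and> points M \<subseteq> \<Union>F"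
  proof (rule finite_open_cover)
    fix p assume p: "p \<in> points M"
    obtain c where "tame_chart K p c" using K(2) p by blast
    note D = tame_chartD[OF this]
    let ?U = "{x \<in> cdom c. l1_dist n (coord c p) (coord c x) < \<rho>}"
    have box: "box (coord c p) \<rho> \<subseteq> l1_ball n (coord c p) (1 / K)"
    proof
      fix v assume v: "v \<in> box (coord c p) \<rho>"
      show "v \<in> l1_ball n (coord c p) (1 / K)"
        using l1_dist_box[OF v] \<rho>(2) v by (simp add: mem_l1_ball mem_box)
    qed
    have "\<forall>v\<in>box (coord c p) \<rho>. 1 / K \<le> sqrt (gdet c v) \<and> sqrt (gdet c v) \<le> K"
      by (intro ballI D(7) subsetD[OF box])
    note V = volume_box[OF D(1) less_imp_le[OF \<rho>(1)] order_trans[OF box D(3)] K(1) this]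
    have "?U \<subseteq> coord_inv c ` box (coord c p) \<rho>"
    proof
      fix x assume x: "x \<in> ?U"
      then have "coord c x \<in> box (coord c p) \<rho>"
        using abs_diff_le_l1_dist[of _ n "coord c p" "coord c x"] coord_extensional[OF D(1)]
        by (force simp: mem_box)
      then show "x \<in> coord_inv c ` box (coord c p) \<rho>"
        using x D(1) by (intro image_eqI[of _ _ "coord c x"]) auto
    qed
    then have "emeasure vol ?U \<le> ennreal (K * (2 * \<rho>) ^ n)"
      by (rule order_trans[OF emeasure_mono[OF _ V(1)] V(3)])
    then have "emeasure vol ?U < \<infinity>" by (simp add: le_less_trans[OF _ ennreal_less_top])
    moreover have "openin (mtop M) ?U" by (rule chart_ball_open[OF D(1)])
    moreover have "p \<in> ?U" using D(2) \<rho> by simp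
    ultimately show "\<exists>U. openin (mtop M) U \<and> p \<in> U \<and> emeasure vol U < \<infinity>" by blast
  qed
  then obtain F where F: "finite F" "\<forall>U\<in>F. openin (mtop M) U \<and> emeasure vol U < \<infinity>" "points M \<subseteq> \<Union>F"
    by blast
  have sets: "(\<lambda>U. U) ` F \<subseteq> sets vol" using F(2) open_sets_vol by auto
  have "emeasure vol (space vol) \<le> emeasure vol (\<Union>U\<in>F. U)"
    using F sets by (intro emeasure_mono sets.finite_UN) (auto simp: space_vol)
  also have "\<dots> \<le> (\<Sum>U\<in>F. emeasure vol U)" by (rule emeasure_subadditive_finite[OF F(1) sets])
  also have "\<dots> < \<infinity>" using F by simp
  finally show "emeasure vol (space vol) \<noteq> \<infinity>" by simp
qed

text \<open>A metric ball of radius r lies between the images of coordinate cubes with half sides r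
  / (K (n + 1)) and K r.\<close>

lemma volume_balls:
  "\<exists>K\<ge>1. (\<forall>x\<in>points M. \<exists>c. tame_chart K x c) \<and>
    (\<forall>x\<in>points M. \<forall>r. 0 < r \<longrightarrow> r \<le> 1 / K \<longrightarrow>
      r ^ n \<le> K * measure vol (R.mball x r) \<and> measure vol (R.mball x r) \<le> K * r ^ n)"
proof -
  interpret finite_measure vol by (rule finite_measure_vol)
  obtain K where K: "1 \<le> K" "\<forall>x\<in>points M. \<exists>c. tame_chart K x c" using uniformly_tame by blast
  \<comment> \<open>The first entry preserves tameness, the second keeps both cubes inside the
    chart, and the last two are the resulting volume constants.\<close>
  define C where "C = Max {K, K\<^sup>2 * (n + 1), K * (K * (n + 1) / 2) ^ n, K * (2 * K) ^ n}"
  have C: "K \<le> C" "K\<^sup>2 * (n + 1) \<le> C" "K * (K * (n + 1) / 2) ^ n \<le> C" "K * (2 * K) ^ n \<le> C"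
    unfolding C_def by (auto intro!: Max_ge)
  have "r ^ n \<le> C * measure vol (R.mball x r) \<and> measure vol (R.mball x r) \<le> C * r ^ n"
    if x: "x \<in> points M" and r: "0 < r" "r \<le> 1 / C" for x r
  proof -
    obtain c where "tame_chart K x c" using K(2) x by blast
    note D = tame_chartD[OF this]
    let ?u = "coord c x"
    have K0: "0 \<le> 1 / K" "0 < K" using K by auto
    have "0 < K\<^sup>2 * (n + 1)" using K0 by simp
    then have "1 / C \<le> 1 / (K\<^sup>2 * (n + 1))" using C by (intro divide_left_mono) auto
    then have r': "r \<le> 1 / (K\<^sup>2 * (n + 1))" using r by linarith
    have "r * (K\<^sup>2 * (n + 1)) \<le> 1" using r' \<open>0 < K\<^sup>2 * (n + 1)\<close> pos_le_divide_eq by blast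
    then have rK: "r * K\<^sup>2 + r * K\<^sup>2 * n \<le> 1" by (simp add: algebra_simps)
    have nn: "0 \<le> r * K\<^sup>2 * n" "0 < r * K\<^sup>2" using r K0 by auto
    have KK: "K \<le> K\<^sup>2" using K self_le_power[of K 2] by simp
    have r1: "r \<le> 1"
    proof -
      have "r * 1 \<le> r * K\<^sup>2" using r K KK by (intro mult_left_mono) auto
      then show ?thesis using rK nn by linarith
    qed
    have mb: "R.mball x r \<in> sets vol" by (intro open_sets_vol openin_mtopology R.openin_mball)
    have cx: "?u \<in> l1_ball n ?u (1 / K)" by (rule center_in_l1_ball[OF D(1,2) K0(1)])
    have inv_x: "coord_inv c ?u = x" using D(1,2) by simp
    have box: "box ?u s \<subseteq> l1_ball n ?u (1 / K)" if "real n * s \<le> 1 / K" for s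
    proof
      fix v assume v: "v \<in> box ?u s"
      show "v \<in> l1_ball n ?u (1 / K)"
        using l1_dist_box[OF v] that v by (simp add: mem_l1_ball mem_box)
    qed
    have "r ^ n \<le> C * measure vol (R.mball x r)"
    proof -
      \<comment> \<open>With n + 1 in place of n, K * n * s is strictly below r, as the open ball
        requires.\<close>
      define s where "s = r / (K * (n + 1))"
      have s0: "0 < s" unfolding s_def using r K0 by (intro divide_pos_pos mult_pos_pos) auto
      have "K * (real n * s) < K * ((real n + 1) * s)"
        using s0 K0 by (intro mult_strict_left_mono mult_strict_right_mono) auto
      also have "\<dots> = r"
      proof -
        have "real n + 1 \<noteq> 0" by linarith
        then show ?thesis using K0 by (simp add: s_def add.commute)
      qed
      finally have s: "0 < s" "K * (real n * s) < r" using s0 by auto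
      have "n * s \<le> 1 / K" using s(2) r1 K0 by (simp add: field_simps)
      note bs = box[OF this]
      have "\<forall>v\<in>box ?u s. 1 / K \<le> sqrt (gdet c v) \<and> sqrt (gdet c v) \<le> K"
        by (intro ballI D(7) subsetD[OF bs])
      note V = volume_box[OF D(1) less_imp_le[OF s(1)] order_trans[OF bs D(3)] K(1) this]
      have "coord_inv c ` box ?u s \<subseteq> R.mball x r"
      proof
        fix y assume "y \<in> coord_inv c ` box ?u s"
        then obtain v where v: "v \<in> box ?u s" "y = coord_inv c v" by blast
        have "rdist x y \<le> K * l1_dist n ?u v" using D(4)[OF cx subsetD[OF bs v(1)]] inv_x v by simp
        also have "\<dots> \<le> K * (n * s)" using l1_dist_box[OF v(1)] K0 by (intro mult_left_mono) auto
        also have "\<dots> < r" by (rule s)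
        finally show "y \<in> R.mball x r"
          using x v(2) coord_inv_point[OF D(1) subsetD[OF D(3) subsetD[OF bs v(1)]]] by simp
      qed
      then have "ennreal ((2 * s) ^ n / K) \<le> emeasure vol (R.mball x r)"
        by (rule order_trans[OF V(2) emeasure_mono[OF _ mb]])
      then have "(2 * s) ^ n / K \<le> measure vol (R.mball x r)"
        by (simp add: emeasure_eq_measure ennreal_le_iff)
      then have "(K * (K * (n + 1) / 2) ^ n) * ((2 * s) ^ n / K)
          \<le> (K * (K * (n + 1) / 2) ^ n) * measure vol (R.mball x r)"
        using K0 by (intro mult_left_mono) auto
      also have "(K * (K * (n + 1) / 2) ^ n) * ((2 * s) ^ n / K) = r ^ n"
      proof -
        have "r = (K * (n + 1) / 2) * (2 * s)" using K0 by (simp add: s_def)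
        then have "r ^ n = (K * (n + 1) / 2) ^ n * (2 * s) ^ n" by (metis power_mult_distrib)
        then show ?thesis using K0 by simp
      qed
      also have "(K * (K * (n + 1) / 2) ^ n) * measure vol (R.mball x r) \<le> C * measure vol (R.mball x r)" by (intro mult_right_mono C) simp
      finally show ?thesis .
    qed
    moreover have "measure vol (R.mball x r) \<le> C * r ^ n"
    proof -
      define s where "s = K * r"
      have s: "0 < s" using r K0 by (simp add: s_def)
      have "n * s * K \<le> 1" using rK nn by (simp add: s_def power2_eq_square mult_ac)
      then have "n * s \<le> 1 / K" using K0 by (simp add: field_simps)
      note bs = box[OF this]
      have "\<forall>v\<in>box ?u s. 1 / K \<le> sqrt (gdet c v) \<and> sqrt (gdet c v) \<le> K"
        by (intro ballI D(7) subsetD[OF bs])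
      note V = volume_box[OF D(1) less_imp_le[OF s] order_trans[OF bs D(3)] K(1) this]
      have rK2: "r \<le> 1 / K\<^sup>2" using rK nn K0 by (simp add: field_simps)
      have "R.mball x r \<subseteq> coord_inv c ` box ?u s"
      proof
        fix y assume "y \<in> R.mball x r"
        then have y: "y \<in> points M" "rdist x y < r" by auto
        then have y': "y \<in> cdom c" "coord c y \<in> l1_ball n ?u (1 / K)" using D(6)[OF y(1)] rK2 by auto
        have "l1_dist n ?u (coord c y) \<le> K * rdist x y" using D(5)[OF cx y'(2)] inv_x y'(1) D(1) by simp
        also have "\<dots> \<le> s" unfolding s_def using y K0 by (intro mult_left_mono) auto
        finally have l: "l1_dist n ?u (coord c y) \<le> s" .
        have "\<bar>?u i - coord c y i\<bar> \<le> s" if "i < n" for i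
          using abs_diff_le_l1_dist[OF that, of ?u "coord c y"] l by linarith
        then have "coord c y \<in> box ?u s" using y'(2) by (simp add: mem_box mem_l1_ball)
        then show "y \<in> coord_inv c ` box ?u s" using y'(1) D(1) by (intro image_eqI[of _ _ "coord c y"]) auto
      qed
      then have "emeasure vol (R.mball x r) \<le> ennreal (K * (2 * s) ^ n)"
        by (rule order_trans[OF emeasure_mono[OF _ V(1)] V(3)])
      then have "measure vol (R.mball x r) \<le> K * (2 * s) ^ n"
        using K0 s by (simp add: emeasure_eq_measure ennreal_le_iff)
      also have "\<dots> = (K * (2 * K) ^ n) * r ^ n" by (simp add: s_def power_mult_distrib)
      also have "\<dots> \<le> C * r ^ n" using r by (intro mult_right_mono C) simp
      finally show ?thesis .
    qed
    ultimately show ?thesis ..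
  qed
  moreover have "\<exists>c. tame_chart C x c" if "x \<in> points M" for x
    using K(2) that tame_chart_mono[OF _ K(1) C(1)] by blast
  moreover have "1 \<le> C" using K(1) C(1) by linarith
  ultimately show ?thesis by blast
qed

end

section \<open>Riemannian warped cones as instances of the abstract levels\<close>

section \<open>Warped cones\<close>

text \<open>Coordinates are translated to put x at the origin, and restricted to the index range so
  that the sum is a point of the coordinate space.\<close>

lemma (in riemannian_with_volume) lipschitz_chart_of_tame:
  assumes K: "1 \<le> K" and tame: "tame_chart K x c"
  shows "lipschitz_chart (points M) rdist n K x (\<lambda>u. coord_inv c (\<lambda>i\<in>{..<n}. coord c x i + u i))"
proof -
  note D = tame_chartD[OF tame]
  define s where "s u = (\<lambda>i\<in>{..<n}. coord c x i + u i)" for u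
  have s_dist: "l1_dist n (s u) (s v) = l1_dist n u v" for u v
    unfolding l1_dist_def by (intro sum.cong) (auto simp: s_def)
  have s0: "s (\<lambda>_. 0) = coord c x"
    using coord_extensional[OF D(1,2)] by (auto simp: s_def extensional_def fun_eq_iff)
  have s_ball: "s u \<in> l1_ball n (coord c x) (1 / K)" if "l1_dist n (\<lambda>_. 0) u \<le> 1 / K" for u
    using that s_dist[of "\<lambda>_. 0" u] unfolding s0 by (simp add: mem_l1_ball) (simp add: s_def)
  show ?thesis
    unfolding lipschitz_chart_def s_def[symmetric]
  proof (intro conjI allI impI ballI)
    show "coord_inv c (s (\<lambda>_. 0)) = x" using s0 D(1,2) by simp
    fix u v assume "l1_dist n (\<lambda>_. 0) u \<le> 1 / K" "l1_dist n (\<lambda>_. 0) v \<le> 1 / K"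
    then have uv: "s u \<in> l1_ball n (coord c x) (1 / K)" "s v \<in> l1_ball n (coord c x) (1 / K)"
      by (auto intro: s_ball)
    show "coord_inv c (s u) \<in> points M" by (rule coord_inv_point[OF D(1) subsetD[OF D(3) uv(1)]])
    show "rdist (coord_inv c (s u)) (coord_inv c (s v)) \<le> K * l1_dist n u v"
      using D(4)[OF uv] by (simp add: s_dist)
    show "l1_dist n u v \<le> K * rdist (coord_inv c (s u)) (coord_inv c (s v))"
      using D(5)[OF uv] by (simp add: s_dist)
  next
    fix y assume y: "y \<in> points M" "rdist x y < 1 / K\<^sup>2"
    have y': "y \<in> cdom c" "coord c y \<in> l1_ball n (coord c x) (1 / K)" using D(6)[OF y] by auto
    define u where "u i = coord c y i - coord c x i" for i
    have su: "s u = coord c y"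
      using coord_extensional[OF D(1) y'(1)] by (auto simp: s_def u_def extensional_def fun_eq_iff)
    have "l1_dist n (\<lambda>_. 0) u = l1_dist n (coord c x) (coord c y)"
      using s_dist[of "\<lambda>_. 0" u] unfolding su s0 by simp
    then show "\<exists>u. l1_dist n (\<lambda>_. 0) u \<le> 1 / K \<and> y = coord_inv c (s u)"
      using y' su D(1) by (intro exI[of _ u]) (simp add: mem_l1_ball)
  qed
qed

context compact_riemannian
begin

text \<open>Pulling a competitor back along a group element gives a competitor, so the action cannot
  increase the supremum; the inverse element gives the other inequality.\<close>

lemma rdist_isometry:
  assumes "isometric_action G M \<phi>" "group G" and g: "g \<in> carrier G" and x: "x \<in> points M" and y: "y \<in> points M"
  shows "rdist (\<phi> g x) (\<phi> g y) = rdist x y"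
proof -
  interpret group G by (rule assms)
  interpret group_action G "points M" \<phi> using assms(1) by (simp add: isometric_action_def)
  have iso: "riemannian_dist M (\<phi> h z) (\<phi> h w) = riemannian_dist M z w"
    if "h \<in> carrier G" "z \<in> points M" "w \<in> points M" for h z w
    using assms(1) that by (simp add: isometric_action_def)
  have cl: "\<phi> h z \<in> points M" if "h \<in> carrier G" "z \<in> points M" for h z
    using element_image[OF that refl] .
  have le: "rdist (\<phi> h z) (\<phi> h w) \<le> rdist z w" if h: "h \<in> carrier G" and z: "z \<in> points M" and w: "w \<in> points M" for h z w
  proof (rule rdist_le)
    fix \<rho> assume \<rho>: "\<rho> \<in> sub_dists"
    have "(\<lambda>z w. \<rho> (\<phi> h z) (\<phi> h w)) \<in> sub_dists"
      unfolding sub_dists_def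
    proof (intro CollectI conjI ballI)
      fix a b assume ab: "a \<in> points M" "b \<in> points M"
      note s = sub_distsD[OF \<rho> cl[OF h ab(1)] cl[OF h ab(2)]]
      show "0 \<le> \<rho> (\<phi> h a) (\<phi> h b)" "\<rho> (\<phi> h a) (\<phi> h b) \<le> 1" "\<rho> (\<phi> h a) (\<phi> h b) = \<rho> (\<phi> h b) (\<phi> h a)"
        by (rule s)+
      show "ennreal (\<rho> (\<phi> h a) (\<phi> h b)) \<le> riemannian_dist M a b"
        using s(4) iso[OF h ab] by simp
      fix c assume "c \<in> points M"
      then show "\<rho> (\<phi> h a) (\<phi> h c) \<le> \<rho> (\<phi> h a) (\<phi> h b) + \<rho> (\<phi> h b) (\<phi> h c)"
        using s(6) cl[OF h] by blast
    next
      fix a assume "a \<in> points M"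
      then show "\<rho> (\<phi> h a) (\<phi> h a) = 0" using sub_distsD(5)[OF \<rho>] cl[OF h] by blast
    qed
    from rdist_ge[OF this z w] show "\<rho> (\<phi> h z) (\<phi> h w) \<le> rdist z w" .
  qed
  have inv_act: "\<phi> (inv\<^bsub>G\<^esub> g) (\<phi> g z) = z" if "z \<in> points M" for z
    by (rule orbit_sym_aux[OF g that refl])
  have "rdist x y = rdist (\<phi> (inv\<^bsub>G\<^esub> g) (\<phi> g x)) (\<phi> (inv\<^bsub>G\<^esub> g) (\<phi> g y))"
    using inv_act[OF x] inv_act[OF y] by simp
  also have "\<dots> \<le> rdist (\<phi> g x) (\<phi> g y)" by (rule le[OF inv_closed[OF g] cl[OF g x] cl[OF g y]])
  finally show ?thesis using le[OF g x y] by linarith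
qed

text \<open>The metric \<delta> / t cut off at 1 is a competitor and hence at most
  \<open>rdist\<close>; where \<open>rdist\<close> is below 1 the cut-off is inactive.\<close>

lemma warped_metric_le_rdist:
  assumes w: "warped_metric S \<phi> M t \<delta>" and t: "0 < t" and x: "x \<in> points M" and y: "y \<in> points M"
    and lt: "rdist x y < 1"
  shows "\<delta> x y \<le> t * rdist x y"
proof -
  have adm: "warped_admissible S \<phi> M t \<delta>" using w by (simp add: warped_metric_def)
  then have met: "Metric_space (points M) \<delta>"
    and le: "\<And>x y. x \<in> points M \<Longrightarrow> y \<in> points M \<Longrightarrow> ennreal (\<delta> x y) \<le> ennreal t * riemannian_dist M x y"
    by (auto simp: warped_admissible_def)
  interpret D: Metric_space "points M" \<delta> by (rule met)
  define \<rho> where "\<rho> = (\<lambda>x y. min (\<delta> x y / t) 1)"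
  have "\<rho> \<in> sub_dists"
    unfolding sub_dists_def
  proof (intro CollectI conjI ballI)
    fix a b assume ab: "a \<in> points M" "b \<in> points M"
    show "0 \<le> \<rho> a b" "\<rho> a b \<le> 1" "\<rho> a b = \<rho> b a"
      using t D.nonneg[of a b] D.commute[of a b] by (auto simp: \<rho>_def)
    show "ennreal (\<rho> a b) \<le> riemannian_dist M a b"
    proof (cases "riemannian_dist M a b")
      case (real r)
      then have "ennreal (\<delta> a b) \<le> ennreal (t * r)" using le[OF ab] t by (simp add: ennreal_mult)
      then have "\<delta> a b \<le> t * r" using real t by (simp add: ennreal_le_iff)
      then have "\<delta> a b / t \<le> r" using t by (simp add: divide_le_eq mult.commute)
      then have "\<rho> a b \<le> r" by (simp add: \<rho>_def)
      then show ?thesis using real by (simp add: ennreal_leI)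
    qed simp
    fix c assume c: "c \<in> points M"
    have "\<delta> a c / t \<le> \<delta> a b / t + \<delta> b c / t"
      using D.triangle[OF ab c] t by (simp add: add_divide_distrib[symmetric] divide_right_mono)
    moreover have "0 \<le> \<delta> a b / t" "0 \<le> \<delta> b c / t" using t by auto
    ultimately show "\<rho> a c \<le> \<rho> a b + \<rho> b c" by (auto simp: \<rho>_def min_def)
  next
    fix a assume "a \<in> points M"
    then show "\<rho> a a = 0" using t by (simp add: \<rho>_def)
  qed
  from rdist_ge[OF this x y] lt have "\<delta> x y / t \<le> rdist x y" by (auto simp: \<rho>_def min_def split: if_splits)
  then show ?thesis using t by (simp add: divide_le_eq mult.commute)
qed

end

text \<open>Maximality of \<delta> is played against the admissible metric
  \<open>orbit_dist\<close>, which gives the lower bound in \<open>level\<close>; the upper bound is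
  \<open>warped_metric_le_rdist\<close>.\<close>

lemma warped_space_of_action:
  fixes G :: "'g monoid" and M :: "'a riemannian_structure"
  assumes G: "group G" and S: "finite_symmetric_generating_set G S"
    and M: "compact_riemannian_manifold M" and iso: "isometric_action G M \<phi>" and free: "essentially_free G M \<phi>"
  shows "\<exists>d \<mu> K. warped_space G S \<phi> (points M) d \<mu> (mdim M) K \<and>
    (\<forall>t \<delta>. 1 \<le> t \<longrightarrow> warped_metric S \<phi> M t \<delta> \<longrightarrow> warped_space.level G S \<phi> (points M) d t \<delta>)"
proof -
  obtain vol where vol: "is_riemannian_volume M vol"
    and null: "{x \<in> points M. stabilizer G \<phi> x \<noteq> {\<one>\<^bsub>G\<^esub>}} \<in> null_sets vol"
    using free by (auto simp: essentially_free_def)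
  interpret riemannian_with_volume M vol
    by unfold_locales (rule M, rule vol)
  have act: "group_action G (points M) \<phi>" using iso by (simp add: isometric_action_def)
  obtain K where K: "1 \<le> K" "\<forall>x\<in>points M. \<exists>c. tame_chart K x c"
    "\<forall>x\<in>points M. \<forall>r. 0 < r \<longrightarrow> r \<le> 1 / K \<longrightarrow>
      r ^ n \<le> K * measure vol (R.mball x r) \<and> measure vol (R.mball x r) \<le> K * r ^ n"
    using volume_balls by blast
  have borel: "U \<in> sets vol" if "openin R.mtopology U" for U
    by (rule open_sets_vol[OF openin_mtopology[OF that]])
  have W: "warped_space G S \<phi> (points M) rdist vol n K"
  proof (intro warped_space.intro warped_space_axioms.intro marked_group.intro marked_group_axioms.intro
      G S act R.Metric_space_axioms finite_measure_vol K(1) nonempty_points borel)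
    fix g x y assume "g \<in> carrier G" "x \<in> points M" "y \<in> points M"
    then show "rdist (\<phi> g x) (\<phi> g y) = rdist x y" by (rule rdist_isometry[OF iso G])
  next
    fix g assume g: "g \<in> carrier G" "g \<noteq> \<one>\<^bsub>G\<^esub>"
    interpret group_action G "points M" \<phi> by (rule act)
    have cl: "\<phi> g x \<in> points M" if "x \<in> points M" for x using element_image[OF g(1) that refl] .
    \<comment> \<open>The fixed point set of g is closed, hence measurable; this has to be known
      before it inherits nullness from the set of points with nontrivial stabilizer.\<close>
    have "openin R.mtopology {x \<in> points M. \<phi> g x \<noteq> x}"
      unfolding R.openin_mtopology
    proof (intro conjI allI impI)
      fix x assume "x \<in> {x \<in> points M. \<phi> g x \<noteq> x}"
      then have x: "x \<in> points M" "\<phi> g x \<noteq> x" by auto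
      define e where "e = rdist (\<phi> g x) x / 2"
      have e: "0 < e" using x cl[OF x(1)] R.zero[of "\<phi> g x" x] rdist_nonneg[of "\<phi> g x" x]
        by (simp add: e_def order_less_le)
      have "\<phi> g y \<noteq> y" if y: "y \<in> R.mball x e" for y
      proof
        assume fix_y: "\<phi> g y = y"
        have yX: "y \<in> points M" and d: "rdist x y < e" using y by auto
        have "rdist (\<phi> g x) x \<le> rdist (\<phi> g x) (\<phi> g y) + rdist y x"
          using rdist_triangle[OF cl[OF x(1)] yX x(1)] fix_y by simp
        also have "rdist (\<phi> g x) (\<phi> g y) = rdist x y" by (rule rdist_isometry[OF iso G g(1) x(1) yX])
        also have "rdist y x = rdist x y" by (rule rdist_commute)
        finally show False using d by (simp add: e_def)
      qed
      then have "R.mball x e \<subseteq> {x \<in> points M. \<phi> g x \<noteq> x}" by auto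
      then show "\<exists>r>0. R.mball x r \<subseteq> {x \<in> points M. \<phi> g x \<noteq> x}" using e by blast
    qed auto
    from borel[OF this] have "space vol - {x \<in> points M. \<phi> g x \<noteq> x} \<in> sets vol" by (rule sets.compl_sets)
    moreover have "space vol - {x \<in> points M. \<phi> g x \<noteq> x} = {x \<in> points M. \<phi> g x = x}"
      by (auto simp: space_vol)
    ultimately have "{x \<in> points M. \<phi> g x = x} \<in> sets vol" by simp
    moreover have "{x \<in> points M. \<phi> g x = x} \<subseteq> {x \<in> points M. stabilizer G \<phi> x \<noteq> {\<one>\<^bsub>G\<^esub>}}"
      using g by (auto simp: stabilizer_def)
    ultimately show "{x \<in> points M. \<phi> g x = x} \<in> null_sets vol"
      using null by (meson null_sets_subset)
  next
    fix x r assume "x \<in> points M" "(0::real) < r" "r \<le> 1 / K"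
    then show "r ^ n \<le> K * measure vol (R.mball x r)" "measure vol (R.mball x r) \<le> K * r ^ n"
      using K(3) by blast+
  next
    fix x assume "x \<in> points M"
    then obtain c where "tame_chart K x c" using K(2) by blast
    from lipschitz_chart_of_tame[OF K(1) this] show "\<exists>\<kappa>. lipschitz_chart (points M) rdist n K x \<kappa>"
      by (rule exI[of "lipschitz_chart (points M) rdist n K x"])
  qed
  interpret W: warped_space G S \<phi> "points M" rdist vol n K by (rule W)
  have "W.level t \<delta>" if t: "1 \<le> t" and w: "warped_metric S \<phi> M t \<delta>" for t \<delta>
  proof -
    have t0: "0 < t" "0 \<le> t" using t by auto
    have adm: "warped_admissible S \<phi> M t \<delta>" using w by (simp add: warped_metric_def)
    have adm': "warped_admissible S \<phi> M t (W.orbit_dist t)"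
      unfolding warped_admissible_def
    proof (intro conjI ballI)
      show "Metric_space (points M) (W.orbit_dist t)" by (rule W.orbit_dist_metric[OF t0(1)])
      fix x y assume xy: "x \<in> points M" "y \<in> points M"
      have "ennreal (W.orbit_dist t x y) \<le> ennreal (t * rdist x y)"
        by (rule ennreal_leI[OF W.orbit_dist_le_scaled[OF t0(2) xy]])
      also have "\<dots> = ennreal t * ennreal (rdist x y)" by (rule ennreal_mult[OF t0(2) rdist_nonneg])
      also have "\<dots> \<le> ennreal t * riemannian_dist M x y"
        by (rule mult_left_mono[OF rdist_le_riemannian_dist[OF xy]]) simp
      finally show "ennreal (W.orbit_dist t x y) \<le> ennreal t * riemannian_dist M x y" .
    next
      fix x s assume "x \<in> points M" "s \<in> S"
      then show "W.orbit_dist t x (\<phi> s x) \<le> 1" by (rule W.orbit_dist_gen[OF t0(2)])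
    qed
    show ?thesis
    proof (rule W.level_if_ge_orbit_dist[OF t0(1)])
      show "Metric_space (points M) \<delta>" using adm by (simp add: warped_admissible_def)
      show "\<delta> x y \<le> t * rdist x y" if "x \<in> points M" "y \<in> points M" "rdist x y < 1" for x y
        by (rule warped_metric_le_rdist[OF w t0(1) that])
      show "\<delta> x (\<phi> s x) \<le> 1" if "x \<in> points M" "s \<in> S" for x s
        using adm that by (simp add: warped_admissible_def)
      show "W.orbit_dist t x y \<le> \<delta> x y" if "x \<in> points M" "y \<in> points M" for x y
        using w adm' that unfolding warped_metric_def by blast
    qed
  qed
  with W show ?thesis by blast
qed

theorem theorem2:
  fixes \<Gamma> :: "'g monoid" and \<Lambda> :: "'h monoid"
    and S :: "'g set" and T :: "'h set"
    and M :: "'a riemannian_structure" and N :: "'b riemannian_structure"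
    and \<phi> :: "'g \<Rightarrow> 'a \<Rightarrow> 'a" and \<psi> :: "'h \<Rightarrow> 'b \<Rightarrow> 'b"
  assumes "group \<Gamma>" and "finite_symmetric_generating_set \<Gamma> S"
    and "group \<Lambda>" and "finite_symmetric_generating_set \<Lambda> T"
    and "compact_riemannian_manifold M" and "compact_riemannian_manifold N"
    and "isometric_action \<Gamma> M \<phi>" and "essentially_free \<Gamma> M \<phi>"
    and "isometric_action \<Lambda> N \<psi>" and "essentially_free \<Lambda> N \<psi>"
    and "warped_cones_quasi_isometric S \<phi> M T \<psi> N"
  shows "quasi_isometric_groups (\<Gamma> \<times>\<times> free_abelian_of_rank (mdim M))
                                (\<Lambda> \<times>\<times> free_abelian_of_rank (mdim N))"
proof -
  from warped_space_of_action[OF assms(1,2,5,7,8)] obtain d \<mu> K where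
    M: "warped_space \<Gamma> S \<phi> (points M) d \<mu> (mdim M) K"
    and levM: "\<forall>t \<delta>. 1 \<le> t \<longrightarrow> warped_metric S \<phi> M t \<delta> \<longrightarrow> warped_space.level \<Gamma> S \<phi> (points M) d t \<delta>"
    by (elim exE conjE)
  from warped_space_of_action[OF assms(3,4,6,9,10)] obtain e \<nu> K' where
    N: "warped_space \<Lambda> T \<psi> (points N) e \<nu> (mdim N) K'"
    and levN: "\<forall>t \<delta>. 1 \<le> t \<longrightarrow> warped_metric T \<psi> N t \<delta> \<longrightarrow> warped_space.level \<Lambda> T \<psi> (points N) e t \<delta>"
    by (elim exE conjE)
  from assms(11) obtain t s \<delta> \<epsilon> where
    t: "filterlim t at_top sequentially" "\<forall>k. 1 \<le> t k"
    and s: "filterlim s at_top sequentially" "\<forall>k. 1 \<le> s k"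
    and w: "\<forall>k. warped_metric S \<phi> M (t k) (\<delta> k)" "\<forall>k. warped_metric T \<psi> N (s k) (\<epsilon> k)"
    and qi: "uniformly_quasi_isometric (\<lambda>_. points M) \<delta> (\<lambda>_. points N) \<epsilon>"
    unfolding warped_cones_quasi_isometric_def by (elim exE conjE)
  from qi obtain L A where "\<forall>k. \<exists>f. quasi_isometry L A (points M) (\<delta> k) (points N) (\<epsilon> k) f"
    unfolding uniformly_quasi_isometric_def by (elim exE)
  from choice[OF this] obtain f where
    f: "\<forall>k. quasi_isometry L A (points M) (\<delta> k) (points N) (\<epsilon> k) (f k)" ..
  have "warped_pair \<Gamma> S \<phi> (points M) d \<mu> (mdim M) K \<Lambda> T \<psi> (points N) e \<nu> (mdim N) K' t s \<delta> \<epsilon> f L A"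
  proof (intro warped_pair.intro warped_pair_axioms.intro M N t(1) s(1))
    fix k
    show "warped_space.level \<Gamma> S \<phi> (points M) d (t k) (\<delta> k)" using levM t(2) w(1) by simp
    show "warped_space.level \<Lambda> T \<psi> (points N) e (s k) (\<epsilon> k)" using levN s(2) w(2) by simp
    show "quasi_isometry L A (points M) (\<delta> k) (points N) (\<epsilon> k) (f k)" using f by simp
  qed
  then show ?thesis by (rule warped_pair.quasi_isometric_groups_prod)
qed

end
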